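(* Let $\lambda\vdash n$, let $i$ be a part of $\lambda$ and let $1\le p\le n-1$. Let $d^{p,n-1}_{\lambda,i}$ be the number of $(p,n-1,n)$-dipoles (with unlabelled ordinary edges) having face degree sequence $2\lambda$ and root face of degree $2i$, i.e. the number of $n$-cycles $\sigma\in\mathfrak{S}_n$ with $\sigma^{-1}(n)=n-1$ and $\sigma C_p\in\mathcal{C}_{\lambda,i}$, where $C_p=(n,1,\ldots,p-1,n-1,p,\ldots,n-2)$. Then \[ d^{p,n-1}_{\lambda,i}=\frac{|\mathcal{C}_{\lambda,i}|\,(n-2)!}{n!}\left(A^{\lambda,i}_{n,p}+B^{\lambda,i}_{n,p}+C^{\lambda,i}_{n,p}\right), \] where \[ A^{\lambda,i}_{n,p}=\sum_{0\le k\le n-2}\frac{(-1)^k\gamma^{(n-k,1^k),n-k}_{\lambda,i}\gamma^{(n-k,1^k),n-k}_{(p,n-p),p}}{d_{(n-k-1,1^k)}}\,\frac{n-1}{n-k-1}, \] \[ B^{\lambda,i}_{n,p}=\sum_{1\le k\le n-1}\frac{(-1)^{k-1}\gamma^{(n-k,1^k),1}_{\lambda,i}\gamma^{(n-k,1^k),1}_{(p,n-p),p}}{d_{(n-k,1^{k-1})}}\,\frac{n-1}{k}, \] \[ C^{\lambda,i}_{n,p}=\sum_{1\le k\le n-3}\frac{(-1)^k\gamma^{(n-k-1,2,1^{k-1}),2}_{\lambda,i}\gamma^{(n-k-1,2,1^{k-1}),2}_{(p,n-p),p}}{d_{(n-k-1,1^k)}}\,\frac{nk(n-k-2)}{(n-k-1)(k+1)}.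 \]
   Context: For $\lambda\vdash n$ and a part $i$ of $\lambda$, $\mathcal{C}_{\lambda,i}$ is the set of permutations in $\mathfrak{S}_n$ of cycle type $\lambda$ with $n$ on a cycle of length $i$, and $K_{\lambda,i}=\sum_{\pi\in\mathcal{C}_{\lambda,i}}\pi$; these form a basis of $Z_1(n)$, the centralizer of $\mathfrak{S}_{n-1}$ in $\mathbb{C}[\mathfrak{S}_n]$, and $[K_{\mu,j}]X$ denotes the coefficient of $K_{\mu,j}$ in $X\in Z_1(n)$. For a standard Young tableau $T$ with $n$ boxes, $c_T(k)=(\text{column})-(\text{row})$ of the box containing $k$. Jucys–Murphy elements: $J_k=\sum_{1\le a<k}(a,k)$. For a standard Young tableau $T$ of shape $\lambda\vdash n$, $e_T$ is the Young seminormal unit: the primitive idempotent of the subalgebra generated by $J_1,\ldots,J_n$ on which each $J_k$ acts by $c_T(k)$. $d_\lambda$ is the number of standard Young tableaux of shape $\lambda$; $\mathrm{SYT}_{\lambda,i}$ is the set of standard Young tableaux of shape $\lambda$ with $n$ at the end of a row of length $i$; $\Gamma^{\lambda,i}=\sum_{T\in\mathrm{SYT}_{\lambda,i}}e_T$; and $\gamma^{\lambda,i}_{\mu,j}=\frac{n!}{d_\lambda}[K_{\mu,j}]\Gamma^{\lambda,i}$. Combinatorially, a dipole is a 2-cell embedding in an orientable surface of a loopless graph with two vertices, rooted at a vertex and an edge (labelled $n$), with a second distinguished edge (labelled $n-1$); $C_p$ is the root vertex rotation (root jump $p$), $\sigma$ the non-root vertex rotation (non-root jump $n-1$), and faces correspond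 to cycles of $\sigma C_p$ (cycle length $m$ $\leftrightarrow$ face degree $2m$), the root face being the one whose cycle contains $n$. *)

theory Defs
  imports
    Complex_Main
    "HOL-Library.Multiset"
    "HOL-Library.FuncSet"
    "HOL-Combinatorics.Orbits"
    "HOL-Combinatorics.Cycles"
begin

text \<open>Integer partitions are multisets of positive parts, so the order in which the parts are
  written is immaterial; this matters for \<open>(p, n - p)\<close>.\<close>

definition partitions :: "nat \<Rightarrow> nat multiset set" where
  "partitions n = {lam. sum_mset lam = n \<and> 0 \<notin># lam}"

definition hook :: "nat \<Rightarrow> nat \<Rightarrow> nat multiset" where
  "hook a k = {#a#} + replicate_mset k 1"

definition near_hook :: "nat \<Rightarrow> nat \<Rightarrow> nat multiset" where
  "near_hook a k = {#a, 2#} + replicate_mset k 1"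


subsection \<open>Permutations\<close>

definition cycle_type :: "nat \<Rightarrow> (nat \<Rightarrow> nat) \<Rightarrow> nat multiset" where
  "cycle_type n \<pi> = image_mset card (mset_set (orbit \<pi> ` {1..n}))"

definition near_class :: "nat \<Rightarrow> nat multiset \<Rightarrow> nat \<Rightarrow> (nat \<Rightarrow> nat) set" where
  "near_class n lam i =
    {\<pi>. \<pi> permutes {1..n} \<and> cycle_type n \<pi> = lam \<and> card (orbit \<pi> n) = i}"


subsection \<open>The group algebra of the symmetric group\<close>

text \<open>Elements of \<open>\<complex>[S\<^sub>n]\<close> are functions on \<open>nat \<Rightarrow> nat\<close> that vanish outside the permutations of
  \<open>{1..n}\<close>. Permutations are multiplied from right to left.\<close>

type_synonym galg = "(nat \<Rightarrow> nat) \<Rightarrow> complex"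

definition gdelta :: "(nat \<Rightarrow> nat) \<Rightarrow> galg" where
  "gdelta \<pi> = (\<lambda>\<rho>. if \<rho> = \<pi> then 1 else 0)"

definition gmult :: "nat \<Rightarrow> galg \<Rightarrow> galg \<Rightarrow> galg" where
  "gmult n X Y = (\<lambda>\<pi>. \<Sum>(\<alpha>, \<beta>) \<in> {(\<alpha>, \<beta>). \<alpha> permutes {1..n} \<and> \<beta> permutes {1..n} \<and> \<alpha> \<circ> \<beta> = \<pi>}.
      X \<alpha> * Y \<beta>)"

definition K_elt :: "nat \<Rightarrow> nat multiset \<Rightarrow> nat \<Rightarrow> galg" where
  "K_elt n lam i = (\<lambda>\<rho>. \<Sum>\<pi>\<in>near_class n lam i. gdelta \<pi> \<rho>)"

text \<open>The coefficient of \<open>K\<^bsub>\<mu>,j\<^esub>\<close> in the expansion of an element of the span of the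
  \<open>K\<^bsub>\<nu>,l\<^esub>\<close> in this basis; meaningful only on that span.\<close>

definition K_coeff :: "nat \<Rightarrow> nat multiset \<Rightarrow> nat \<Rightarrow> galg \<Rightarrow> complex" where
  "K_coeff n \<mu> j X = (THE c. \<exists>a. c = a \<mu> j \<and>
      X = (\<lambda>\<rho>. \<Sum>(\<nu>, l) \<in> {(\<nu>, l). \<nu> \<in> partitions n \<and> l \<in># \<nu>}. a \<nu> l * K_elt n \<nu> l \<rho>))"

definition jucys_murphy :: "nat \<Rightarrow> galg" where
  "jucys_murphy k = (\<lambda>\<rho>. \<Sum>a\<in>{1..<k}. gdelta (transpose a k) \<rho>)"

inductive_set jm_algebra :: "nat \<Rightarrow> galg set" for n :: nat where
  unit: "gdelta id \<in> jm_algebra n"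
| gen: "k \<in> {1..n} \<Longrightarrow> jucys_murphy k \<in> jm_algebra n"
| scale: "X \<in> jm_algebra n \<Longrightarrow> (\<lambda>\<pi>. c * X \<pi>) \<in> jm_algebra n"
| plus: "X \<in> jm_algebra n \<Longrightarrow> Y \<in> jm_algebra n \<Longrightarrow> (\<lambda>\<pi>. X \<pi> + Y \<pi>) \<in> jm_algebra n"
| mult: "X \<in> jm_algebra n \<Longrightarrow> Y \<in> jm_algebra n \<Longrightarrow> gmult n X Y \<in> jm_algebra n"

definition primitive_idempotent :: "nat \<Rightarrow> galg set \<Rightarrow> galg \<Rightarrow> bool" where
  "primitive_idempotent n A e \<longleftrightarrow>
     e \<in> A \<and> e \<noteq> (\<lambda>_. 0) \<and> gmult n e e = e \<and>
     (\<forall>f\<in>A. \<forall>g\<in>A. gmult n f f = f \<and> gmult n g g = g \<and>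
        gmult n f g = (\<lambda>_. 0) \<and> gmult n g f = (\<lambda>_. 0) \<and> e = (\<lambda>\<pi>. f \<pi> + g \<pi>) \<longrightarrow>
        f = (\<lambda>_. 0) \<or> g = (\<lambda>_. 0))"


subsection \<open>Standard Young tableaux and seminormal units\<close>

definition row_lengths :: "nat multiset \<Rightarrow> nat list" where
  "row_lengths lam = rev (sorted_list_of_multiset lam)"

text \<open>Boxes are pairs (row, column), both counted from 0.\<close>

definition young_diagram :: "nat multiset \<Rightarrow> (nat \<times> nat) set" where
  "young_diagram lam = {(r, c). r < length (row_lengths lam) \<and> c < row_lengths lam ! r}"

definition SYT :: "nat multiset \<Rightarrow> (nat \<times> nat \<Rightarrow> nat) set" where
  "SYT lam = {T. T \<in> extensional (young_diagram lam) \<and>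
     bij_betw T (young_diagram lam) {1..sum_mset lam} \<and>
     (\<forall>r c c'. (r, c) \<in> young_diagram lam \<and> (r, c') \<in> young_diagram lam \<and> c < c' \<longrightarrow>
        T (r, c) < T (r, c')) \<and>
     (\<forall>r r' c. (r, c) \<in> young_diagram lam \<and> (r', c) \<in> young_diagram lam \<and> r < r' \<longrightarrow>
        T (r, c) < T (r', c))}"

definition SYT_end :: "nat multiset \<Rightarrow> nat \<Rightarrow> (nat \<times> nat \<Rightarrow> nat) set" where
  "SYT_end lam i = {T \<in> SYT lam. \<exists>r < length (row_lengths lam).
     row_lengths lam ! r = i \<and> T (r, i - 1) = sum_mset lam}"

definition num_SYT :: "nat multiset \<Rightarrow> nat" where
  "num_SYT lam = card (SYT lam)"

definition box_content :: "nat multiset \<Rightarrow> (nat \<times> nat \<Rightarrow> nat) \<Rightarrow> nat \<Rightarrow> int" where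
  "box_content lam T k = (case the_inv_into (young_diagram lam) T k of (r, c) \<Rightarrow> int c - int r)"

definition seminormal_unit :: "nat \<Rightarrow> nat multiset \<Rightarrow> (nat \<times> nat \<Rightarrow> nat) \<Rightarrow> galg" where
  "seminormal_unit n lam T = (THE e. primitive_idempotent n (jm_algebra n) e \<and>
     (\<forall>k\<in>{1..n}. gmult n (jucys_murphy k) e = (\<lambda>\<pi>. of_int (box_content lam T k) * e \<pi>)))"

definition Gamma_elt :: "nat \<Rightarrow> nat multiset \<Rightarrow> nat \<Rightarrow> galg" where
  "Gamma_elt n lam i = (\<lambda>\<rho>. \<Sum>T\<in>SYT_end lam i. seminormal_unit n lam T \<rho>)"

definition gamma_coeff :: "nat \<Rightarrow> nat multiset \<Rightarrow> nat \<Rightarrow> nat multiset \<Rightarrow> nat \<Rightarrow> complex" where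
  "gamma_coeff n lam i \<mu> j = fact n / of_nat (num_SYT lam) * K_coeff n \<mu> j (Gamma_elt n lam i)"


subsection \<open>Dipoles\<close>

text \<open>A dipole is encoded by its non-root vertex rotation \<open>\<sigma>\<close>, the root vertex rotation being
  the fixed cycle \<open>(n, 1, \<dots>, p - 1, n - 1, p, \<dots>, n - 2)\<close>.\<close>

definition root_rotation :: "nat \<Rightarrow> nat \<Rightarrow> nat \<Rightarrow> nat" where
  "root_rotation n p = cycle_of_list ([n] @ [1..<p] @ [n - 1] @ [p..<n - 1])"

definition dipoles :: "nat \<Rightarrow> nat \<Rightarrow> nat multiset \<Rightarrow> nat \<Rightarrow> (nat \<Rightarrow> nat) set" where
  "dipoles n p lam i = {\<sigma>. \<sigma> permutes {1..n} \<and> cyclic_on \<sigma> {1..n} \<and> inv \<sigma> n = n - 1 \<and>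
     \<sigma> \<circ> root_rotation n p \<in> near_class n lam i}"

definition A_sum :: "nat \<Rightarrow> nat \<Rightarrow> nat multiset \<Rightarrow> nat \<Rightarrow> complex" where
  "A_sum n p lam i = (\<Sum>k\<in>{0..n - 2}.
     (-1) ^ k * gamma_coeff n (hook (n - k) k) (n - k) lam i
       * gamma_coeff n (hook (n - k) k) (n - k) {#p, n - p#} p
       / of_nat (num_SYT (hook (n - k - 1) k))
       * (of_nat (n - 1) / of_nat (n - k - 1)))"

definition B_sum :: "nat \<Rightarrow> nat \<Rightarrow> nat multiset \<Rightarrow> nat \<Rightarrow> complex" where
  "B_sum n p lam i = (\<Sum>k\<in>{1..n - 1}.
     (-1) ^ (k - 1) * gamma_coeff n (hook (n - k) k) 1 lam i
       * gamma_coeff n (hook (n - k) k) 1 {#p, n - p#} p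
       / of_nat (num_SYT (hook (n - k) (k - 1)))
       * (of_nat (n - 1) / of_nat k))"

definition C_sum :: "nat \<Rightarrow> nat \<Rightarrow> nat multiset \<Rightarrow> nat \<Rightarrow> complex" where
  "C_sum n p lam i = (\<Sum>k\<in>{1..n - 3}.
     (-1) ^ k * gamma_coeff n (near_hook (n - k - 1) (k - 1)) 2 lam i
       * gamma_coeff n (near_hook (n - k - 1) (k - 1)) 2 {#p, n - p#} p
       / of_nat (num_SYT (hook (n - k - 1) k))
       * (of_nat (n * k * (n - k - 2)) / of_nat ((n - k - 1) * (k + 1))))"

end

theory Submission
  imports Defs "HOL-Library.Poly_Mapping"
begin

text \<open>
  Put \<open>m = n - 1\<close> and \<open>s = (m, n)\<close>. A dipole rotation \<open>\<sigma>\<close> is \<open>\<tau> s\<close> with \<open>\<tau>\<close> a full cycle of \<open>S\<^sub>m\<close>,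
  and \<open>s C\<^sub>p\<close> has cycle type \<open>(p, n - p)\<close> with \<open>n\<close> on the cycle of length \<open>p\<close>. So the number of
  dipoles is the coefficient of \<open>s C\<^sub>p\<close> in \<open>J\<^sub>2 \<dots> J\<^sub>m K\<^bsub>\<lambda>,i\<^esub>\<close>, because \<open>J\<^sub>2 \<dots> J\<^sub>m\<close> is the sum of
  all full cycles. The product \<open>J\<^sub>2 \<dots> J\<^sub>m\<close> vanishes on every tableau that is not a hook, as
  some box other than the corner then has content 0, and is a combination of the central idempotents \<open>F\<^sub>k\<close> of the hooks
  \<open>(m - k, 1\<^sup>k)\<close>. On \<open>F\<^sub>k\<close> the element \<open>J\<^sub>n\<close> satisfies a cubic equation with the roots \<open>m - k\<close>,
  \<open>- (k + 1)\<close> and \<open>0\<close>, which splits \<open>F\<^sub>k\<close> into three idempotents; these are the \<open>\<Gamma>\<close>'s of the sums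
  \<open>A\<close>, \<open>B\<close> and \<open>C\<close>. The centralizer of \<open>S\<^sub>m\<close> acts on each of them by scalars, and the scalar by
  which \<open>K\<^bsub>\<lambda>,i\<^esub>\<close> acts is obtained by comparing coefficients of the identity.
\<close>

section \<open>The group algebra of the finitary symmetric group\<close>

text \<open>No representation of a symmetric group is constructed. What is usually taken from Specht
  modules, namely hook idempotents, their centrality, the scalars and the dimensions, is extracted
  from the Jucys-Murphy elements by induction on the size.

  The obstacle is that the recursion from size m to size m + 1 only shows that its result commutes
  with S_m. Commuting with the rest of S_{m+1} comes from two central elements: the sum J_1 + ... +
  J_{m+1}, whose eigenvalues on the hooks are distinct, and the product, which is a combination of
  hooks alone. The induction closes because J_m has only two eigenvalues on a hook of size m, the
  contents of its two removable boxes.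

  All S_n sit in one group of finitary permutations, so that C[S_m] is literally contained in
  C[S_{m+1}]; the functions of the definitions are reached through \<open>galg_of\<close>.
  Dimensions arise twice, as coefficients of the identity and as numbers of tableaux, and binomial
  identities match the two.\<close>

text \<open>The group law on permutations is written additively, because multiplication of
  finitely supported functions is convolution over an additive monoid.\<close>

typedef fperm = "{f :: nat \<Rightarrow> nat. permutation f}"
  morphisms perm_fun Abs_fperm
  using permutation_id by blast

setup_lifting type_definition_fperm

instantiation fperm :: group_add
begin

lift_definition zero_fperm :: fperm is id
  by (rule permutation_id)

lift_definition plus_fperm :: "fperm \<Rightarrow> fperm \<Rightarrow> fperm" is "(\<circ>)"
  by (rule permutation_compose)

lift_definition uminus_fperm :: "fperm \<Rightarrow> fperm" is inv
  by (rule permutation_inverse)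

definition minus_fperm :: "fperm \<Rightarrow> fperm \<Rightarrow> fperm" where
  "minus_fperm g h = g + (- h)"

instance
proof
  fix a b c :: fperm
  show "a + b + c = a + (b + c)"
    by transfer (simp add: comp_assoc)
  show "0 + a = a" "a + 0 = a"
    by (transfer, simp)+
  show "- a + a = 0"
    by transfer (simp add: permutation_bijective bij_is_inj)
  show "a + (- b) = a - b"
    by (simp add: minus_fperm_def)
qed

end

lemma perm_fun_permutation [simp]: "permutation (perm_fun g)"
  using perm_fun by auto

lemma bij_perm_fun [simp]: "bij (perm_fun g)"
  by (simp add: permutation_bijective)

lemma fperm_eqI: "(\<And>x. perm_fun g x = perm_fun h x) \<Longrightarrow> g = h"
  by (metis perm_fun_inject ext)

lemma perm_fun_add: "perm_fun (g + h) = perm_fun g \<circ> perm_fun h"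
  by (fact plus_fperm.rep_eq)

lemma perm_fun_minus: "perm_fun (- g) = inv (perm_fun g)"
  by (fact uminus_fperm.rep_eq)

lemma perm_fun_zero [simp]: "perm_fun 0 = id"
  by (fact zero_fperm.rep_eq)

lemma perm_fun_Abs [simp]: "permutation f \<Longrightarrow> perm_fun (Abs_fperm f) = f"
  by (simp add: Abs_fperm_inverse)

lemma perm_fun_minus_cancel [simp]:
  "perm_fun g (perm_fun (- g) x) = x"
  by (simp add: perm_fun_minus bij_is_surj surj_f_inv_f)

section \<open>The group algebra and its scalars\<close>

type_synonym sga = "fperm \<Rightarrow>\<^sub>0 complex"

definition el :: "fperm \<Rightarrow> sga" where
  "el g = Poly_Mapping.single g 1"

text \<open>Scalars act as multiples of the unit, so that bilinearity of the product comes down to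
  associativity and \<open>single_zero_central\<close>.\<close>

definition scl :: "complex \<Rightarrow> sga \<Rightarrow> sga" (infixr \<open>*\<^sub>C\<close> 75) where
  "c *\<^sub>C X = Poly_Mapping.single 0 c * X"

abbreviation coef :: "sga \<Rightarrow> fperm \<Rightarrow> complex" where
  "coef \<equiv> Poly_Mapping.lookup"

lemma el_add: "el (g + h) = el g * el h"
  by (simp add: el_def mult_single)

lemma el_zero [simp]: "el 0 = 1"
  by (simp add: el_def)

lemma el_inverse [simp]: "el g * el (- g) = 1" "el (- g) * el g = 1"
  by (simp_all flip: el_add)

lemma el_inverse_mult [simp]: "el (- g) * (el g * X) = X"
  by (simp flip: mult.assoc)

lemma coef_el: "coef (el g) h = (if g = h then 1 else 0)"
  by (simp add: el_def lookup_single when_def)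

lemma coef_single_mult: "coef (Poly_Mapping.single h c * X) g = c * coef X (- h + g)"
proof -
  have "(\<Sum>q. coef X q when g = l + q) = coef X (- l + g)" for l
  proof -
    have "(\<Sum>q. coef X q when g = l + q) = (\<Sum>q. coef X q when q = - l + g)"
      by (rule Sum_any.cong, rule when_cong) (auto simp: add.assoc[symmetric])
    thus ?thesis by simp
  qed
  hence "coef (Poly_Mapping.single h c * X) g
      = (\<Sum>l. (c when h = l) * coef X (- l + g))"
    by (simp add: lookup_mult lookup_single)
  also have "\<dots> = (\<Sum>l. c * coef X (- l + g) when h = l)"
    by (simp add: when_mult)
  finally show ?thesis by simp
qed

lemma coef_mult_single: "coef (X * Poly_Mapping.single h c) g = coef X (g - h) * c"
proof -
  have "(\<Sum>q. (c when h = q) when g = l + q) = (c when l = g - h)" for l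
  proof -
    have "(\<Sum>q. (c when h = q) when g = l + q) = (\<Sum>q. (c when g = l + q) when h = q)"
      by (rule Sum_any.cong) (simp add: when_commute)
    also have "\<dots> = (c when g = l + h)" by simp
    also have "\<dots> = (c when l = g - h)" by (rule when_cong) (auto simp: eq_diff_eq)
    finally show ?thesis .
  qed
  hence "coef (X * Poly_Mapping.single h c) g = (\<Sum>l. coef X l * (c when l = g - h))"
    by (simp add: lookup_mult lookup_single)
  also have "\<dots> = (\<Sum>l. coef X l * c when l = g - h)"
    by (simp add: mult_when)
  finally show ?thesis by simp
qed

lemma coef_el_mult: "coef (el h * X) g = coef X (- h + g)"
  by (simp add: el_def coef_single_mult)

lemma coef_mult_el: "coef (X * el h) g = coef X (g - h)"
  by (simp add: el_def coef_mult_single)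

lemma coef_scl [simp]: "coef (c *\<^sub>C X) g = c * coef X g"
  by (simp add: scl_def coef_single_mult)

lemma sga_eqI: "(\<And>g. coef X g = coef Y g) \<Longrightarrow> X = Y"
  by (rule poly_mapping_eqI)

lemma single_zero_central: "X * Poly_Mapping.single 0 c = Poly_Mapping.single 0 c * X"
  for X :: sga
  by (rule sga_eqI) (simp add: coef_single_mult coef_mult_single)

lemma scl_mult [simp]: "(c *\<^sub>C X) * Y = c *\<^sub>C (X * Y)"
  by (simp add: scl_def mult.assoc)

lemma mult_scl [simp]: "X * (c *\<^sub>C Y) = c *\<^sub>C (X * Y)"
  by (simp add: scl_def single_zero_central flip: mult.assoc)

lemma scl_scl [simp]: "c *\<^sub>C d *\<^sub>C X = (c * d) *\<^sub>C X"
  by (rule sga_eqI) simp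

lemma scl_one [simp]: "1 *\<^sub>C X = X"
  by (rule sga_eqI) simp

lemma scl_zero [simp]: "0 *\<^sub>C X = 0" "c *\<^sub>C 0 = 0"
  by (rule sga_eqI; simp)+

lemma scl_add_right: "c *\<^sub>C (X + Y) = c *\<^sub>C X + c *\<^sub>C Y"
  by (rule sga_eqI) (simp add: lookup_add algebra_simps)

lemma scl_add_left: "(c + d) *\<^sub>C X = c *\<^sub>C X + d *\<^sub>C X"
  by (rule sga_eqI) (simp add: lookup_add algebra_simps)

lemma scl_diff_right: "c *\<^sub>C (X - Y) = c *\<^sub>C X - c *\<^sub>C Y"
  by (rule sga_eqI) (simp add: lookup_minus algebra_simps)

lemma scl_diff_left: "(c - d) *\<^sub>C X = c *\<^sub>C X - d *\<^sub>C X"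
  by (rule sga_eqI) (simp add: lookup_minus algebra_simps)

lemma scl_minus_left: "(- c) *\<^sub>C X = - (c *\<^sub>C X)"
  by (rule sga_eqI) simp

lemma scl_sum_right: "c *\<^sub>C (\<Sum>i\<in>I. X i) = (\<Sum>i\<in>I. c *\<^sub>C X i)"
  by (rule sga_eqI) (simp add: lookup_sum sum_distrib_left)

lemma scl_sum_left: "(\<Sum>i\<in>I. c i) *\<^sub>C X = (\<Sum>i\<in>I. c i *\<^sub>C X)"
  by (rule sga_eqI) (simp add: lookup_sum sum_distrib_right)

lemma scl_of_nat: "of_nat k *\<^sub>C X = of_nat k * X"
  by (simp add: scl_def)

lemma scl_eq_0_iff: "c *\<^sub>C X = 0 \<longleftrightarrow> c = 0 \<or> X = 0"
proof
  assume h: "c *\<^sub>C X = 0"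
  { assume "c \<noteq> 0"
    hence "X = inverse c *\<^sub>C (c *\<^sub>C X)" by (simp del: mult_scl add: field_simps)
    hence "X = 0" using h by simp }
  thus "c = 0 \<or> X = 0" by blast
qed auto

lemma scl_cancel: "c \<noteq> 0 \<Longrightarrow> c *\<^sub>C X = c *\<^sub>C Y \<Longrightarrow> X = Y"
  using scl_eq_0_iff[of c "X - Y"] by (simp add: scl_diff_right)

lemma scl_cancel_right: "X \<noteq> 0 \<Longrightarrow> c *\<^sub>C X = d *\<^sub>C X \<Longrightarrow> c = d"
  using scl_eq_0_iff[of "c - d" X] by (simp add: scl_diff_left)

lemma sga_expand:
  assumes "finite A" "Poly_Mapping.keys X \<subseteq> A"
  shows "X = (\<Sum>g\<in>A. coef X g *\<^sub>C el g)"
proof (rule sga_eqI)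
  fix h
  have "coef (\<Sum>g\<in>A. coef X g *\<^sub>C el g) h = (\<Sum>g\<in>A. if g = h then coef X g else 0)"
    by (simp add: lookup_sum coef_el if_distrib cong: if_cong)
  also have "\<dots> = coef X h"
    using assms by (auto simp: in_keys_iff)
  finally show "coef X h = coef (\<Sum>g\<in>A. coef X g *\<^sub>C el g) h" by simp
qed


subsection \<open>Symmetric groups, centralizers and averages\<close>

definition Sn :: "nat \<Rightarrow> fperm set" where
  "Sn n = {g. perm_fun g permutes {1..n}}"

lemma permutes_imp_permutation: "f permutes {1..n::nat} \<Longrightarrow> permutation f"
  by (auto simp: permutation_permutes)

lemma Sn_iff: "g \<in> Sn n \<longleftrightarrow> perm_fun g permutes {1..n}"
  by (simp add: Sn_def)

lemma Sn_image: "perm_fun ` Sn n = {f. f permutes {1..n}}"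
proof (intro set_eqI iffI)
  fix f assume "f \<in> {f. f permutes {1..n}}"
  hence "f = perm_fun (Abs_fperm f)" "Abs_fperm f \<in> Sn n"
    by (auto simp: Sn_def permutes_imp_permutation)
  thus "f \<in> perm_fun ` Sn n" by blast
qed (auto simp: Sn_def)

lemma inj_perm_fun: "inj_on perm_fun A"
  by (auto simp: inj_on_def perm_fun_inject)

lemma finite_Sn [simp]: "finite (Sn n)"
  using finite_permutations[of "{1..n}"] by (metis Sn_image finite_imageD finite_atLeastAtMost inj_perm_fun)

lemma card_Sn: "card (Sn n) = fact n"
  using card_permutations[of "{1..n}" n] card_image[OF inj_perm_fun, of "Sn n"]
  by (simp add: Sn_image)

lemma Sn_zero [simp]: "0 \<in> Sn n"
  by (simp add: Sn_def permutes_id)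

lemma Sn_add: "g \<in> Sn n \<Longrightarrow> h \<in> Sn n \<Longrightarrow> g + h \<in> Sn n"
  by (simp add: Sn_def perm_fun_add permutes_compose)

lemma Sn_minus [simp]: "- g \<in> Sn n \<longleftrightarrow> g \<in> Sn n"
proof -
  have "g \<in> Sn n \<Longrightarrow> - g \<in> Sn n" for g
    by (simp add: Sn_def perm_fun_minus permutes_inv)
  thus ?thesis by (metis minus_minus)
qed

lemma Sn_diff: "g \<in> Sn n \<Longrightarrow> h \<in> Sn n \<Longrightarrow> g - h \<in> Sn n"
  by (metis Sn_add Sn_minus add_uminus_conv_diff)

lemma Sn_mono: "m \<le> n \<Longrightarrow> Sn m \<subseteq> Sn n"
  by (auto simp: Sn_def intro: permutes_subset)

lemma Sn_le1: "n \<le> 1 \<Longrightarrow> Sn n = {0}"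
proof -
  assume n: "n \<le> 1"
  have "card (Sn n) = 1" using n by (cases n) (auto simp: card_Sn)
  thus ?thesis by (metis Sn_zero card_1_singletonE singletonD)
qed

definition alg :: "nat \<Rightarrow> sga set" where
  "alg n = {X. Poly_Mapping.keys X \<subseteq> Sn n}"

lemma alg_iff: "X \<in> alg n \<longleftrightarrow> (\<forall>g. coef X g \<noteq> 0 \<longrightarrow> g \<in> Sn n)"
  by (auto simp: alg_def in_keys_iff)

lemma alg_expand: "X \<in> alg n \<Longrightarrow> X = (\<Sum>g\<in>Sn n. coef X g *\<^sub>C el g)"
  by (rule sga_expand) (auto simp: alg_def)

lemma alg_mono: "m \<le> n \<Longrightarrow> X \<in> alg m \<Longrightarrow> X \<in> alg n"
  using Sn_mono by (auto simp: alg_def)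

lemma alg_add: "X \<in> alg n \<Longrightarrow> Y \<in> alg n \<Longrightarrow> X + Y \<in> alg n"
  unfolding alg_iff lookup_add by (metis add.right_neutral)

lemma alg_diff: "X \<in> alg n \<Longrightarrow> Y \<in> alg n \<Longrightarrow> X - Y \<in> alg n"
  unfolding alg_iff lookup_minus by (metis diff_zero)

lemma alg_scl: "X \<in> alg n \<Longrightarrow> c *\<^sub>C X \<in> alg n"
  by (auto simp: alg_iff)

lemma alg_sum: "(\<And>i. i \<in> I \<Longrightarrow> X i \<in> alg n) \<Longrightarrow> (\<Sum>i\<in>I. X i) \<in> alg n"
  by (induction I rule: infinite_finite_induct) (auto intro: alg_add simp: alg_iff[of 0])

lemma alg_zero [simp]: "0 \<in> alg n"
  by (simp add: alg_iff)

lemma alg_el: "g \<in> Sn n \<Longrightarrow> el g \<in> alg n"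
  by (simp add: alg_iff coef_el)

lemma alg_one [simp]: "1 \<in> alg n"
  using alg_el[of 0 n] by simp

lemma alg_mult: "X \<in> alg n \<Longrightarrow> Y \<in> alg n \<Longrightarrow> X * Y \<in> alg n"
proof -
  assume X: "X \<in> alg n" and Y: "Y \<in> alg n"
  have "X * Y = (\<Sum>g\<in>Sn n. coef X g *\<^sub>C (el g * Y))"
    by (subst alg_expand[OF X]) (simp add: sum_distrib_right)
  moreover have "el g * Y \<in> alg n" if "g \<in> Sn n" for g
    using Y that unfolding alg_iff coef_el_mult by (metis Sn_add add_minus_cancel)
  ultimately show ?thesis by (simp add: alg_sum alg_scl)
qed

text \<open>The commutant is taken in the whole ambient algebra, because \<open>JM (Suc m)\<close>
  has to lie in \<open>cent m\<close> without being supported on S_m. The centralizer of S_m in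
  C[S_{m+1}] is \<open>cent m\<close> intersected with \<open>alg (Suc m)\<close>.\<close>

definition cent :: "nat \<Rightarrow> sga set" where
  "cent n = {X. \<forall>h\<in>Sn n. el h * X = X * el h}"

lemma centD: "X \<in> cent n \<Longrightarrow> h \<in> Sn n \<Longrightarrow> el h * X = X * el h"
  by (simp add: cent_def)

lemma cent_add: "X \<in> cent n \<Longrightarrow> Y \<in> cent n \<Longrightarrow> X + Y \<in> cent n"
  by (simp add: cent_def algebra_simps)

lemma cent_diff: "X \<in> cent n \<Longrightarrow> Y \<in> cent n \<Longrightarrow> X - Y \<in> cent n"
  by (simp add: cent_def algebra_simps)

lemma cent_scl: "X \<in> cent n \<Longrightarrow> c *\<^sub>C X \<in> cent n"
  by (simp add: cent_def)

lemma cent_mult: "X \<in> cent n \<Longrightarrow> Y \<in> cent n \<Longrightarrow> X * Y \<in> cent n"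
  unfolding cent_def by clarify (metis mult.assoc)

lemma cent_one [simp]: "1 \<in> cent n"
  by (simp add: cent_def)

lemma cent_zero [simp]: "0 \<in> cent n"
  by (simp add: cent_def)

lemma cent_le1: "n \<le> 1 \<Longrightarrow> X \<in> cent n"
  by (simp add: cent_def Sn_le1)

lemma cent_commute: "X \<in> cent n \<Longrightarrow> Y \<in> alg n \<Longrightarrow> Y * X = X * Y"
proof -
  assume X: "X \<in> cent n" and Y: "Y \<in> alg n"
  have "(\<Sum>g\<in>Sn n. coef Y g *\<^sub>C el g) * X = X * (\<Sum>g\<in>Sn n. coef Y g *\<^sub>C el g)"
    unfolding sum_distrib_left sum_distrib_right
    by (rule sum.cong) (auto simp: centD[OF X])
  thus ?thesis using alg_expand[OF Y] by simp
qed

lemma cent_coef: "X \<in> cent n \<Longrightarrow> h \<in> Sn n \<Longrightarrow> coef X (h + g - h) = coef X g"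
proof -
  assume X: "X \<in> cent n" and h: "h \<in> Sn n"
  have "coef (el h * X) (h + g) = coef (X * el h) (h + g)"
    using centD[OF X h] by simp
  thus ?thesis by (simp add: coef_el_mult coef_mult_el)
qed

section \<open>Averages over a symmetric group\<close>

definition avg :: "nat \<Rightarrow> sga \<Rightarrow> sga" where
  "avg m X = (1 / fact m) *\<^sub>C (\<Sum>h\<in>Sn m. el h * X * el (- h))"

lemma avg_add: "avg m (X + Y) = avg m X + avg m Y"
  by (simp add: avg_def algebra_simps sum.distrib scl_add_right)

lemma avg_diff: "avg m (X - Y) = avg m X - avg m Y"
  by (simp add: avg_def algebra_simps sum_subtractf scl_diff_right)

lemma avg_scl: "avg m (c *\<^sub>C X) = c *\<^sub>C avg m X"
  by (simp add: avg_def scl_sum_right[symmetric] mult.commute)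

lemma avg_zero [simp]: "avg m 0 = 0"
  by (simp add: avg_def)

lemma avg_sum: "avg m (\<Sum>i\<in>I. X i) = (\<Sum>i\<in>I. avg m (X i))"
  by (induction I rule: infinite_finite_induct) (auto simp: avg_add)

text \<open>Averages are linear over the commutant, here on the left and next on the right; this
  lets \<open>JM (Suc m)\<close> and the hook idempotents be moved out of them.\<close>

lemma avg_cent_mult_left: "z \<in> cent m \<Longrightarrow> avg m (z * X) = z * avg m X"
proof -
  assume z: "z \<in> cent m"
  have "(\<Sum>h\<in>Sn m. el h * (z * X) * el (- h)) = (\<Sum>h\<in>Sn m. z * (el h * X * el (- h)))"
    by (rule sum.cong) (auto simp: mult.assoc[symmetric] centD[OF z])
  thus ?thesis by (simp add: avg_def sum_distrib_left)
qed

lemma avg_cent_mult_right: "z \<in> cent m \<Longrightarrow> avg m (X * z) = avg m X * z"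
proof -
  assume z: "z \<in> cent m"
  have "(\<Sum>h\<in>Sn m. el h * (X * z) * el (- h)) = (\<Sum>h\<in>Sn m. (el h * X * el (- h)) * z)"
    by (rule sum.cong) (auto simp: mult.assoc centD[OF z])
  thus ?thesis by (simp add: avg_def sum_distrib_right)
qed

lemma avg_one [simp]: "avg m 1 = 1"
proof -
  have "(\<Sum>h\<in>Sn m. el h * 1 * el (- h)) = of_nat (fact m) * 1"
    by (simp add: card_Sn)
  thus ?thesis unfolding avg_def
    by (metis scl_of_nat scl_scl scl_one nonzero_eq_divide_eq fact_nonzero of_nat_fact)
qed

lemma avg_cent: "z \<in> cent m \<Longrightarrow> avg m z = z"
  using avg_cent_mult_left[of z m 1] by simp

lemma sum_Sn_shift: "k \<in> Sn m \<Longrightarrow> (\<Sum>h\<in>Sn m. f (h + k)) = (\<Sum>h\<in>Sn m. f h)"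
  by (rule sum.reindex_bij_witness[where i="\<lambda>h. h - k" and j="\<lambda>h. h + k"])
     (auto intro: Sn_add Sn_diff)

lemma avg_conj: "k \<in> Sn m \<Longrightarrow> avg m (el k * X * el (- k)) = avg m X"
proof -
  assume k: "k \<in> Sn m"
  have "(\<Sum>h\<in>Sn m. el h * (el k * X * el (- k)) * el (- h))
      = (\<Sum>h\<in>Sn m. el (h + k) * X * el (- (h + k)))"
    by (simp add: minus_add el_add mult.assoc del: add_uminus_conv_diff)
  also have "\<dots> = (\<Sum>h\<in>Sn m. el h * X * el (- h))"
    by (rule sum_Sn_shift[OF k, where f="\<lambda>h. el h * X * el (- h)"])
  finally show ?thesis by (simp add: avg_def)
qed

text \<open>Conjugation by S_l is absorbed by the larger average. Used with l = m - 1, to let an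
  average over S_{m-1} act first inside one over S_m.\<close>

lemma avg_avg: "l \<le> m \<Longrightarrow> avg m (avg l X) = avg m X"
proof -
  assume "l \<le> m"
  hence "avg m (el h * X * el (- h)) = avg m X" if "h \<in> Sn l" for h
    using that Sn_mono by (intro avg_conj) auto
  hence "avg m (\<Sum>h\<in>Sn l. el h * X * el (- h)) = fact l *\<^sub>C avg m X"
    using scl_of_nat[of "fact l" "avg m X"] by (simp add: avg_sum card_Sn)
  thus ?thesis by (simp add: avg_def[of l] avg_scl)
qed

subsection \<open>Jucys--Murphy elements\<close>

definition tp :: "nat \<Rightarrow> nat \<Rightarrow> fperm" where
  "tp a b = Abs_fperm (transpose a b)"

lemma perm_fun_tp [simp]: "perm_fun (tp a b) = transpose a b"
  by (simp add: tp_def permutation_swap_id)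

lemma tp_in_Sn: "a \<in> {1..n} \<Longrightarrow> b \<in> {1..n} \<Longrightarrow> tp a b \<in> Sn n"
  by (simp add: Sn_def permutes_swap_id)

lemma tp_tp [simp]: "tp a b + tp a b = 0"
  by (rule fperm_eqI) (simp add: perm_fun_add)

lemma el_tp_tp [simp]: "el (tp a b) * el (tp a b) = 1"
  by (simp flip: el_add)

lemma el_tp_tp_mult [simp]: "el (tp a b) * (el (tp a b) * X) = X"
  by (simp flip: mult.assoc)

lemma minus_tp [simp]: "- tp a b = tp a b"
  by (metis tp_tp add_eq_0_iff)

lemma tp_conj: "h + tp a b - h = tp (perm_fun h a) (perm_fun h b)"
proof -
  have "h + tp a b = tp (perm_fun h a) (perm_fun h b) + h"
    by (rule fperm_eqI) (auto simp: perm_fun_add transpose_def bij_is_inj inj_eq)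
  thus ?thesis by (simp add: diff_eq_eq)
qed

lemma el_tp_conj: "el h * el (tp a b) * el (- h) = el (tp (perm_fun h a) (perm_fun h b))"
  by (simp add: tp_conj[symmetric] el_add[symmetric])

definition JM :: "nat \<Rightarrow> sga" where
  "JM k = (\<Sum>a\<in>{1..<k}. el (tp a k))"

lemma JM_1 [simp]: "JM (Suc 0) = 0"
  by (simp add: JM_def)

lemma JM_alg: "k \<le> n \<Longrightarrow> JM k \<in> alg n"
  unfolding JM_def by (intro alg_sum alg_el tp_in_Sn) auto

lemma commute_mult: "x * a = a * x \<Longrightarrow> x * b = b * x \<Longrightarrow> x * (a * b) = a * b * x"
  for x :: "'a :: semigroup_mult"
  by (metis mult.assoc)

lemma conj_imp_commute: "el h * X * el (- h) = X \<Longrightarrow> el h * X = X * el h"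
  by (metis mult.assoc el_inverse(2) mult.right_neutral)

text \<open>An element of S_m fixes m + 1, so conjugating by it only permutes the summands.\<close>

lemma JM_cent: "JM (Suc m) \<in> cent m"
  unfolding cent_def
proof clarify
  fix h assume h: "h \<in> Sn m"
  hence p: "perm_fun h permutes {1..m}" by (simp add: Sn_iff)
  hence [simp]: "perm_fun h (Suc m) = Suc m"
    by (auto simp: permutes_def)
  have "el h * JM (Suc m) * el (- h) = (\<Sum>a\<in>{1..m}. el (tp (perm_fun h a) (Suc m)))"
    by (simp add: JM_def sum_distrib_left sum_distrib_right el_tp_conj atLeastLessThanSuc_atLeastAtMost)
  also have "\<dots> = (\<Sum>a\<in>{1..m}. el (tp a (Suc m)))"
    using sum.permute[OF p, of "\<lambda>a. el (tp a (Suc m))"] by (simp add: o_def)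
  finally have "el h * JM (Suc m) * el (- h) = JM (Suc m)"
    by (simp add: JM_def atLeastLessThanSuc_atLeastAtMost)
  thus "el h * JM (Suc m) = JM (Suc m) * el h" by (rule conj_imp_commute)
qed

lemma JM_commute: "JM j * JM k = JM k * JM j"
proof -
  have "JM j * JM k = JM k * JM j" if jk: "j < k" for j k
  proof (cases k)
    case (Suc m)
    thus ?thesis using jk cent_commute[OF JM_cent JM_alg, of j m] by simp
  qed (use jk in simp)
  thus ?thesis by (metis linorder_neqE_nat)
qed

lemma Sn_Suc_fix: "g \<in> Sn (Suc m) \<Longrightarrow> perm_fun g (Suc m) = Suc m \<Longrightarrow> g \<in> Sn m"
  unfolding Sn_iff using permutes_superset[of "perm_fun g" "{1..Suc m}" "{1..m}"]
  by (auto simp: le_Suc_eq)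

lemma Sn_fix: "g \<in> Sn m \<Longrightarrow> m < x \<Longrightarrow> perm_fun g x = x"
  by (auto simp: Sn_iff permutes_def)

text \<open>The cosets of S_m in S_{m+1} are represented by the identity and the transpositions
  \<open>(x, m + 1)\<close>, with x the image of m + 1.\<close>

lemma Sn_Suc_cases:
  assumes "g \<in> Sn (Suc m)"
  obtains "g \<in> Sn m" | x h where "x \<in> {1..m}" "h \<in> Sn m" "g = tp x (Suc m) + h"
proof (cases "perm_fun g (Suc m) = Suc m")
  case True
  thus ?thesis using that(1) Sn_Suc_fix[OF assms] by blast
next
  case False
  let ?x = "perm_fun g (Suc m)"
  have "?x \<in> {1..Suc m}"
    using assms permutes_in_image[of "perm_fun g" "{1..Suc m}" "Suc m"] by (simp add: Sn_iff)
  hence x: "?x \<in> {1..m}" using False by auto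
  hence "tp ?x (Suc m) + g \<in> Sn (Suc m)" using assms by (intro Sn_add tp_in_Sn) auto
  hence "tp ?x (Suc m) + g \<in> Sn m" by (rule Sn_Suc_fix) (simp add: perm_fun_add)
  moreover have "g = tp ?x (Suc m) + (tp ?x (Suc m) + g)"
    by (simp add: add.assoc[symmetric])
  ultimately show ?thesis using x that(2) by blast
qed

lemma tp_conj_adjacent: "x \<in> {1..m} \<Longrightarrow> tp x (Suc m) = tp x m + tp m (Suc m) + tp x m"
proof -
  assume "x \<in> {1..m}"
  hence "tp x m + tp m (Suc m) - tp x m = tp x (Suc m)"
    unfolding tp_conj by (auto simp: transpose_def)
  thus ?thesis by (simp add: diff_eq_eq add.assoc)
qed

text \<open>S_{m+1} is generated by S_m and the adjacent transposition s, as
  \<open>(x, m + 1)\<close> is s conjugated by \<open>(x, m)\<close>. Every claim of centrality is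
  thereby reduced to a single commutation.\<close>

lemma cent_SucI:
  assumes X: "X \<in> cent m" and s: "el (tp m (Suc m)) * X = X * el (tp m (Suc m))"
  shows "X \<in> cent (Suc m)"
  unfolding cent_def
proof clarify
  fix g assume "g \<in> Sn (Suc m)"
  thus "el g * X = X * el g"
  proof (cases rule: Sn_Suc_cases)
    case 1
    thus ?thesis using X by (simp add: centD)
  next
    case (2 x h)
    have "tp x m \<in> Sn m" using 2 by (intro tp_in_Sn) auto
    hence t: "el (tp x m) * X = X * el (tp x m)" using X by (simp add: centD)
    have "el g = el (tp x m) * (el (tp m (Suc m)) * (el (tp x m) * el h))"
      using 2 by (simp only: tp_conj_adjacent el_add mult.assoc)
    thus ?thesis using s t centD[OF X \<open>h \<in> Sn m\<close>]
      by (metis commute_mult)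
  qed
qed

text \<open>The relation of the degenerate affine Hecke algebra: s turns \<open>(a, m)\<close> into
  \<open>(a, m + 1)\<close>, and among the summands of \<open>JM (Suc m)\<close> only s itself is
  missed. The next three lemmas rearrange it for moving s past a Jucys-Murphy element.\<close>

lemma JM_Suc_adjacent: "m \<ge> 1 \<Longrightarrow>
  el (tp m (Suc m)) * JM m * el (tp m (Suc m)) = JM (Suc m) - el (tp m (Suc m))"
proof -
  assume m: "m \<ge> 1"
  have "el (tp m (Suc m)) * JM m * el (tp m (Suc m))
      = (\<Sum>a\<in>{1..<m}. el (tp m (Suc m)) * el (tp a m) * el (- tp m (Suc m)))"
    by (simp add: JM_def sum_distrib_left sum_distrib_right)
  also have "\<dots> = (\<Sum>a\<in>{1..<m}. el (tp a (Suc m)))"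
    unfolding el_tp_conj by (rule sum.cong) (auto simp: transpose_def)
  also have "\<dots> = JM (Suc m) - el (tp m (Suc m))"
    using m by (simp add: JM_def atLeastLessThanSuc)
  finally show ?thesis .
qed

lemma adjacent_JM: "m \<ge> 1 \<Longrightarrow>
  el (tp m (Suc m)) * JM m = JM (Suc m) * el (tp m (Suc m)) - 1"
proof -
  assume m: "m \<ge> 1"
  let ?s = "el (tp m (Suc m))"
  have "?s * JM m = (?s * JM m * ?s) * ?s" by (simp add: mult.assoc)
  also have "\<dots> = JM (Suc m) * ?s - 1"
    unfolding JM_Suc_adjacent[OF m] by (simp add: algebra_simps)
  finally show ?thesis .
qed

lemma JM_Suc_times_adjacent: "m \<ge> 1 \<Longrightarrow>
  JM (Suc m) * el (tp m (Suc m)) = el (tp m (Suc m)) * JM m + 1"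
  using adjacent_JM[of m] by simp

lemma adjacent_JM_Suc: "m \<ge> 1 \<Longrightarrow>
  el (tp m (Suc m)) * JM (Suc m) = JM m * el (tp m (Suc m)) + 1"
proof -
  assume m: "m \<ge> 1"
  let ?s = "el (tp m (Suc m))"
  have "?s * JM (Suc m) = ?s * (?s * JM m * ?s + ?s)"
    unfolding JM_Suc_adjacent[OF m] by simp
  also have "\<dots> = JM m * ?s + 1" by (simp add: distrib_left mult.assoc)
  finally show ?thesis .
qed

lemma adjacent_cent: "el (tp m (Suc m)) \<in> cent (m - 1)"
  unfolding cent_def
proof clarify
  fix h assume h: "h \<in> Sn (m - 1)"
  show "el h * el (tp m (Suc m)) = el (tp m (Suc m)) * el h"
  proof (cases "m = 0")
    case True
    thus ?thesis using h by (simp add: Sn_le1)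
  next
    case False
    hence "perm_fun h m = m" "perm_fun h (Suc m) = Suc m" using h by (auto intro: Sn_fix)
    thus ?thesis using el_tp_conj[of h m "Suc m"] by (metis conj_imp_commute)
  qed
qed

text \<open>The sum of all transpositions of S_m. Its eigenvalue on a shape is the sum of the
  contents, and these sums separate the hooks of equal size.\<close>

definition JM_sum :: "nat \<Rightarrow> sga" where
  "JM_sum m = (\<Sum>k\<in>{1..m}. JM k)"

lemma JM_sum_Suc: "JM_sum (Suc m) = JM_sum m + JM (Suc m)"
  by (simp add: JM_sum_def)

lemma JM_sum_alg: "JM_sum m \<in> alg m"
  unfolding JM_sum_def by (intro alg_sum JM_alg) auto

lemma JM_sum_cent: "JM_sum m \<in> cent m"
proof (induction m)
  case (Suc m)
  show ?case
  proof (cases "m = 0")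
    case False
    hence m: "m \<ge> 1" by simp
    let ?s = "el (tp m (Suc m))"
    show ?thesis
    proof (rule cent_SucI)
      show "JM_sum (Suc m) \<in> cent m"
        unfolding JM_sum_Suc by (intro cent_add Suc.IH JM_cent)
      have eq: "JM_sum (Suc m) = JM_sum (m - 1) + (JM m + JM (Suc m))"
        using JM_sum_Suc[of "m - 1"] m by (simp add: JM_sum_Suc)
      have "?s * JM_sum (m - 1) = JM_sum (m - 1) * ?s"
        by (rule cent_commute[OF adjacent_cent JM_sum_alg, symmetric])
      moreover have "?s * (JM m + JM (Suc m)) = (JM m + JM (Suc m)) * ?s"
        using adjacent_JM[OF m] adjacent_JM_Suc[OF m] by (simp add: algebra_simps)
      ultimately show "?s * JM_sum (Suc m) = JM_sum (Suc m) * ?s"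
        unfolding eq by (simp only: distrib_left distrib_right)
    qed
  qed (simp add: cent_le1)
qed (simp add: cent_le1)

text \<open>The product omits \<open>J\<^sub>1 = 0\<close>.\<close>

primrec JM_prod :: "nat \<Rightarrow> sga" where
  "JM_prod 0 = 1"
| "JM_prod (Suc m) = (if m = 0 then 1 else JM (Suc m) * JM_prod m)"

lemma JM_prod_alg: "JM_prod m \<in> alg m"
  by (induction m) (auto intro!: alg_mult JM_alg intro: alg_mono[of m "Suc m" for m])

lemma JM_prod_cent: "JM_prod m \<in> cent m"
proof (induction m)
  case (Suc m)
  show ?case
  proof (cases "m = 0")
    case False
    hence m: "m \<ge> 1" by simp
    let ?s = "el (tp m (Suc m))"
    show ?thesis
    proof (rule cent_SucI)
      show "JM_prod (Suc m) \<in> cent m"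
        using Suc.IH JM_cent m by (auto intro: cent_mult)
      \<comment> \<open>Only the last two factors interact with s; they commute with it jointly,
        though not one by one. For m = 1 the omitted \<open>JM 1\<close> leaves \<open>JM 2\<close>
        alone, which is s itself.\<close>
      have eq: "JM_prod (Suc m) = (if m = 1 then JM (Suc m) else JM (Suc m) * JM m * JM_prod (m - 1))"
        using m by (cases m) (auto simp: mult.assoc)
      have 1: "?s * JM_prod (m - 1) = JM_prod (m - 1) * ?s"
        by (rule cent_commute[OF adjacent_cent JM_prod_alg, symmetric])
      have "?s * (JM (Suc m) * JM m) = (JM m * ?s + 1) * JM m"
        by (simp add: adjacent_JM_Suc[OF m] flip: mult.assoc)
      also have "\<dots> = JM m * (?s * JM m) + JM m" by (simp add: algebra_simps)
      also have "\<dots> = (JM (Suc m) * JM m) * ?s"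
        by (simp add: adjacent_JM[OF m] right_diff_distrib JM_commute[of "Suc m" m] flip: mult.assoc)
      finally have "?s * (JM (Suc m) * JM m) = JM (Suc m) * JM m * ?s" .
      moreover have "m = 1 \<Longrightarrow> ?s * JM (Suc m) = JM (Suc m) * ?s"
        using adjacent_JM_Suc[of 1] JM_Suc_times_adjacent[of 1] by simp
      ultimately show "?s * JM_prod (Suc m) = JM_prod (Suc m) * ?s"
        unfolding eq using 1 commute_mult by auto
    qed
  qed (simp add: cent_le1)
qed (simp add: cent_le1)

text \<open>The m transpositions moving m + 1 are conjugate under S_m, so their averages coincide;
  their sum \<open>JM (Suc m)\<close> is its own average.\<close>

lemma avg_tp_Suc:
  assumes x: "x \<in> {1..m}"
  shows "avg m (el (tp x (Suc m))) = (1 / of_nat m) *\<^sub>C JM (Suc m)"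
proof -
  have eq: "avg m (el (tp y (Suc m))) = avg m (el (tp m (Suc m)))" if y: "y \<in> {1..m}" for y
  proof -
    have "tp y m \<in> Sn m" using y by (intro tp_in_Sn) auto
    hence "avg m (el (tp m (Suc m))) = avg m (el (tp y m) * el (tp m (Suc m)) * el (- tp y m))"
      by (rule avg_conj[symmetric])
    also have "\<dots> = avg m (el (tp y (Suc m)))"
      by (simp only: tp_conj_adjacent[OF y] el_add minus_tp)
    finally show ?thesis by simp
  qed
  have "JM (Suc m) = avg m (JM (Suc m))" by (simp add: avg_cent JM_cent)
  also have "\<dots> = (\<Sum>y\<in>{1..m}. avg m (el (tp y (Suc m))))"
    by (simp add: JM_def avg_sum atLeastLessThanSuc_atLeastAtMost)
  also have "\<dots> = (\<Sum>y\<in>{1..m}. avg m (el (tp x (Suc m))))"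
    by (rule sum.cong[OF refl]) (rule trans[OF eq eq[OF x, symmetric]])
  also have "\<dots> = of_nat m *\<^sub>C avg m (el (tp x (Suc m)))" by (simp add: scl_of_nat)
  finally show ?thesis using x by simp
qed

text \<open>All transpositions of S_m have the same average. \<open>JM m\<close> contains m - 1 of
  them and \<open>JM_sum m\<close> contains m (m - 1) / 2, whence the factor 2 / m.\<close>

lemma avg_JM:
  assumes m: "m \<ge> 1"
  shows "avg m (JM m) = (2 / of_nat m) *\<^sub>C JM_sum m"
proof (cases "m = 1")
  case True
  thus ?thesis by (simp add: JM_sum_def)
next
  case False
  hence m2: "m \<ge> 2" using m by simp
  let ?t = "avg m (el (tp 1 m))"
  have eq: "avg m (el (tp a k)) = ?t" if ak: "a \<in> {1..<k}" "k \<in> {1..m}" for a k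
  proof -
    have "avg m (el (tp a k)) = avg m (el (tp a m))"
    proof -
      have "tp k m \<in> Sn m" using ak by (intro tp_in_Sn) auto
      hence "avg m (el (tp a k)) = avg m (el (tp k m) * el (tp a k) * el (- tp k m))"
        by (rule avg_conj[symmetric])
      also have "\<dots> = avg m (el (tp a m))"
        unfolding el_tp_conj using ak by (auto simp: transpose_def)
      finally show ?thesis .
    qed
    also have "\<dots> = ?t"
    proof -
      have "tp a 1 \<in> Sn m" using ak by (intro tp_in_Sn) auto
      hence "avg m (el (tp a m)) = avg m (el (tp a 1) * el (tp a m) * el (- tp a 1))"
        by (rule avg_conj[symmetric])
      also have "\<dots> = ?t"
        unfolding el_tp_conj using ak by (auto simp: transpose_def)
      finally show ?thesis .
    qed
    finally show ?thesis .
  qed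
  have J: "avg m (JM k) = of_nat (k - 1) *\<^sub>C ?t" if k: "k \<in> {1..m}" for k
  proof -
    have "avg m (JM k) = (\<Sum>a\<in>{1..<k}. ?t)"
      unfolding JM_def avg_sum using k by (intro sum.cong refl eq) auto
    thus ?thesis by (simp add: scl_of_nat)
  qed
  have "JM_sum m = avg m (JM_sum m)" by (simp add: avg_cent JM_sum_cent)
  also have "\<dots> = (\<Sum>k\<in>{1..m}. of_nat (k - 1) *\<^sub>C ?t)"
    unfolding JM_sum_def avg_sum by (rule sum.cong) (auto simp: J)
  also have "\<dots> = (\<Sum>k\<in>{1..m}. of_nat (k - 1)) *\<^sub>C ?t"
    by (simp add: scl_sum_left)
  also have "(\<Sum>k\<in>{1..m}. of_nat (k - 1)) = (of_nat m * of_nat (m - 1) / 2 :: complex)"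
  proof -
    have "2 * (\<Sum>k\<in>{1..m}. of_nat (k - 1)) = (of_nat m * of_nat (m - 1) :: complex)" for m
    proof (induction m)
      case (Suc m)
      thus ?case by (cases m) (auto simp: algebra_simps)
    qed simp
    from this[of m] show ?thesis
      by (simp only: eq_divide_eq_numeral1 mult.commute[of _ 2]) simp
  qed
  finally show ?thesis using J[of m] m2 by (simp add: diff_divide_distrib)
qed

text \<open>The second part follows from the first: \<open>adjacent_JM\<close> moves the
  Jucys-Murphy element to the left of s, where it becomes \<open>JM (Suc m)\<close> and leaves the
  average.\<close>

lemma avg_adjacent:
  assumes m: "m \<ge> 1"
  shows "avg m (el (tp m (Suc m))) = (1 / of_nat m) *\<^sub>C JM (Suc m)"
    and "avg m (el (tp m (Suc m)) * JM m) = (1 / of_nat m) *\<^sub>C (JM (Suc m) * JM (Suc m)) - 1"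
proof -
  show 1: "avg m (el (tp m (Suc m))) = (1 / of_nat m) *\<^sub>C JM (Suc m)"
    using avg_tp_Suc[of m m] m by simp
  show "avg m (el (tp m (Suc m)) * JM m) = (1 / of_nat m) *\<^sub>C (JM (Suc m) * JM (Suc m)) - 1"
    unfolding adjacent_JM[OF m] by (simp add: avg_diff avg_cent_mult_left JM_cent 1)
qed


section \<open>Hook idempotents\<close>

text \<open>Lagrange interpolation for an element \<open>J\<close> with eigenvalues \<open>a\<close>, \<open>-b\<close> and \<open>0\<close> on \<open>v\<close>.\<close>

definition proj_arm :: "sga \<Rightarrow> complex \<Rightarrow> complex \<Rightarrow> sga \<Rightarrow> sga" where
  "proj_arm J a b v = (1 / (a * (a + b))) *\<^sub>C (J * (J * v) + b *\<^sub>C (J * v))"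

definition proj_leg :: "sga \<Rightarrow> complex \<Rightarrow> complex \<Rightarrow> sga \<Rightarrow> sga" where
  "proj_leg J a b v = (1 / (b * (a + b))) *\<^sub>C (J * (J * v) - a *\<^sub>C (J * v))"

text \<open>Taken as the remainder instead of an interpolation polynomial, so that v is the sum of
  the three parts by definition.\<close>

definition proj_zero :: "sga \<Rightarrow> complex \<Rightarrow> complex \<Rightarrow> sga \<Rightarrow> sga" where
  "proj_zero J a b v = v - proj_arm J a b v - proj_leg J a b v"

lemmas proj_defs = proj_arm_def proj_leg_def proj_zero_def

text \<open>This says that \<open>J * (J - a) * (J + b)\<close> annihilates v, solved for the third
  power.\<close>

definition cubic :: "sga \<Rightarrow> complex \<Rightarrow> complex \<Rightarrow> sga \<Rightarrow> bool" where
  "cubic J a b v \<longleftrightarrow> J * (J * (J * v)) = (a - b) *\<^sub>C (J * (J * v)) + (a * b) *\<^sub>C (J * v)"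

lemma JM_proj_arm:
  assumes "cubic J a b v"
  shows "J * proj_arm J a b v = a *\<^sub>C proj_arm J a b v"
proof -
  have "J * (k *\<^sub>C (J * (J * v) + b *\<^sub>C (J * v))) = a *\<^sub>C (k *\<^sub>C (J * (J * v) + b *\<^sub>C (J * v)))" for k
    using assms unfolding cubic_def
    by (intro sga_eqI) (simp add: distrib_left lookup_add algebra_simps)
  thus ?thesis by (simp only: proj_arm_def)
qed

lemma JM_proj_leg:
  assumes "cubic J a b v"
  shows "J * proj_leg J a b v = (- b) *\<^sub>C proj_leg J a b v"
proof -
  have "J * (k *\<^sub>C (J * (J * v) - a *\<^sub>C (J * v))) = (- b) *\<^sub>C (k *\<^sub>C (J * (J * v) - a *\<^sub>C (J * v)))" for k
    using assms unfolding cubic_def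
    by (intro sga_eqI) (simp add: right_diff_distrib lookup_minus lookup_add algebra_simps)
  thus ?thesis by (simp only: proj_leg_def)
qed

lemma JM_proj_sum:
  assumes "cubic J a b v" "a \<noteq> 0" "b \<noteq> 0" "a + b \<noteq> 0"
  shows "J * v = J * proj_arm J a b v + J * proj_leg J a b v"
proof -
  have "J * v = a *\<^sub>C proj_arm J a b v + (- b) *\<^sub>C proj_leg J a b v"
  proof (rule sga_eqI)
    fix g
    have "1 / (a + b) * (x + b * y) - 1 / (a + b) * (x - a * y) = y" for x y
    proof -
      have "(x + b * y) - (x - a * y) = y * (a + b)" by (simp add: algebra_simps)
      thus ?thesis using assms(4) by (simp add: diff_divide_distrib[symmetric])
    qed
    from this[of "coef (J * (J * v)) g" "coef (J * v) g"]
    show "coef (J * v) g = coef (a *\<^sub>C proj_arm J a b v + (- b) *\<^sub>C proj_leg J a b v) g"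
      using assms by (simp add: proj_defs lookup_add lookup_minus)
  qed
  thus ?thesis using JM_proj_arm[OF assms(1)] JM_proj_leg[OF assms(1)] by simp
qed

lemma JM_proj_zero:
  assumes "cubic J a b v" "a \<noteq> 0" "b \<noteq> 0" "a + b \<noteq> 0"
  shows "J * proj_zero J a b v = 0"
  using JM_proj_sum[OF assms] by (simp add: proj_zero_def right_diff_distrib)

lemma proj_mult_right:
  "proj_arm J a b (v * w) = proj_arm J a b v * w"
  "proj_leg J a b (v * w) = proj_leg J a b v * w"
  "proj_zero J a b (v * w) = proj_zero J a b v * w"
  by (simp_all add: proj_defs algebra_simps)

lemma proj_mult_left:
  assumes "w * J = J * w"
  shows "proj_arm J a b (w * v) = w * proj_arm J a b v"
    "proj_leg J a b (w * v) = w * proj_leg J a b v"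
    "proj_zero J a b (w * v) = w * proj_zero J a b v"
proof -
  have "J * (w * x) = w * (J * x)" for x
    using assms by (metis mult.assoc)
  thus "proj_arm J a b (w * v) = w * proj_arm J a b v"
    "proj_leg J a b (w * v) = w * proj_leg J a b v"
    "proj_zero J a b (w * v) = w * proj_zero J a b v"
    by (simp_all add: proj_defs algebra_simps)
qed

lemma proj_sum:
  "proj_arm J a b (\<Sum>i\<in>I. v i) = (\<Sum>i\<in>I. proj_arm J a b (v i))"
  "proj_leg J a b (\<Sum>i\<in>I. v i) = (\<Sum>i\<in>I. proj_leg J a b (v i))"
  "proj_zero J a b (\<Sum>i\<in>I. v i) = (\<Sum>i\<in>I. proj_zero J a b (v i))"
  by (simp_all add: proj_defs sum_distrib_left scl_sum_right scl_add_right scl_diff_right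
      sum.distrib sum_subtractf)

lemma proj_0 [simp]: "proj_arm J a b 0 = 0" "proj_leg J a b 0 = 0" "proj_zero J a b 0 = 0"
  by (simp_all add: proj_defs)

lemma proj_eigen:
  assumes "J * v = c *\<^sub>C v"
  shows "proj_arm J a b v = (c * (c + b) / (a * (a + b))) *\<^sub>C v"
    and "proj_leg J a b v = (c * (c - a) / (b * (a + b))) *\<^sub>C v"
  using assms
  by (simp_all add: proj_defs scl_add_left[symmetric] scl_diff_left[symmetric] algebra_simps)

lemma proj_alg:
  assumes "J \<in> alg n" "v \<in> alg n"
  shows "proj_arm J a b v \<in> alg n" "proj_leg J a b v \<in> alg n" "proj_zero J a b v \<in> alg n"
  using assms unfolding proj_defs by (auto intro!: alg_diff alg_scl alg_add alg_mult)

lemma proj_cent: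
  assumes "J \<in> cent n" "v \<in> cent n"
  shows "proj_arm J a b v \<in> cent n" "proj_leg J a b v \<in> cent n" "proj_zero J a b v \<in> cent n"
  using assms unfolding proj_defs by (auto intro!: cent_diff cent_scl cent_add cent_mult)

text \<open>For the hook \<open>(m - k, 1\<^sup>k)\<close>, the contents of the boxes that can be added to the arm
  and to the leg are \<open>arm m k\<close> and \<open>- leg k\<close>.\<close>

definition arm :: "nat \<Rightarrow> nat \<Rightarrow> complex" where
  "arm m k = of_nat m - of_nat k"

definition leg :: "nat \<Rightarrow> complex" where
  "leg k = of_nat k + 1"

lemma arm_add_leg: "arm m k + leg k = of_nat m + 1"
  by (simp add: arm_def leg_def)

lemma arm_leg_nonzero: "k < m \<Longrightarrow> arm m k \<noteq> 0" "leg k \<noteq> 0" "arm m k + leg k \<noteq> 0"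
  unfolding arm_add_leg by (simp_all add: arm_def leg_def of_nat_neq_0 add.commute
      del: of_nat_Suc flip: of_nat_Suc)

text \<open>The central idempotent of \<open>\<complex>[S\<^sub>m]\<close> belonging to the hook \<open>(m - k, 1\<^sup>k)\<close>.\<close>

primrec hookF :: "nat \<Rightarrow> nat \<Rightarrow> sga" where
  "hookF 0 k = 0"
| "hookF (Suc m) k = (if m = 0 then (if k = 0 then 1 else 0) else
     proj_arm (JM (Suc m)) (arm m k) (leg k) (hookF m k)
     + (if k = 0 then 0 else proj_leg (JM (Suc m)) (arm m (k - 1)) (leg (k - 1)) (hookF m (k - 1))))"

text \<open>The product of the contents of all boxes of the hook except the corner: 1, ..., m - k -
  1 along the arm and -1, ..., -k down the leg.\<close>

definition hook_eig :: "nat \<Rightarrow> nat \<Rightarrow> complex" where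
  "hook_eig m k = (-1) ^ k * fact (m - 1 - k) * fact k"

lemma hookF_eq_0: "m \<le> k \<Longrightarrow> hookF m k = 0"
proof (induction m arbitrary: k)
  case (Suc m)
  show ?case using Suc.prems by (auto simp: Suc.IH)
qed simp

lemma hookF_alg: "hookF m k \<in> alg m"
proof (induction m arbitrary: k)
  case (Suc m)
  have "hookF m k \<in> alg (Suc m)" for k using Suc.IH alg_mono[of m "Suc m"] by simp
  thus ?case by (auto intro!: alg_add proj_alg JM_alg)
qed simp

text \<open>The element \<open>J\<^bsub>m+1\<^esub>\<close> is \<open>m\<close> times the average over \<open>S\<^sub>m\<close> of the transposition \<open>s = (m, m + 1)\<close>, and
  \<open>J\<^bsub>m+1\<^esub>\<^sup>2 s = s J\<^sub>m\<^sup>2 + J\<^bsub>m+1\<^esub> + J\<^sub>m\<close>. Averaging turns the quadratic relation for \<open>J\<^sub>m\<close> into the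
  cubic one for \<open>J\<^bsub>m+1\<^esub>\<close>.\<close>

lemma hook_cubic:
  assumes m: "m \<ge> 1"
    and cent: "F \<in> cent m"
    and sum: "JM_sum m * F = ((a - b) * of_nat m / 2) *\<^sub>C F"
    and quad: "JM m * (JM m * F) = (a - b) *\<^sub>C (JM m * F) + ((a - 1) * (b - 1)) *\<^sub>C F"
    and ab: "a + b = of_nat m + 1"
  shows "cubic (JM (Suc m)) a b F"
proof -
  let ?J = "JM (Suc m)" and ?s = "el (tp m (Suc m))"
  have JJs: "?J * (?J * ?s) = ?s * (JM m * JM m) + ?J + JM m"
    unfolding JM_Suc_times_adjacent[OF m] distrib_left mult.assoc[symmetric]
    by (simp add: JM_Suc_times_adjacent[OF m] algebra_simps)
  note avs = avg_adjacent(1)[OF m] and avsJ = avg_adjacent(2)[OF m]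
  have "avg m (?J * (?J * ?s) * F) = ?J * (?J * avg m ?s) * F"
    by (simp add: avg_cent_mult_left avg_cent_mult_right JM_cent cent)
  hence 1: "avg m (?J * (?J * ?s) * F) = (1 / of_nat m) *\<^sub>C (?J * (?J * (?J * F)))"
    by (simp add: avs mult.assoc)
  have "?J * (?J * ?s) * F
      = (a - b) *\<^sub>C (?s * JM m * F) + ((a - 1) * (b - 1)) *\<^sub>C (?s * F) + ?J * F + JM m * F"
    unfolding JJs by (simp add: distrib_right mult.assoc quad distrib_left)
  hence "avg m (?J * (?J * ?s) * F) = (a - b) *\<^sub>C (avg m (?s * JM m) * F)
      + ((a - 1) * (b - 1)) *\<^sub>C (avg m ?s * F) + ?J * F + avg m (JM m) * F"
    by (simp add: avg_add avg_scl avg_cent_mult_right cent avg_cent JM_cent)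
  \<comment> \<open>The factor 2 / m of \<open>avg_JM\<close> cancels the m / 2 in the eigenvalue of
    \<open>JM_sum m\<close>. The resulting term cancels in turn against the -1 in
    \<open>avsJ\<close>, so no multiple of F is left over; this is where the root 0 comes
    from.\<close>
  also have "avg m (JM m) * F = (a - b) *\<^sub>C F"
    using m by (simp add: avg_JM sum diff_divide_distrib)
  finally have "(1 / of_nat m) *\<^sub>C (?J * (?J * (?J * F)))
      = (a - b) *\<^sub>C (((1 / of_nat m) *\<^sub>C (?J * ?J) - 1) * F)
        + ((a - 1) * (b - 1)) *\<^sub>C ((1 / of_nat m) *\<^sub>C ?J * F) + ?J * F + (a - b) *\<^sub>C F"
    unfolding 1 avsJ avs .
  note h = this
  have 2: "(1 / of_nat m) *\<^sub>C (?J * (?J * (?J * F)))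
      = ((a - b) / of_nat m) *\<^sub>C (?J * (?J * F)) + ((a - 1) * (b - 1) / of_nat m + 1) *\<^sub>C (?J * F)"
  proof (rule sga_eqI)
    fix g
    show "coef ((1 / of_nat m) *\<^sub>C (?J * (?J * (?J * F)))) g
        = coef (((a - b) / of_nat m) *\<^sub>C (?J * (?J * F))
            + ((a - 1) * (b - 1) / of_nat m + 1) *\<^sub>C (?J * F)) g"
      unfolding h by (simp add: lookup_add lookup_minus mult.assoc algebra_simps
          add_divide_distrib diff_divide_distrib)
  qed
  have "of_nat m *\<^sub>C ((1 / of_nat m) *\<^sub>C (?J * (?J * (?J * F))))
      = (a - b) *\<^sub>C (?J * (?J * F)) + ((a - 1) * (b - 1) + of_nat m) *\<^sub>C (?J * F)"
  proof -
    have "of_nat m * ((a - b) / of_nat m) = a - b"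
        "of_nat m * ((a - 1) * (b - 1) / of_nat m + 1) = (a - 1) * (b - 1) + of_nat m"
      using m by (simp_all add: distrib_left)
    thus ?thesis unfolding 2 scl_add_right by (simp only: scl_scl)
  qed
  \<comment> \<open>The roots a - 1 and -(b - 1) of the quadratic relation become a and -b, thanks
    to a + b = m + 1.\<close>
  moreover have "(a - 1) * (b - 1) + of_nat m = a * b"
    using ab by (simp add: algebra_simps)
  ultimately show ?thesis using m by (simp add: cubic_def)
qed

text \<open>The eigenvalues of \<open>p\<close> force \<open>F l * g * F k = 0\<close> for \<open>l \<noteq> k\<close>; since \<open>z\<close> commutes with \<open>g\<close>, both
  \<open>g * F k\<close> and \<open>F k * g\<close> are then equal to \<open>F k * g * F k\<close>.\<close>

lemma separated_commute:
  fixes F :: "nat \<Rightarrow> sga"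
  assumes fin: "finite K" and k: "k \<in> K"
    and p: "p * g = g * p" and z: "z * g = g * z"
    and zF: "z = (\<Sum>l\<in>K. w l *\<^sub>C F l)"
    and zk: "z * F k = w k *\<^sub>C F k" "F k * z = w k *\<^sub>C F k" and w: "w k \<noteq> 0"
    and pl: "\<And>l. l \<in> K \<Longrightarrow> p * F l = c l *\<^sub>C F l" "\<And>l. l \<in> K \<Longrightarrow> F l * p = c l *\<^sub>C F l"
    and c: "\<And>l. l \<in> K \<Longrightarrow> l \<noteq> k \<Longrightarrow> c l \<noteq> c k"
  shows "g * F k = F k * g"
proof -
  have 0: "F i * g * F j = 0" if "i \<in> K" "j \<in> K" "c i \<noteq> c j" for i j
  proof -
    have "c i *\<^sub>C (F i * g * F j) = F i * p * g * F j" using pl(2) that by simp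
    also have "\<dots> = F i * g * (p * F j)" by (simp add: mult.assoc) (metis p mult.assoc)
    also have "\<dots> = c j *\<^sub>C (F i * g * F j)" using pl(1) that by simp
    finally have "(c i - c j) *\<^sub>C (F i * g * F j) = 0" by (simp add: scl_diff_left)
    thus ?thesis using that by (simp add: scl_eq_0_iff)
  qed
  have "w k *\<^sub>C (g * F k) = g * z * F k" by (simp add: mult.assoc zk)
  also have "\<dots> = z * g * F k" by (simp add: z)
  also have "\<dots> = (\<Sum>l\<in>K. w l *\<^sub>C (F l * g * F k))"
    by (simp add: zF sum_distrib_right)
  also have "\<dots> = w k *\<^sub>C (F k * g * F k)"
    by (subst sum.remove[OF fin k]) (auto intro!: sum.neutral simp: 0 c k)
  finally have 1: "g * F k = F k * g * F k" by (rule scl_cancel[OF w])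
  have "w k *\<^sub>C (F k * g) = F k * z * g" by (simp add: zk)
  also have "\<dots> = F k * g * z" by (simp add: z mult.assoc)
  also have "\<dots> = (\<Sum>l\<in>K. w l *\<^sub>C (F k * g * F l))"
    by (simp add: zF sum_distrib_left)
  also have "\<dots> = w k *\<^sub>C (F k * g * F k)"
  proof (subst sum.remove[OF fin k])
    have "F k * g * F l = 0" if "l \<in> K - {k}" for l
      using that c[of l] by (intro 0) (auto simp: k)
    thus "w k *\<^sub>C (F k * g * F k) + (\<Sum>l\<in>K - {k}. w l *\<^sub>C (F k * g * F l)) = w k *\<^sub>C (F k * g * F k)"
      by simp
  qed
  finally have "F k * g = F k * g * F k" by (rule scl_cancel[OF w])
  thus ?thesis using 1 by simp
qed

text \<open>These statements are proved by one induction: centrality at size m + 1 rests on the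
  eigenvalues and on the decomposition of the product, those rest on the cubic equation, and the
  cubic rests on centrality and the quadratic relation at size m. The quadratic has as roots the
  contents of the two boxes that may have been added last.\<close>

definition hook_inv :: "nat \<Rightarrow> bool" where
  "hook_inv m \<longleftrightarrow> JM_prod m = (\<Sum>k<m. hook_eig m k *\<^sub>C hookF m k) \<and>
    (\<forall>k<m. hookF m k \<in> cent m \<and>
      JM_sum m * hookF m k = ((arm m k - leg k) * of_nat m / 2) *\<^sub>C hookF m k \<and>
      JM_prod m * hookF m k = hook_eig m k *\<^sub>C hookF m k \<and>
      JM m * (JM m * hookF m k) = (arm m k - leg k) *\<^sub>C (JM m * hookF m k)
        + ((arm m k - 1) * (leg k - 1)) *\<^sub>C hookF m k)"

lemma hook_inv_cubic:
  assumes "hook_inv m" "k < m"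
  shows "cubic (JM (Suc m)) (arm m k) (leg k) (hookF m k)"
  using assms hook_cubic[of m "hookF m k" "arm m k" "leg k"]
  by (auto simp: hook_inv_def arm_add_leg)

abbreviation hookA :: "nat \<Rightarrow> nat \<Rightarrow> sga" where
  "hookA m k \<equiv> proj_arm (JM (Suc m)) (arm m k) (leg k) (hookF m k)"

abbreviation hookL :: "nat \<Rightarrow> nat \<Rightarrow> sga" where
  "hookL m k \<equiv> proj_leg (JM (Suc m)) (arm m k) (leg k) (hookF m k)"

abbreviation hookZ :: "nat \<Rightarrow> nat \<Rightarrow> sga" where
  "hookZ m k \<equiv> proj_zero (JM (Suc m)) (arm m k) (leg k) (hookF m k)"

lemma hook_eig_Suc_arm: "k < m \<Longrightarrow> hook_eig (Suc m) k = arm m k * hook_eig m k"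
proof -
  assume k: "k < m"
  then obtain d where "m = Suc (k + d)" using less_iff_Suc_add by auto
  thus ?thesis by (simp add: hook_eig_def arm_def algebra_simps)
qed

lemma hook_eig_Suc_leg: "k < m \<Longrightarrow> hook_eig (Suc m) (Suc k) = - leg k * hook_eig m k"
  by (simp add: hook_eig_def leg_def algebra_simps)

lemma hook_eig_nonzero: "hook_eig m k \<noteq> 0"
  by (simp add: hook_eig_def)

lemma hook_inv_1: "hook_inv (Suc 0)"
  by (simp add: hook_inv_def hook_eig_def arm_def leg_def JM_sum_def)

text \<open>The branching rule: removing a corner of the hook with leg k shortens either the arm or
  the leg.\<close>

lemma hookF_Suc: "m \<ge> 1 \<Longrightarrow>
  hookF (Suc m) k = hookA m k + (if k = 0 then 0 else hookL m (k - 1))"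
  by simp

declare hookF.simps(2) [simp del]

lemma JM_prod_Suc: "m \<ge> 1 \<Longrightarrow> JM_prod (Suc m) = JM (Suc m) * JM_prod m"
  by simp

declare JM_prod.simps(2) [simp del]

text \<open>The arm and leg parts are joint eigenvectors of \<open>JM (Suc m)\<close>,
  \<open>JM_sum m\<close> and \<open>JM_prod m\<close>, with eigenvalues on the next sum and product
  that depend only on the hook they lead to. Hence they may be added up to
  \<open>hookF (Suc m)\<close>. Centrality comes last, from
  \<open>separated_commute\<close>.\<close>

lemma hook_inv_Suc:
  assumes m: "m \<ge> 1" and inv: "hook_inv m"
  shows "hook_inv (Suc m)"
proof -
  let ?J = "JM (Suc m)"
  have cent: "hookF m k \<in> cent m" if "k < m" for k using inv that by (simp add: hook_inv_def)
  have cub: "cubic ?J (arm m k) (leg k) (hookF m k)" if "k < m" for k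
    using hook_inv_cubic[OF inv that] .
  have JA: "?J * hookA m k = arm m k *\<^sub>C hookA m k" for k
    by (cases "k < m") (auto simp: JM_proj_arm[OF cub] hookF_eq_0)
  have JL: "?J * hookL m k = (- leg k) *\<^sub>C hookL m k" for k
    by (cases "k < m") (auto simp: JM_proj_leg[OF cub] hookF_eq_0)
  have comm: "x * ?J = ?J * x" if "x \<in> alg m" for x
    using that by (rule cent_commute[OF JM_cent])
  have pA: "JM_sum m * hookA m k = ((arm m k - leg k) * of_nat m / 2) *\<^sub>C hookA m k"
    and pL: "JM_sum m * hookL m k = ((arm m k - leg k) * of_nat m / 2) *\<^sub>C hookL m k"
    and zA: "JM_prod m * hookA m k = hook_eig m k *\<^sub>C hookA m k"
    and zL: "JM_prod m * hookL m k = hook_eig m k *\<^sub>C hookL m k" if k: "k < m" for k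
  proof -
    have l: "proj_arm ?J a b (c *\<^sub>C v) = c *\<^sub>C proj_arm ?J a b v"
        "proj_leg ?J a b (c *\<^sub>C v) = c *\<^sub>C proj_leg ?J a b v" for a b c v
      by (simp_all add: proj_defs scl_add_right scl_diff_right mult_ac)
    have i: "JM_sum m * hookF m k = ((arm m k - leg k) * of_nat m / 2) *\<^sub>C hookF m k"
        "JM_prod m * hookF m k = hook_eig m k *\<^sub>C hookF m k"
      using inv k unfolding hook_inv_def by blast+
    note pl = proj_mult_left[OF comm[OF JM_sum_alg]] proj_mult_left[OF comm[OF JM_prod_alg]]
    show "JM_sum m * hookA m k = ((arm m k - leg k) * of_nat m / 2) *\<^sub>C hookA m k"
      "JM_sum m * hookL m k = ((arm m k - leg k) * of_nat m / 2) *\<^sub>C hookL m k"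
      "JM_prod m * hookA m k = hook_eig m k *\<^sub>C hookA m k"
      "JM_prod m * hookL m k = hook_eig m k *\<^sub>C hookL m k"
      by (simp_all add: l i flip: pl)
  qed
  have pA': "JM_sum (Suc m) * hookA m k = ((arm (Suc m) k - leg k) * of_nat (Suc m) / 2) *\<^sub>C hookA m k" for k
  proof (cases "k < m")
    case True
    \<comment> \<open>The content of the new box is added to the total content, which gives the
      total content of the larger hook.\<close>
    have "(arm m k - leg k) * of_nat m / 2 + arm m k = (arm (Suc m) k - leg k) * of_nat (Suc m) / 2"
      by (simp add: arm_def leg_def field_simps)
    moreover have "JM_sum (Suc m) * hookA m k = ((arm m k - leg k) * of_nat m / 2 + arm m k) *\<^sub>C hookA m k"
      using pA[OF True] JA[of k] by (simp only: JM_sum_Suc distrib_right scl_add_left)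
    ultimately show ?thesis by (simp only:)
  qed (simp add: hookF_eq_0)
  have pL': "JM_sum (Suc m) * hookL m k = ((arm (Suc m) (Suc k) - leg (Suc k)) * of_nat (Suc m) / 2) *\<^sub>C hookL m k" for k
  proof (cases "k < m")
    case True
    have "(arm m k - leg k) * of_nat m / 2 + (- leg k)
        = (arm (Suc m) (Suc k) - leg (Suc k)) * of_nat (Suc m) / 2"
      by (simp add: arm_def leg_def field_simps)
    moreover have "JM_sum (Suc m) * hookL m k = ((arm m k - leg k) * of_nat m / 2 + (- leg k)) *\<^sub>C hookL m k"
      using pL[OF True] JL[of k] by (simp only: JM_sum_Suc distrib_right scl_add_left)
    ultimately show ?thesis by (simp only:)
  qed (simp add: hookF_eq_0)
  have zA': "JM_prod (Suc m) * hookA m k = hook_eig (Suc m) k *\<^sub>C hookA m k" for k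
  proof (cases "k < m")
    case True
    thus ?thesis using zA[OF True] JA[of k] m
      by (simp add: JM_prod_Suc mult.assoc hook_eig_Suc_arm mult.commute)
  qed (simp add: hookF_eq_0)
  have zL': "JM_prod (Suc m) * hookL m k = hook_eig (Suc m) (Suc k) *\<^sub>C hookL m k" for k
  proof (cases "k < m")
    case True
    thus ?thesis using zL[OF True] JL[of k] m
      by (simp add: JM_prod_Suc mult.assoc hook_eig_Suc_leg mult.commute)
  qed (simp add: hookF_eq_0)
  have sum: "JM_sum (Suc m) * hookF (Suc m) k
      = ((arm (Suc m) k - leg k) * of_nat (Suc m) / 2) *\<^sub>C hookF (Suc m) k" for k
    using pA'[of k] pL'[of "k - 1"] m
    by (simp add: hookF_Suc distrib_left scl_add_right del: of_nat_Suc)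
  have prod: "JM_prod (Suc m) * hookF (Suc m) k = hook_eig (Suc m) k *\<^sub>C hookF (Suc m) k" for k
    using zA'[of k] zL'[of "k - 1"] m
    by (simp add: hookF_Suc distrib_left scl_add_right)
  have quad: "JM (Suc m) * (JM (Suc m) * hookF (Suc m) k)
      = (arm (Suc m) k - leg k) *\<^sub>C (JM (Suc m) * hookF (Suc m) k)
        + ((arm (Suc m) k - 1) * (leg k - 1)) *\<^sub>C hookF (Suc m) k" for k
  proof -
    have e: "arm (Suc m) k = arm m k + 1" "k \<noteq> 0 \<Longrightarrow> leg k = leg (k - 1) + 1"
      "k = 0 \<Longrightarrow> leg k = 1"
      by (auto simp: arm_def leg_def of_nat_diff)
    define A where "A = hookA m k"
    define L where "L = (if k = 0 then 0 else hookL m (k - 1))"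
    have F: "hookF (Suc m) k = A + L" using m by (simp add: A_def L_def hookF_Suc)
    have a: "?J * A = arm m k *\<^sub>C A" unfolding A_def by (rule JA)
    have l: "?J * L = (1 - leg k) *\<^sub>C L"
      using JL[of "k - 1"] e by (simp add: L_def)
    \<comment> \<open>A and L belong to the roots \<open>arm (Suc m) k - 1\<close> and
      \<open>1 - leg k\<close> of the quadratic.\<close>
    show ?thesis unfolding F e(1)
      by (rule sga_eqI) (simp add: distrib_left a l lookup_add algebra_simps)
  qed
  have decomp: "JM_prod (Suc m) = (\<Sum>k<Suc m. hook_eig (Suc m) k *\<^sub>C hookF (Suc m) k)"
  proof -
    \<comment> \<open>\<open>JM (Suc m)\<close> annihilates the third part of every hook; this keeps
      the product within the span of the hooks.\<close>
    have "JM_prod (Suc m) = ?J * (\<Sum>k<m. hook_eig m k *\<^sub>C hookF m k)"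
      using inv m by (simp add: JM_prod_Suc hook_inv_def)
    also have "\<dots> = (\<Sum>k<m. hook_eig m k *\<^sub>C (?J * hookF m k))"
      by (simp add: sum_distrib_left)
    also have "\<dots> = (\<Sum>k<m. hook_eig m k *\<^sub>C (arm m k *\<^sub>C hookA m k + (- leg k) *\<^sub>C hookL m k))"
    proof (rule sum.cong[OF refl])
      fix k assume "k \<in> {..<m}"
      hence k: "k < m" by simp
      show "hook_eig m k *\<^sub>C (?J * hookF m k)
          = hook_eig m k *\<^sub>C (arm m k *\<^sub>C hookA m k + (- leg k) *\<^sub>C hookL m k)"
        using JM_proj_sum[OF cub[OF k] arm_leg_nonzero(1)[OF k] arm_leg_nonzero(2,3)] JA[of k] JL[of k] by simp
    qed
    also have "\<dots> = (\<Sum>k<m. hook_eig (Suc m) k *\<^sub>C hookA m k)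
        + (\<Sum>k<m. hook_eig (Suc m) (Suc k) *\<^sub>C hookL m k)"
      unfolding sum.distrib[symmetric]
      by (rule sum.cong) (auto simp: scl_add_right hook_eig_Suc_arm hook_eig_Suc_leg mult.commute)
    also have "(\<Sum>k<m. hook_eig (Suc m) k *\<^sub>C hookA m k) = (\<Sum>k<Suc m. hook_eig (Suc m) k *\<^sub>C hookA m k)"
      by (simp add: hookF_eq_0)
    also have "(\<Sum>k<m. hook_eig (Suc m) (Suc k) *\<^sub>C hookL m k)
        = (\<Sum>k<Suc m. hook_eig (Suc m) k *\<^sub>C (if k = 0 then 0 else hookL m (k - 1)))"
      unfolding sum.lessThan_Suc_shift by simp
    finally show ?thesis
      using m by (simp add: hookF_Suc scl_add_right flip: sum.distrib del: sum.lessThan_Suc)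
  qed
  have "hookF (Suc m) k \<in> cent (Suc m)" if k: "k < Suc m" for k
    unfolding cent_def
  proof clarify
    fix g assume g: "g \<in> Sn (Suc m)"
    let ?c = "\<lambda>k. (arm (Suc m) k - leg k) * of_nat (Suc m) / 2"
    have comm: "hookF (Suc m) k * z = z * hookF (Suc m) k" if "z \<in> cent (Suc m)" for z k
      by (rule cent_commute[OF that hookF_alg])
    show "el g * hookF (Suc m) k = hookF (Suc m) k * el g"
    proof (rule separated_commute[where K="{..<Suc m}" and p="JM_sum (Suc m)" and z="JM_prod (Suc m)"
            and w="hook_eig (Suc m)" and c="?c"])
      show "JM_sum (Suc m) * el g = el g * JM_sum (Suc m)"
        using centD[OF JM_sum_cent g] by simp
      show "JM_prod (Suc m) * el g = el g * JM_prod (Suc m)"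
        using centD[OF JM_prod_cent g] by simp
      \<comment> \<open>The eigenvalue equals (m - 2 k) (m + 1) / 2, which is injective in
        k.\<close>
      show "?c l \<noteq> ?c k" if "l \<noteq> k" for l
        using that by (simp add: arm_def leg_def del: of_nat_Suc) 
      show "JM_prod (Suc m) = (\<Sum>l<Suc m. hook_eig (Suc m) l *\<^sub>C hookF (Suc m) l)"
        by (rule decomp)
    qed (use k prod sum in \<open>auto simp: comm JM_sum_cent JM_prod_cent hook_eig_nonzero simp del: of_nat_Suc\<close>)
  qed
  thus ?thesis unfolding hook_inv_def using decomp sum prod quad by blast
qed

lemma hook_inv: "m \<ge> 1 \<Longrightarrow> hook_inv m"
  by (induction m rule: nat_induct_at_least) (auto intro: hook_inv_1 hook_inv_Suc)

lemma hookF_cent: "k < m \<Longrightarrow> hookF m k \<in> cent m"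
  using hook_inv[of m] by (auto simp: hook_inv_def)

lemma hookF_cubic: "k < m \<Longrightarrow> cubic (JM (Suc m)) (arm m k) (leg k) (hookF m k)"
  using hook_inv[of m] hook_inv_cubic by auto

lemma JM_sum_hookF: "k < m \<Longrightarrow>
  JM_sum m * hookF m k = ((arm m k - leg k) * of_nat m / 2) *\<^sub>C hookF m k"
  using hook_inv[of m] by (auto simp: hook_inv_def)

lemma JM_prod_hookF: "m \<ge> 1 \<Longrightarrow> JM_prod m = (\<Sum>k<m. hook_eig m k *\<^sub>C hookF m k)"
  using hook_inv[of m] by (auto simp: hook_inv_def)

lemma JM_hookA: "JM (Suc m) * hookA m k = arm m k *\<^sub>C hookA m k"
  by (cases "k < m") (auto simp: JM_proj_arm[OF hookF_cubic] hookF_eq_0)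

lemma JM_hookL: "JM (Suc m) * hookL m k = (- leg k) *\<^sub>C hookL m k"
  by (cases "k < m") (auto simp: JM_proj_leg[OF hookF_cubic] hookF_eq_0)

lemma JM_hookZ: "JM (Suc m) * hookZ m k = 0"
  by (cases "k < m")
     (auto simp: JM_proj_zero[OF hookF_cubic arm_leg_nonzero] hookF_eq_0)

lemma hookF_JM_commute: "hookF m k * JM (Suc m) = JM (Suc m) * hookF m k"
  by (rule cent_commute[OF JM_cent hookF_alg])

lemma hookF_split: "hookF m k = hookA m k + hookL m k + hookZ m k"
  by (simp add: proj_zero_def)

text \<open>The two factors have different eigenvalues under \<open>JM_sum m\<close>, which can be
  moved past the first of them.\<close>

lemma hookF_orthogonal: "i \<noteq> j \<Longrightarrow> hookF m i * hookF m j = 0"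
proof (cases "i < m \<and> j < m")
  case True
  assume ij: "i \<noteq> j"
  let ?c = "\<lambda>k. (arm m k - leg k) * of_nat m / 2"
  have "?c i *\<^sub>C (hookF m i * hookF m j) = JM_sum m * (hookF m i * hookF m j)"
    using True by (simp add: JM_sum_hookF flip: mult.assoc)
  also have "\<dots> = hookF m i * (JM_sum m * hookF m j)"
    by (simp add: cent_commute[OF JM_sum_cent hookF_alg] flip: mult.assoc)
  also have "\<dots> = ?c j *\<^sub>C (hookF m i * hookF m j)"
    using True by (simp add: JM_sum_hookF)
  finally have "(?c i - ?c j) *\<^sub>C (hookF m i * hookF m j) = 0"
    by (simp only: scl_diff_left diff_self)
  moreover have "?c i - ?c j \<noteq> 0" using True ij by (simp add: arm_def leg_def)
  ultimately show ?thesis by (metis scl_eq_0_iff)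
qed (auto simp: hookF_eq_0 not_less)


subsection \<open>The centralizer acts by scalars\<close>

text \<open>A permutation in \<open>S\<^bsub>m+1\<^esub>\<close> outside \<open>S\<^sub>m\<close> is \<open>S\<^sub>m\<close>-conjugate to \<open>s y\<close> with \<open>y\<close> in \<open>S\<^sub>m\<close>, so that its
  average over \<open>S\<^sub>m\<close> is determined by the average of \<open>y\<close> over \<open>S\<^bsub>m-1\<^esub>\<close>.\<close>

lemma avg_hookF_quadratic_step:
  assumes m: "m \<ge> 1" and k: "k < m" and g: "g \<in> Sn (Suc m)"
    and L: "\<And>g. g \<in> Sn m \<Longrightarrow> \<exists>\<alpha> \<beta>. avg (m - 1) (el g) * hookF m k
        = \<alpha> *\<^sub>C hookF m k + \<beta> *\<^sub>C (JM m * hookF m k)"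
  shows "\<exists>\<alpha> \<beta> \<gamma>. avg m (el g) * hookF m k = \<alpha> *\<^sub>C hookF m k
    + \<beta> *\<^sub>C (JM (Suc m) * hookF m k) + \<gamma> *\<^sub>C (JM (Suc m) * (JM (Suc m) * hookF m k))"
proof -
  let ?F = "hookF m k" and ?J = "JM (Suc m)" and ?s = "el (tp m (Suc m))"
  note F = hookF_cent[OF k]
  from g show ?thesis
  proof (cases rule: Sn_Suc_cases)
    case 1
    then obtain \<alpha> \<beta> where ab: "avg (m - 1) (el g) * ?F = \<alpha> *\<^sub>C ?F + \<beta> *\<^sub>C (JM m * ?F)"
      using L by blast
    \<comment> \<open>Inside S_m the linear relation applies at once, and averaging
      \<open>JM m\<close> over S_m leaves a multiple of F.\<close>
    have "avg m (el g) * ?F = avg m (avg (m - 1) (el g) * ?F)"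
      by (simp add: avg_cent_mult_right[OF F] avg_avg)
    also have "\<dots> = \<alpha> *\<^sub>C ?F + \<beta> *\<^sub>C (avg m (JM m) * ?F)"
      unfolding ab by (simp add: avg_add avg_scl avg_cent_mult_right[OF F] avg_cent[OF F])
    also have "\<dots> = (\<alpha> + \<beta> * (2 / of_nat m) * ((arm m k - leg k) * of_nat m / 2)) *\<^sub>C ?F
        + 0 *\<^sub>C (?J * ?F) + 0 *\<^sub>C (?J * (?J * ?F))"
      by (simp only: avg_JM[OF m] JM_sum_hookF[OF k] scl_mult scl_scl scl_add_left scl_zero
          add_0_right mult.assoc)
    finally show ?thesis by blast
  next
    case (2 x h)
    \<comment> \<open>Chosen so that g is the product s y conjugated by
      \<open>(x, m)\<close>.\<close>
    let ?y = "tp x m + h + tp x m"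
    have t: "tp x m \<in> Sn m" using 2 by (intro tp_in_Sn) auto
    have y: "?y \<in> Sn m" using t 2 by (intro Sn_add)
    then obtain \<alpha> \<beta> where ab: "avg (m - 1) (el ?y) * ?F = \<alpha> *\<^sub>C ?F + \<beta> *\<^sub>C (JM m * ?F)"
      using L by blast
    have "g = tp x m + (tp m (Suc m) + ?y) - tp x m"
    proof -
      have "tp x m + (tp m (Suc m) + ?y) - tp x m = tp x m + tp m (Suc m) + tp x m + h"
        by (simp add: add.assoc diff_eq_eq)
      thus ?thesis using 2 tp_conj_adjacent[of x m] by simp
    qed
    hence "el g = el (tp x m) * (?s * el ?y) * el (- tp x m)"
      by (metis add_uminus_conv_diff el_add)
    hence "avg m (el g) = avg m (?s * el ?y)" by (simp only: avg_conj[OF t])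
    \<comment> \<open>s commutes with S_{m-1}, so averaging over S_{m-1} first affects only y, and
      the hypothesis \<open>L\<close> applies to y.\<close>
    also have "\<dots> = avg m (avg (m - 1) (?s * el ?y))" by (simp add: avg_avg)
    also have "\<dots> = avg m (?s * avg (m - 1) (el ?y))"
      by (simp only: avg_cent_mult_left[OF adjacent_cent])
    finally have "avg m (el g) * ?F = avg m (?s * (avg (m - 1) (el ?y) * ?F))"
      by (simp only: avg_cent_mult_right[OF F, symmetric] mult.assoc)
    also have "\<dots> = \<alpha> *\<^sub>C (avg m ?s * ?F) + \<beta> *\<^sub>C (avg m (?s * JM m) * ?F)"
      unfolding ab
      by (simp add: avg_add avg_scl distrib_left avg_cent_mult_right[OF F] flip: mult.assoc)
    also have "\<dots> = (- \<beta>) *\<^sub>C ?F + (\<alpha> / of_nat m) *\<^sub>C (?J * ?F)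
        + (\<beta> / of_nat m) *\<^sub>C (?J * (?J * ?F))"
      unfolding avg_adjacent[OF m]
      by (rule sga_eqI) (simp add: left_diff_distrib lookup_add lookup_minus mult.assoc algebra_simps)
    finally show ?thesis by blast
  qed
qed

lemma quadratic_scalar:
  assumes X: "X * F = \<alpha> *\<^sub>C F + \<beta> *\<^sub>C (J * F) + \<gamma> *\<^sub>C (J * (J * F))"
    and J: "J * (F * P) = c *\<^sub>C (F * P)"
  shows "X * (F * P) = (\<alpha> + \<beta> * c + \<gamma> * c * c) *\<^sub>C (F * P)"
proof -
  have "X * (F * P) = (X * F) * P" by (simp add: mult.assoc)
  also have "\<dots> = \<alpha> *\<^sub>C (F * P) + \<beta> *\<^sub>C (J * (F * P)) + \<gamma> *\<^sub>C (J * (J * (F * P)))"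
    unfolding X by (simp add: distrib_right mult.assoc)
  also have "\<dots> = (\<alpha> + \<beta> * c + \<gamma> * c * c) *\<^sub>C (F * P)"
    by (simp add: J scl_add_left mult_ac)
  finally show ?thesis .
qed

text \<open>With F as the left factor, a relation for \<open>X * F\<close> passes to the three parts
  by multiplication on the right.\<close>

lemma hook_proj_factor:
  "hookA m k = hookF m k * proj_arm (JM (Suc m)) (arm m k) (leg k) 1"
  "hookL m k = hookF m k * proj_leg (JM (Suc m)) (arm m k) (leg k) 1"
  "hookZ m k = hookF m k * proj_zero (JM (Suc m)) (arm m k) (leg k) 1"
  using proj_mult_left[OF hookF_JM_commute, where v = 1] by simp_all

lemma quadratic_scalar_hook:
  assumes X: "X * hookF m k = \<alpha> *\<^sub>C hookF m k
    + \<beta> *\<^sub>C (JM (Suc m) * hookF m k) + \<gamma> *\<^sub>C (JM (Suc m) * (JM (Suc m) * hookF m k))"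
  shows "\<exists>\<kappa>. X * hookA m k = \<kappa> *\<^sub>C hookA m k"
    and "\<exists>\<kappa>. X * hookL m k = \<kappa> *\<^sub>C hookL m k"
    and "\<exists>\<kappa>. X * hookZ m k = \<kappa> *\<^sub>C hookZ m k"
proof -
  have "JM (Suc m) * hookZ m k = 0 *\<^sub>C hookZ m k" by (simp add: JM_hookZ)
  thus "\<exists>\<kappa>. X * hookA m k = \<kappa> *\<^sub>C hookA m k" "\<exists>\<kappa>. X * hookL m k = \<kappa> *\<^sub>C hookL m k"
      "\<exists>\<kappa>. X * hookZ m k = \<kappa> *\<^sub>C hookZ m k"
    using JM_hookA[of m k] JM_hookL[of m k] quadratic_scalar[OF X]
    unfolding hook_proj_factor by blast+
qed

text \<open>\<open>JM m\<close> has only two eigenvalues on a hook of size m, so a linear polynomial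
  in it suffices. Inductively, the quadratic relation gives a scalar on each of the two parts of
  \<open>hookF (Suc m) k\<close>, and two scalars are interpolated by a line.\<close>

lemma avg_hookF_linear:
  assumes "m \<ge> 1" "g \<in> Sn m"
  shows "\<exists>\<alpha> \<beta>. avg (m - 1) (el g) * hookF m k = \<alpha> *\<^sub>C hookF m k + \<beta> *\<^sub>C (JM m * hookF m k)"
  using assms
proof (induction m arbitrary: g k rule: nat_induct_at_least)
  case base
  hence "g = 0" by (simp add: Sn_le1)
  hence "avg (1 - 1) (el g) * hookF 1 k = 1 *\<^sub>C hookF 1 k + 0 *\<^sub>C (JM 1 * hookF 1 k)"
    by simp
  thus ?case by blast
next
  case (Suc m)
  let ?X = "avg m (el g)" and ?J = "JM (Suc m)"
  have sc: "\<exists>\<kappa>. ?X * hookA m k = \<kappa> *\<^sub>C hookA m k" "\<exists>\<kappa>. ?X * hookL m k = \<kappa> *\<^sub>C hookL m k" for k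
  proof -
    have "(\<exists>\<kappa>. ?X * hookA m k = \<kappa> *\<^sub>C hookA m k) \<and> (\<exists>\<kappa>. ?X * hookL m k = \<kappa> *\<^sub>C hookL m k)"
    proof (cases "k < m")
      case True
      have "\<exists>\<alpha> \<beta> \<gamma>. ?X * hookF m k = \<alpha> *\<^sub>C hookF m k
          + \<beta> *\<^sub>C (?J * hookF m k) + \<gamma> *\<^sub>C (?J * (?J * hookF m k))"
        by (rule avg_hookF_quadratic_step[OF Suc.hyps True Suc.prems Suc.IH])
      thus ?thesis using quadratic_scalar_hook by blast
    qed (auto simp: hookF_eq_0)
    thus "\<exists>\<kappa>. ?X * hookA m k = \<kappa> *\<^sub>C hookA m k" "\<exists>\<kappa>. ?X * hookL m k = \<kappa> *\<^sub>C hookL m k"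
      by blast+
  qed
  obtain x where x: "?X * hookA m k = x *\<^sub>C hookA m k" using sc by blast
  show ?case
  proof (cases "k = 0")
    case True
    hence "?X * hookF (Suc m) k = x *\<^sub>C hookF (Suc m) k + 0 *\<^sub>C (?J * hookF (Suc m) k)"
      using Suc.hyps x by (simp add: hookF_Suc)
    thus ?thesis unfolding diff_Suc_1 by blast
  next
    case False
    obtain y where y: "?X * hookL m (k - 1) = y *\<^sub>C hookL m (k - 1)" using sc by blast
    define A where "A = hookA m k"
    define L where "L = hookL m (k - 1)"
    have F: "hookF (Suc m) k = A + L"
      using Suc.hyps False by (simp add: hookF_Suc A_def L_def)
    have JA: "?J * A = arm m k *\<^sub>C A" unfolding A_def by (rule JM_hookA)
    have JL: "?J * L = (- leg (k - 1)) *\<^sub>C L" unfolding L_def by (rule JM_hookL)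
    \<comment> \<open>The contents of the two possible last boxes differ by m.\<close>
    have ne: "arm m k + leg (k - 1) \<noteq> 0"
      using False Suc.hyps by (simp add: arm_def leg_def of_nat_diff)
    \<comment> \<open>Slope of the line with value x at the content \<open>arm m k\<close> and y at
      the content \<open>- leg (k - 1)\<close>.\<close>
    define \<beta> where "\<beta> = (x - y) / (arm m k + leg (k - 1))"
    have "\<beta> * (arm m k + leg (k - 1)) = x - y" using ne by (simp add: \<beta>_def)
    hence y': "y = x - \<beta> * arm m k - \<beta> * leg (k - 1)" by (simp add: algebra_simps)
    have "?X * hookF (Suc m) k
        = (x - \<beta> * arm m k) *\<^sub>C hookF (Suc m) k + \<beta> *\<^sub>C (?J * hookF (Suc m) k)"
      using x y unfolding F A_def[symmetric] L_def[symmetric] y'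
      by (intro sga_eqI) (simp add: distrib_left JA JL lookup_add algebra_simps)
    thus ?thesis unfolding diff_Suc_1 by blast
  qed
qed

text \<open>Such an X is its own average, hence a combination of averages of single permutations,
  and for those the quadratic relation in \<open>JM (Suc m)\<close> becomes a scalar on each
  eigenspace. This takes the place of Schur's lemma and multiplicity-free branching.\<close>

lemma near_central_scalar:
  assumes m: "m \<ge> 1" and X: "X \<in> alg (Suc m)" "X \<in> cent m"
  shows "\<exists>\<kappa>. X * hookA m k = \<kappa> *\<^sub>C hookA m k" (is ?A)
    and "\<exists>\<kappa>. X * hookL m k = \<kappa> *\<^sub>C hookL m k" (is ?L)
    and "\<exists>\<kappa>. X * hookZ m k = \<kappa> *\<^sub>C hookZ m k" (is ?Z)
proof -
  have el: "\<exists>\<kappa>. avg m (el g) * hookA m k = \<kappa> *\<^sub>C hookA m k"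
      "\<exists>\<kappa>. avg m (el g) * hookL m k = \<kappa> *\<^sub>C hookL m k"
      "\<exists>\<kappa>. avg m (el g) * hookZ m k = \<kappa> *\<^sub>C hookZ m k" if g: "g \<in> Sn (Suc m)" for g
  proof -
    have "(\<exists>\<kappa>. avg m (el g) * hookA m k = \<kappa> *\<^sub>C hookA m k) \<and>
      (\<exists>\<kappa>. avg m (el g) * hookL m k = \<kappa> *\<^sub>C hookL m k) \<and>
      (\<exists>\<kappa>. avg m (el g) * hookZ m k = \<kappa> *\<^sub>C hookZ m k)"
    proof (cases "k < m")
      case True
      thus ?thesis
        using avg_hookF_quadratic_step[OF m True g avg_hookF_linear[OF m]] quadratic_scalar_hook
        by blast
    qed (auto simp: hookF_eq_0)
    thus "\<exists>\<kappa>. avg m (el g) * hookA m k = \<kappa> *\<^sub>C hookA m k"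
      "\<exists>\<kappa>. avg m (el g) * hookL m k = \<kappa> *\<^sub>C hookL m k"
      "\<exists>\<kappa>. avg m (el g) * hookZ m k = \<kappa> *\<^sub>C hookZ m k" by blast+
  qed
  have exp: "X = (\<Sum>g\<in>Sn (Suc m). coef X g *\<^sub>C avg m (el g))"
  proof -
    have "X = avg m (\<Sum>g\<in>Sn (Suc m). coef X g *\<^sub>C el g)"
      using alg_expand[OF X(1)] avg_cent[OF X(2)] by simp
    thus ?thesis by (simp add: avg_sum avg_scl)
  qed
  have "\<exists>\<kappa>. X * v = \<kappa> *\<^sub>C v"
    if ex: "\<And>g. g \<in> Sn (Suc m) \<Longrightarrow> \<exists>\<kappa>. avg m (el g) * v = \<kappa> *\<^sub>C v" for v
  proof -
    obtain \<kappa> where k: "\<And>g. g \<in> Sn (Suc m) \<Longrightarrow> avg m (el g) * v = \<kappa> g *\<^sub>C v"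
      using bchoice[of "Sn (Suc m)" "\<lambda>g \<kappa>. avg m (el g) * v = \<kappa> *\<^sub>C v"] ex by blast
    have "X * v = (\<Sum>g\<in>Sn (Suc m). coef X g *\<^sub>C (avg m (el g) * v))"
      by (subst exp) (simp add: sum_distrib_right)
    also have "\<dots> = (\<Sum>g\<in>Sn (Suc m). coef X g * \<kappa> g) *\<^sub>C v"
      by (simp add: k scl_sum_left)
    finally show ?thesis by blast
  qed
  thus ?A ?L ?Z using el by blast+
qed


subsection \<open>Traces\<close>

lemma coef_alg_eq_0: "v \<in> alg n \<Longrightarrow> g \<notin> Sn n \<Longrightarrow> coef v g = 0"
  by (auto simp: alg_iff)

lemma trace_JM:
  assumes v: "v \<in> alg m"
  shows "coef (JM (Suc m) * v) 0 = 0"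
proof -
  have "tp x (Suc m) \<notin> Sn m" if "x \<in> {1..m}" for x
    using that Sn_fix[of "tp x (Suc m)" m "Suc m"] by auto
  hence "coef v (tp x (Suc m)) = 0" if "x \<in> {1..m}" for x
    using that coef_alg_eq_0[OF v] by blast
  thus ?thesis
    unfolding JM_def atLeastLessThanSuc_atLeastAtMost
    by (simp add: sum_distrib_right lookup_sum coef_el_mult)
qed

text \<open>The product of \<open>(x, m + 1)\<close> and \<open>(y, m + 1)\<close> lies in S_m only
  for x = y, when it is the identity; there are m such pairs.\<close>

lemma trace_JM_JM:
  assumes v: "v \<in> alg m"
  shows "coef (JM (Suc m) * (JM (Suc m) * v)) 0 = of_nat m * coef v 0"
proof -
  have 0: "coef v (tp y (Suc m) + tp x (Suc m)) = (if x = y then coef v 0 else 0)"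
    if xy: "x \<in> {1..m}" "y \<in> {1..m}" for x y
  proof (cases "x = y")
    case False
    have "perm_fun (tp y (Suc m) + tp x (Suc m)) (Suc m) = x"
      using xy False by (auto simp: perm_fun_add transpose_def)
    hence "tp y (Suc m) + tp x (Suc m) \<notin> Sn m"
      using xy Sn_fix[of "tp y (Suc m) + tp x (Suc m)" m "Suc m"] by auto
    thus ?thesis using False coef_alg_eq_0[OF v] by simp
  qed simp
  have "coef (JM (Suc m) * (JM (Suc m) * v)) 0
      = (\<Sum>x\<in>{1..m}. \<Sum>y\<in>{1..m}. coef v (tp x (Suc m) + tp y (Suc m)))"
    by (simp add: JM_def sum_distrib_right sum_distrib_left lookup_sum coef_el_mult
        atLeastLessThanSuc_atLeastAtMost)
  also have "\<dots> = (\<Sum>x\<in>{1..m}. \<Sum>y\<in>{1..m}. if y = x then coef v 0 else 0)"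
    by (intro sum.cong refl) (simp add: 0)
  also have "\<dots> = of_nat m * coef v 0" by simp
  finally show ?thesis .
qed

lemma trace_proj:
  assumes "v \<in> alg m"
  shows "coef (proj_arm (JM (Suc m)) a b v) 0 = of_nat m / (a * (a + b)) * coef v 0"
    and "coef (proj_leg (JM (Suc m)) a b v) 0 = of_nat m / (b * (a + b)) * coef v 0"
  by (simp_all add: proj_defs lookup_add lookup_minus trace_JM[OF assms] trace_JM_JM[OF assms])


subsection \<open>Idempotents indexed by hook tableaux\<close>

text \<open>A standard tableau of hook shape is encoded by the set \<open>S\<close> of the entries in its leg.\<close>

abbreviation legs :: "nat set \<Rightarrow> nat \<Rightarrow> nat" where
  "legs S m \<equiv> card (S \<inter> {2..m})"

primrec hookE :: "nat \<Rightarrow> nat set \<Rightarrow> sga" where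
  "hookE 0 S = 0"
| "hookE (Suc m) S = (if m = 0 then 1 else
     (if Suc m \<in> S then proj_leg else proj_arm) (JM (Suc m)) (arm m (legs S m)) (leg (legs S m))
       (hookE m S))"

text \<open>The content of the box of j: if l smaller entries lie in the leg, then j is in row l + 1
  of the leg or in column j - 1 - l of the arm, counted from 0.\<close>

definition leg_content :: "nat set \<Rightarrow> nat \<Rightarrow> complex" where
  "leg_content S j = (if j = 1 then 0 else if j \<in> S then - leg (legs S (j - 1))
     else arm (j - 1) (legs S (j - 1)))"

lemma legs_less: "m \<ge> 1 \<Longrightarrow> legs S m < m"
proof -
  assume "m \<ge> 1"
  have "legs S m \<le> card {2..m}" by (rule card_mono) auto
  thus ?thesis using \<open>m \<ge> 1\<close> by simp
qed

lemma legs_Suc: "m \<ge> 1 \<Longrightarrow> legs S (Suc m) = (if Suc m \<in> S then Suc (legs S m) else legs S m)"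
proof -
  assume "m \<ge> 1"
  hence "{2..Suc m} = insert (Suc m) {2..m}" by auto
  thus ?thesis by auto
qed

lemma hookE_alg: "hookE m S \<in> alg m"
proof (induction m)
  case (Suc m)
  have "hookE m S \<in> alg (Suc m)" using Suc.IH alg_mono[of m "Suc m"] by simp
  thus ?case by (auto intro!: proj_alg JM_alg)
qed simp

lemma cubic_mult_right: "cubic J a b v \<Longrightarrow> cubic J a b (v * w)"
proof -
  assume "cubic J a b v"
  hence "(J * (J * (J * v))) * w = ((a - b) *\<^sub>C (J * (J * v)) + (a * b) *\<^sub>C (J * v)) * w"
    by (simp add: cubic_def)
  thus ?thesis by (simp add: cubic_def mult.assoc distrib_right)
qed

lemma hookE_JM_commute: "hookE m S * JM (Suc m) = JM (Suc m) * hookE m S"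
  by (rule cent_commute[OF JM_cent hookE_alg])

lemma proj_arm_eigen_self:
  "J * v = a *\<^sub>C v \<Longrightarrow> a \<noteq> 0 \<Longrightarrow> a + b \<noteq> 0 \<Longrightarrow> proj_arm J a b v = v"
  by (simp add: proj_eigen)

lemma proj_leg_eigen_self:
  "J * v = (- b) *\<^sub>C v \<Longrightarrow> b \<noteq> 0 \<Longrightarrow> a + b \<noteq> 0 \<Longrightarrow> proj_leg J a b v = v"
proof -
  assume h: "J * v = (- b) *\<^sub>C v" "b \<noteq> 0" "a + b \<noteq> 0"
  have "- b * (- b - a) = b * (a + b)" by (simp add: algebra_simps)
  hence "- b * (- b - a) / (b * (a + b)) = 1" using h(2,3) by simp
  thus ?thesis using h(1) by (simp add: proj_eigen del: minus_diff_eq)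
qed

lemma hookE_Suc: "m \<ge> 1 \<Longrightarrow> hookE (Suc m) S =
  (if Suc m \<in> S then proj_leg (JM (Suc m)) (arm m (legs S m)) (leg (legs S m)) (hookE m S)
   else proj_arm (JM (Suc m)) (arm m (legs S m)) (leg (legs S m)) (hookE m S))"
  by simp

lemma hookE_1: "hookE (Suc 0) S = 1"
  by simp

declare hookE.simps(2) [simp del]

lemma cubic_hookE_aux:
  assumes "m \<ge> 1" "hookF m (legs S m) * hookE m S = hookE m S"
  shows "cubic (JM (Suc m)) (arm m (legs S m)) (leg (legs S m)) (hookE m S)"
  using cubic_mult_right[OF hookF_cubic[OF legs_less[OF assms(1)]], of S "hookE m S"] assms by simp

text \<open>Puts each unit under the idempotent of its own hook, and so passes the cubic equation on
  from \<open>hookF\<close> to \<open>hookE\<close>, which the next step of the recursion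
  requires.\<close>

lemma hookF_hookE: "m \<ge> 1 \<Longrightarrow> hookF m (legs S m) * hookE m S = hookE m S"
proof (induction m rule: nat_induct_at_least)
  case base
  show ?case by (simp add: hookE_1 hookF_Suc hookF.simps(2))
next
  case (Suc m)
  let ?J = "JM (Suc m)" and ?k = "legs S m"
  let ?a = "arm m ?k" and ?b = "leg ?k"
  note k = legs_less[OF Suc.hyps, of S]
  note nz = arm_leg_nonzero(1)[OF k] arm_leg_nonzero(2)[of ?k] arm_leg_nonzero(3)[of m ?k]
  have cub: "cubic ?J ?a ?b (hookE m S)" by (rule cubic_hookE_aux[OF Suc])
  have FE: "hookF m j * hookE m S = (if j = ?k then hookE m S else 0)" for j
  proof (cases "j = ?k")
    case False
    have "hookF m j * hookE m S = hookF m j * hookF m ?k * hookE m S"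
      using Suc.IH by (simp add: mult.assoc)
    thus ?thesis using False by (simp add: hookF_orthogonal)
  qed (simp add: Suc.IH)
  show ?case
  proof (cases "Suc m \<in> S")
    case True
    let ?E = "hookE (Suc m) S"
    have E: "?E = proj_leg ?J ?a ?b (hookE m S)" using Suc.hyps True by (simp add: hookE_Suc)
    have JE: "?J * ?E = (- ?b) *\<^sub>C ?E" unfolding E by (rule JM_proj_leg[OF cub])
    have FE': "hookF m j * ?E = (if j = ?k then ?E else 0)" for j
      unfolding E by (simp add: FE flip: proj_mult_left[OF hookF_JM_commute])
    have "hookF (Suc m) (Suc ?k) * ?E = proj_leg ?J ?a ?b ?E"
      using Suc.hyps by (simp add: hookF_Suc distrib_right FE' flip: proj_mult_right)
    also have "\<dots> = ?E" by (rule proj_leg_eigen_self[OF JE nz(2,3)])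
    finally show ?thesis using True Suc.hyps by (simp add: legs_Suc)
  next
    case False
    let ?E = "hookE (Suc m) S"
    have E: "?E = proj_arm ?J ?a ?b (hookE m S)" using Suc.hyps False by (simp add: hookE_Suc)
    have JE: "?J * ?E = ?a *\<^sub>C ?E" unfolding E by (rule JM_proj_arm[OF cub])
    have FE': "hookF m j * ?E = (if j = ?k then ?E else 0)" for j
      unfolding E by (simp add: FE flip: proj_mult_left[OF hookF_JM_commute])
    \<comment> \<open>The leg branch starts from the hook with leg k - 1, whose idempotent is
      orthogonal to the one fixing E.\<close>
    have "(if ?k = 0 then 0 else proj_leg ?J (arm m (?k - 1)) (leg (?k - 1)) (hookF m (?k - 1) * ?E)) = 0"
    proof (cases "?k = 0")
      case k0: False
      hence "?k - 1 \<noteq> ?k" by linarith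
      hence "hookF m (?k - 1) * ?E = 0" using FE' by (simp only: if_False)
      thus ?thesis by (simp only: proj_0 if_cancel)
    qed (simp only: if_True refl)
    moreover have "hookF (Suc m) j * ?E = proj_arm ?J (arm m j) (leg j) (hookF m j * ?E)
        + (if j = 0 then 0 else proj_leg ?J (arm m (j - 1)) (leg (j - 1)) (hookF m (j - 1) * ?E))" for j
      using Suc.hyps by (simp add: hookF_Suc distrib_right proj_mult_right)
    ultimately have "hookF (Suc m) ?k * ?E = proj_arm ?J ?a ?b ?E"
      using FE'[of ?k] by (simp only: if_True refl add_0_right)
    also have "\<dots> = ?E" by (rule proj_arm_eigen_self[OF JE nz(1,3)])
    finally show ?thesis using False Suc.hyps by (simp add: legs_Suc)
  qed
qed

lemma hookE_cubic:
  "m \<ge> 1 \<Longrightarrow> cubic (JM (Suc m)) (arm m (legs S m)) (leg (legs S m)) (hookE m S)"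
  by (rule cubic_hookE_aux) (auto intro: hookF_hookE)

text \<open>The unit of the near-hook tableau that arises from S by putting m + 1 into the box
  \<open>(1, 1)\<close> of content 0, whenever this box can be added.\<close>

abbreviation hookE0 :: "nat \<Rightarrow> nat set \<Rightarrow> sga" where
  "hookE0 m S \<equiv> proj_zero (JM (Suc m)) (arm m (legs S m)) (leg (legs S m)) (hookE m S)"

lemma JM_hookE_top: "m \<ge> 1 \<Longrightarrow> JM (Suc m) * hookE (Suc m) S = leg_content S (Suc m) *\<^sub>C hookE (Suc m) S"
  using JM_proj_arm[OF hookE_cubic[of m S]] JM_proj_leg[OF hookE_cubic[of m S]]
  by (auto simp: hookE_Suc leg_content_def)

lemma JM_hookE0_top: "m \<ge> 1 \<Longrightarrow> JM (Suc m) * hookE0 m S = 0"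
  using JM_proj_zero[OF hookE_cubic arm_leg_nonzero(1)[OF legs_less] arm_leg_nonzero(2,3)] by blast

lemma JM_hookE: "j \<in> {1..m} \<Longrightarrow> JM j * hookE m S = leg_content S j *\<^sub>C hookE m S"
proof (induction m)
  case (Suc m)
  show ?case
  proof (cases "m = 0")
    case True
    thus ?thesis using Suc.prems by (simp add: leg_content_def)
  next
    case False
    hence m: "m \<ge> 1" by simp
    show ?thesis
    proof (cases "j = Suc m")
      case True
      thus ?thesis using JM_hookE_top[OF m] by simp
    next
      case j: False
      hence IH: "JM j * hookE m S = leg_content S j *\<^sub>C hookE m S" using Suc by simp
      have lin: "proj_arm J a b (c *\<^sub>C v) = c *\<^sub>C proj_arm J a b v"
        "proj_leg J a b (c *\<^sub>C v) = c *\<^sub>C proj_leg J a b v" for J a b c v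
        by (simp_all add: proj_defs scl_add_right scl_diff_right mult_ac)
      show ?thesis
        using m IH by (simp add: hookE_Suc lin flip: proj_mult_left[OF JM_commute])
    qed
  qed
qed simp

lemma JM_hookE0:
  assumes "m \<ge> 1" "j \<in> {1..m}"
  shows "JM j * hookE0 m S = leg_content S j *\<^sub>C hookE0 m S"
proof -
  have "proj_zero J a b (c *\<^sub>C v) = c *\<^sub>C proj_zero J a b v" for J a b c v
    by (simp add: proj_defs scl_add_right scl_diff_right mult_ac)
  thus ?thesis
    using assms by (simp add: JM_hookE flip: proj_mult_left[OF JM_commute])
qed

text \<open>\<open>hookE m S\<close> commutes with \<open>JM (Suc m)\<close>, so squaring the new
  unit applies the projection once more to an element that is already an eigenvector.\<close>

lemma hookE_idem: "m \<ge> 1 \<Longrightarrow> hookE m S * hookE m S = hookE m S"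
proof (induction m rule: nat_induct_at_least)
  case base
  show ?case by (simp add: hookE_1)
next
  case (Suc m)
  note c = hookE_JM_commute[of m S]
  let ?E = "hookE (Suc m) S" and ?J = "JM (Suc m)"
  note nz = arm_leg_nonzero(1)[OF legs_less[OF Suc.hyps, of S]] arm_leg_nonzero(2,3)
  show ?case
  proof (cases "Suc m \<in> S")
    case True
    have E: "?E = proj_leg ?J (arm m (legs S m)) (leg (legs S m)) (hookE m S)"
      using Suc.hyps True by (simp add: hookE_Suc)
    have "hookE m S * ?E = ?E" unfolding E by (simp add: Suc.IH flip: proj_mult_left[OF c])
    hence "?E * ?E = proj_leg ?J (arm m (legs S m)) (leg (legs S m)) ?E"
      by (subst E) (simp flip: proj_mult_right)
    also have "\<dots> = ?E"
      using JM_hookE_top[OF Suc.hyps, of S] True Suc.hyps nz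
      by (intro proj_leg_eigen_self) (auto simp: leg_content_def)
    finally show ?thesis .
  next
    case False
    have E: "?E = proj_arm ?J (arm m (legs S m)) (leg (legs S m)) (hookE m S)"
      using Suc.hyps False by (simp add: hookE_Suc)
    have "hookE m S * ?E = ?E" unfolding E by (simp add: Suc.IH flip: proj_mult_left[OF c])
    hence "?E * ?E = proj_arm ?J (arm m (legs S m)) (leg (legs S m)) ?E"
      by (subst E) (simp flip: proj_mult_right)
    also have "\<dots> = ?E"
      using JM_hookE_top[OF Suc.hyps, of S] False Suc.hyps nz
      by (intro proj_arm_eigen_self) (auto simp: leg_content_def)
    finally show ?thesis .
  qed
qed

lemma hookE0_idem: "m \<ge> 1 \<Longrightarrow> hookE0 m S * hookE0 m S = hookE0 m S"
proof -
  assume m: "m \<ge> 1"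
  have 1: "hookE m S * hookE0 m S = hookE0 m S"
    by (simp add: hookE_idem[OF m] flip: proj_mult_left[OF hookE_JM_commute])
  have "hookE0 m S * hookE0 m S
      = proj_zero (JM (Suc m)) (arm m (legs S m)) (leg (legs S m)) (hookE0 m S)"
    by (simp add: 1 flip: proj_mult_right)
  also have "\<dots> = hookE0 m S"
    unfolding proj_zero_def[of _ _ _ "hookE0 m S"]
    by (simp add: proj_eigen[of _ _ 0] JM_hookE0_top[OF m])
  finally show ?thesis .
qed

text \<open>The value is d / m! with d the number of tableaux of the hook. Each step multiplies by
  the factor of \<open>trace_proj\<close>, and the absorption identities for binomial coefficients
  turn d into the next dimension.\<close>

lemma trace_hookE: "m \<ge> 1 \<Longrightarrow> coef (hookE m S) 0 = of_nat ((m - 1) choose legs S m) / fact m"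
proof (induction m rule: nat_induct_at_least)
  case base
  show ?case by (simp add: hookE_1 lookup_one)
next
  case (Suc m)
  let ?k = "legs S m"
  have k: "?k < m" using legs_less Suc.hyps by blast
  have b1: "of_nat (m choose ?k) * (of_nat m - of_nat ?k) = (of_nat m * of_nat ((m - 1) choose ?k) :: complex)"
  proof -
    have "(m - ?k) * (m choose ?k) = m * ((m - 1) choose ?k)"
      using binomial_absorb_comp[of m ?k] by simp
    hence "of_nat ((m - ?k) * (m choose ?k)) = (of_nat (m * ((m - 1) choose ?k)) :: complex)"
      by (simp only:)
    thus ?thesis using k by (simp add: of_nat_diff mult.commute)
  qed
  have b2: "of_nat (m choose Suc ?k) * (of_nat ?k + 1) = (of_nat m * of_nat ((m - 1) choose ?k) :: complex)"
  proof -
    have "Suc ?k * (m choose Suc ?k) = m * ((m - 1) choose ?k)"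
      using binomial_absorption[of ?k m] by simp
    hence "of_nat (Suc ?k * (m choose Suc ?k)) = (of_nat (m * ((m - 1) choose ?k)) :: complex)"
      by (simp only:)
    thus ?thesis by (simp add: mult.commute algebra_simps)
  qed
  have nz: "of_nat m - of_nat ?k \<noteq> (0::complex)" "of_nat ?k + 1 \<noteq> (0::complex)"
    using arm_leg_nonzero(1)[OF k] arm_leg_nonzero(2)[of ?k] by (simp_all add: arm_def leg_def)
  show ?case
  proof (cases "Suc m \<in> S")
    case True
    have "coef (hookE (Suc m) S) 0 = of_nat m / (leg ?k * (arm m ?k + leg ?k)) * coef (hookE m S) 0"
      using True Suc.hyps by (simp add: hookE_Suc trace_proj[OF hookE_alg])
    also have "\<dots> = of_nat m * of_nat ((m - 1) choose ?k) / (of_nat ?k + 1) / ((of_nat m + 1) * fact m)"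
      unfolding arm_add_leg Suc.IH by (simp add: leg_def)
    also have "of_nat m * of_nat ((m - 1) choose ?k) / (of_nat ?k + 1) = (of_nat (m choose Suc ?k) :: complex)"
      using b2[symmetric] nz(2) by (simp add: nonzero_divide_eq_eq)
    finally show ?thesis using True Suc.hyps by (simp add: legs_Suc add.commute)
  next
    case False
    have "coef (hookE (Suc m) S) 0 = of_nat m / (arm m ?k * (arm m ?k + leg ?k)) * coef (hookE m S) 0"
      using False Suc.hyps by (simp add: hookE_Suc trace_proj[OF hookE_alg])
    also have "\<dots> = of_nat m * of_nat ((m - 1) choose ?k) / (of_nat m - of_nat ?k) / ((of_nat m + 1) * fact m)"
      unfolding arm_add_leg Suc.IH by (simp add: arm_def)
    also have "of_nat m * of_nat ((m - 1) choose ?k) / (of_nat m - of_nat ?k) = (of_nat (m choose ?k) :: complex)"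
      using b1[symmetric] nz(1) by (simp add: nonzero_divide_eq_eq)
    finally show ?thesis using False Suc.hyps by (simp add: legs_Suc add.commute)
  qed
qed

lemma hookE_cong: "S \<inter> {2..m} = S' \<inter> {2..m} \<Longrightarrow> hookE m S = hookE m S'"
proof (induction m)
  case (Suc m)
  have "{2..m} \<subseteq> {2..Suc m}" by auto
  hence e: "S \<inter> {2..m} = S' \<inter> {2..m}" using Suc.prems by blast
  show ?case
  proof (cases "m = 0")
    case False
    hence "Suc m \<in> {2..Suc m}" by simp
    hence "Suc m \<in> S \<longleftrightarrow> Suc m \<in> S'" using Suc.prems by blast
    thus ?thesis using False Suc.IH[OF e] e by (simp add: hookE_Suc)
  qed (simp add: hookE_1)
qed simp

definition leg_sets :: "nat \<Rightarrow> nat \<Rightarrow> nat set set" where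
  "leg_sets m k = {S. S \<subseteq> {2..m} \<and> card S = k}"

lemma finite_leg_sets [simp]: "finite (leg_sets m k)"
  by (simp add: leg_sets_def)

lemma card_leg_sets: "card (leg_sets m k) = (m - 1) choose k"
  using n_subsets[of "{2..m}" k] by (simp add: leg_sets_def)

lemma legs_leg_sets: "S \<in> leg_sets m k \<Longrightarrow> legs S m = k"
  by (simp add: leg_sets_def Int_absorb2)

text \<open>The arm branch of the recursion produces the leg sets without m + 1, the leg branch
  those with it.\<close>

lemma hookF_sum: "m \<ge> 1 \<Longrightarrow> hookF m k = (\<Sum>S\<in>leg_sets m k. hookE m S)"
proof (induction m arbitrary: k rule: nat_induct_at_least)
  case base
  have "leg_sets (Suc 0) k = (if k = 0 then {{}} else {})"
    by (auto simp: leg_sets_def)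
  thus ?case by (simp add: hookE_1 hookF.simps(2))
next
  case (Suc m)
  let ?J = "JM (Suc m)"
  let ?ins = "\<lambda>S. insert (Suc m) S"
  have notin: "Suc m \<notin> S" if "S \<in> leg_sets m j" for S j
    using that by (auto simp: leg_sets_def)
  have split: "leg_sets (Suc m) k = leg_sets m k \<union> (if k = 0 then {} else ?ins ` leg_sets m (k - 1))"
  proof (intro set_eqI iffI)
    fix S assume S: "S \<in> leg_sets (Suc m) k"
    hence fin: "finite S" by (auto simp: leg_sets_def intro: finite_subset)
    show "S \<in> leg_sets m k \<union> (if k = 0 then {} else ?ins ` leg_sets m (k - 1))"
    proof (cases "Suc m \<in> S")
      case True
      have "S - {Suc m} \<subseteq> {2..m}" using S by (auto simp: leg_sets_def)
      moreover have "card (S - {Suc m}) = k - 1" using S True by (simp add: leg_sets_def)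
      ultimately have 1: "S - {Suc m} \<in> leg_sets m (k - 1)" by (simp add: leg_sets_def)
      have 2: "S = ?ins (S - {Suc m})" using True by blast
      have "k \<noteq> 0" using S fin True card_0_eq[OF fin] by (auto simp only: leg_sets_def)
      moreover have "S \<in> ?ins ` leg_sets m (k - 1)" 
        by (rule image_eqI[where f = ?ins and x = "S - {Suc m}"]) (rule 2, rule 1)
      ultimately show ?thesis by simp
    next
      case False
      hence "S \<subseteq> {2..m}" using S by (auto simp: leg_sets_def le_Suc_eq subset_iff)
      thus ?thesis using S by (auto simp: leg_sets_def)
    qed
  next
    fix S assume S: "S \<in> leg_sets m k \<union> (if k = 0 then {} else ?ins ` leg_sets m (k - 1))"
    have "S \<in> leg_sets (Suc m) k" if "S \<in> leg_sets m k"
      using that by (auto simp: leg_sets_def)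
    moreover have "?ins S' \<in> leg_sets (Suc m) k" if "k \<noteq> 0" "S' \<in> leg_sets m (k - 1)" for S'
      using that Suc.hyps notin[OF that(2)] finite_subset[of S' "{2..m}"] by (auto simp: leg_sets_def)
    ultimately show "S \<in> leg_sets (Suc m) k" using S by (auto split: if_splits)
  qed
  have arms: "(\<Sum>S\<in>leg_sets m k. hookE (Suc m) S) = hookA m k"
  proof -
    have "(\<Sum>S\<in>leg_sets m k. hookE (Suc m) S)
        = (\<Sum>S\<in>leg_sets m k. proj_arm ?J (arm m k) (leg k) (hookE m S))"
      using Suc.hyps notin by (intro sum.cong refl) (simp add: hookE_Suc legs_leg_sets)
    thus ?thesis by (simp add: Suc.IH proj_sum)
  qed
  have lgs: "(\<Sum>S\<in>?ins ` leg_sets m j. hookE (Suc m) S) = hookL m j" for j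
  proof -
    have inj: "inj_on ?ins (leg_sets m j)"
      using notin by (intro inj_onI) (metis insert_ident)
    have "hookE m (?ins S) = hookE m S \<and> legs (?ins S) m = j" if "S \<in> leg_sets m j" for S
    proof -
      have "?ins S \<inter> {2..m} = S \<inter> {2..m}" by auto
      thus ?thesis using hookE_cong legs_leg_sets[OF that] by metis
    qed
    hence "(\<Sum>S\<in>?ins ` leg_sets m j. hookE (Suc m) S)
        = (\<Sum>S\<in>leg_sets m j. proj_leg ?J (arm m j) (leg j) (hookE m S))"
      using Suc.hyps by (subst sum.reindex[OF inj]) (intro sum.cong refl, simp add: hookE_Suc)
    thus ?thesis by (simp add: Suc.IH proj_sum)
  qed
  show ?case
  proof (cases "k = 0")
    case True
    thus ?thesis using Suc.hyps arms split by (simp add: hookF_Suc)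
  next
    case False
    have "leg_sets m k \<inter> ?ins ` leg_sets m (k - 1) = {}" using notin by auto
    hence "(\<Sum>S\<in>leg_sets (Suc m) k. hookE (Suc m) S) = hookA m k + hookL m (k - 1)"
      using False by (simp add: split sum.union_disjoint arms lgs)
    thus ?thesis using Suc.hyps False by (simp add: hookF_Suc)
  qed
qed

lemma hook_proj_sum:
  assumes m: "m \<ge> 1"
  shows "hookA m k = (\<Sum>S\<in>leg_sets m k. hookE (Suc m) S)"
    and "hookL m k = (\<Sum>S\<in>leg_sets m k. hookE (Suc m) (insert (Suc m) S))"
    and "hookZ m k = (\<Sum>S\<in>leg_sets m k. hookE0 m S)"
proof -
  have 1: "Suc m \<notin> S" "legs S m = k" if "S \<in> leg_sets m k" for S
    using that legs_leg_sets by (auto simp: leg_sets_def)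
  have 2: "hookE m (insert (Suc m) S) = hookE m S \<and> legs (insert (Suc m) S) m = k"
    if "S \<in> leg_sets m k" for S
  proof -
    have "insert (Suc m) S \<inter> {2..m} = S \<inter> {2..m}" by auto
    thus ?thesis using hookE_cong 1[OF that] by metis
  qed
  show "hookA m k = (\<Sum>S\<in>leg_sets m k. hookE (Suc m) S)"
    "hookL m k = (\<Sum>S\<in>leg_sets m k. hookE (Suc m) (insert (Suc m) S))"
    "hookZ m k = (\<Sum>S\<in>leg_sets m k. hookE0 m S)"
    unfolding hookF_sum[OF m] proj_sum using m 1 2 by (auto intro!: sum.cong simp: hookE_Suc)
qed

text \<open>What is left after subtracting the arm and leg parts. The value is 0 exactly for a leg
  of 0 or m - 1 entries, where the hook is a row or a column and the box \<open>(1, 1)\<close>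
  cannot be added.\<close>

lemma trace_hookE0:
  assumes "m \<ge> 1"
  shows "coef (hookE0 m S) 0 = of_nat ((m - 1) choose legs S m) / fact m *
    ((arm m (legs S m) - 1) * (leg (legs S m) - 1) / (arm m (legs S m) * leg (legs S m)))"
proof -
  let ?k = "legs S m"
  have k: "?k < m" using legs_less assms by blast
  define a b where ab: "a = arm m ?k" "b = leg ?k"
  have nz: "a \<noteq> 0" "b \<noteq> 0" "a + b \<noteq> 0"
    unfolding ab using arm_leg_nonzero(1)[OF k] arm_leg_nonzero(2,3) by auto
  have mab: "of_nat m = a + b - 1"
    using arm_add_leg[of m ?k] by (simp_all add: ab)
  have "1 - (a + b - 1) / (a * (a + b)) - (a + b - 1) / (b * (a + b)) = (a - 1) * (b - 1) / (a * b)"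
    using nz by (simp add: divide_simps) (simp add: algebra_simps)
  moreover have "coef (hookE0 m S) 0 = coef (hookE m S) 0 * (1 - (a + b - 1) / (a * (a + b)) - (a + b - 1) / (b * (a + b)))"
    unfolding proj_zero_def lookup_minus trace_proj[OF hookE_alg] ab[symmetric] mab
    by (simp add: algebra_simps)
  ultimately show ?thesis using trace_hookE[OF assms, of S] by (simp add: ab)
qed

lemma trace_hook_proj:
  assumes k: "k < m"
  shows "coef (hookA m k) 0 = of_nat ((m - 1) choose k) ^ 2 / fact m * (of_nat m / (arm m k * (of_nat m + 1)))"
    and "coef (hookL m k) 0 = of_nat ((m - 1) choose k) ^ 2 / fact m * (of_nat m / (leg k * (of_nat m + 1)))"
    and "coef (hookZ m k) 0 = of_nat ((m - 1) choose k) ^ 2 / fact m *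
      ((arm m k - 1) * (leg k - 1) / (arm m k * leg k))"
proof -
  have m: "m \<ge> 1" using k by simp
  have "coef (hookF m k) 0 = of_nat ((m - 1) choose k) ^ 2 / fact m"
    by (simp add: hookF_sum[OF m] lookup_sum trace_hookE[OF m] legs_leg_sets card_leg_sets power2_eq_square)
  thus "coef (hookA m k) 0 = of_nat ((m - 1) choose k) ^ 2 / fact m * (of_nat m / (arm m k * (of_nat m + 1)))"
    "coef (hookL m k) 0 = of_nat ((m - 1) choose k) ^ 2 / fact m * (of_nat m / (leg k * (of_nat m + 1)))"
    by (simp_all add: trace_proj[OF hookF_alg] arm_add_leg mult_ac)
  show "coef (hookZ m k) 0 = of_nat ((m - 1) choose k) ^ 2 / fact m *
      ((arm m k - 1) * (leg k - 1) / (arm m k * leg k))"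
  proof -
    have "coef (hookE0 m S) 0 = of_nat ((m - 1) choose k) / fact m *
        ((arm m k - 1) * (leg k - 1) / (arm m k * leg k))" if S: "S \<in> leg_sets m k" for S
      using trace_hookE0[OF m, of S] unfolding legs_leg_sets[OF S] .
    thus ?thesis unfolding hook_proj_sum(3)[OF m]
      by (simp add: lookup_sum card_leg_sets power2_eq_square)
  qed
qed

section \<open>Seminormal units\<close>

definition galg_of :: "sga \<Rightarrow> galg" where
  "galg_of X = (\<lambda>\<pi>. if permutation \<pi> then coef X (Abs_fperm \<pi>) else 0)"

lemma galg_of_perm_fun [simp]: "galg_of X (perm_fun g) = coef X g"
  by (simp add: galg_of_def perm_fun_inverse)

lemma galg_of_inject: "galg_of X = galg_of Y \<longleftrightarrow> X = Y"
  by (metis galg_of_perm_fun sga_eqI)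

lemma galg_of_add: "galg_of (X + Y) = (\<lambda>\<pi>. galg_of X \<pi> + galg_of Y \<pi>)"
  by (auto simp: galg_of_def lookup_add)

lemma galg_of_scl: "galg_of (c *\<^sub>C X) = (\<lambda>\<pi>. c * galg_of X \<pi>)"
  by (auto simp: galg_of_def)

lemma galg_of_zero: "galg_of 0 = (\<lambda>_. 0)"
  by (auto simp: galg_of_def)

lemma galg_of_sum: "galg_of (\<Sum>i\<in>I. X i) = (\<lambda>\<pi>. \<Sum>i\<in>I. galg_of (X i) \<pi>)"
  by (auto simp: galg_of_def lookup_sum)

lemma gdelta_conv: "permutation \<pi> \<Longrightarrow> gdelta \<pi> = galg_of (el (Abs_fperm \<pi>))"
  by (rule ext) (auto simp: gdelta_def galg_of_def coef_el Abs_fperm_inject)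

lemma jucys_murphy_conv: "jucys_murphy k = galg_of (JM k)"
  unfolding jucys_murphy_def JM_def galg_of_sum tp_def
  by (auto simp: gdelta_conv permutation_swap_id)

lemma coef_mult_alg:
  assumes "X \<in> alg n"
  shows "coef (X * Y) g = (\<Sum>h\<in>Sn n. coef X h * coef Y (- h + g))"
  by (subst alg_expand[OF assms]) (simp add: sum_distrib_right lookup_sum coef_el_mult)

lemma gmult_galg_of:
  assumes X: "X \<in> alg n" and Y: "Y \<in> alg n"
  shows "gmult n (galg_of X) (galg_of Y) = galg_of (X * Y)"
proof
  fix \<pi>
  let ?D = "{(\<alpha>, \<beta>). \<alpha> permutes {1..n} \<and> \<beta> permutes {1..n} \<and> \<alpha> \<circ> \<beta> = \<pi>}"
  show "gmult n (galg_of X) (galg_of Y) \<pi> = galg_of (X * Y) \<pi>"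
  proof (cases "\<pi> permutes {1..n}")
    case True
    define g where "g = Abs_fperm \<pi>"
    have g: "perm_fun g = \<pi>" "g \<in> Sn n"
      using True by (auto simp: g_def Sn_iff permutes_imp_permutation)
    have "(\<Sum>(\<alpha>, \<beta>)\<in>?D. galg_of X \<alpha> * galg_of Y \<beta>) = (\<Sum>h\<in>Sn n. coef X h * coef Y (- h + g))"
    proof (rule sum.reindex_bij_witness[where j="\<lambda>(\<alpha>, \<beta>). Abs_fperm \<alpha>"
            and i="\<lambda>h. (perm_fun h, perm_fun (- h + g))"])
      fix ab assume "ab \<in> ?D"
      then obtain \<alpha> \<beta> where ab: "ab = (\<alpha>, \<beta>)" "\<alpha> permutes {1..n}" "\<beta> permutes {1..n}" "\<alpha> \<circ> \<beta> = \<pi>"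
        by auto
      define h k where hk: "h = Abs_fperm \<alpha>" "k = Abs_fperm \<beta>"
      have pf: "perm_fun h = \<alpha>" "perm_fun k = \<beta>" using ab by (auto simp: hk permutes_imp_permutation)
      have "h + k = g" using ab by (intro fperm_eqI) (simp add: perm_fun_add pf g)
      hence k: "- h + g = k" by (metis minus_add_cancel)
      show "(perm_fun (case ab of (\<alpha>, \<beta>) \<Rightarrow> Abs_fperm \<alpha>),
             perm_fun (- (case ab of (\<alpha>, \<beta>) \<Rightarrow> Abs_fperm \<alpha>) + g)) = ab"
        using ab k pf by (simp add: hk[symmetric])
      show "(case ab of (\<alpha>, \<beta>) \<Rightarrow> Abs_fperm \<alpha>) \<in> Sn n"
        using ab by (simp add: Sn_iff permutes_imp_permutation)
      show "coef X (case ab of (\<alpha>, \<beta>) \<Rightarrow> Abs_fperm \<alpha>) *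
          coef Y (- (case ab of (\<alpha>, \<beta>) \<Rightarrow> Abs_fperm \<alpha>) + g) =
        (case ab of (\<alpha>, \<beta>) \<Rightarrow> galg_of X \<alpha> * galg_of Y \<beta>)"
        using ab k by (simp add: perm_fun_inverse flip: pf)
    next
      fix h assume h: "h \<in> Sn n"
      show "(case (perm_fun h, perm_fun (- h + g)) of (\<alpha>, \<beta>) \<Rightarrow> Abs_fperm \<alpha>) = h"
        by (simp add: perm_fun_inverse)
      have "- h + g \<in> Sn n" using h g by (intro Sn_add) auto
      moreover have "perm_fun h \<circ> perm_fun (- h + g) = \<pi>"
        using g(1) by (simp flip: perm_fun_add add: add.assoc[symmetric])
      ultimately show "(perm_fun h, perm_fun (- h + g)) \<in> ?D"
        using h by (simp add: Sn_iff)
    qed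
    thus ?thesis unfolding gmult_def
      using galg_of_perm_fun[of "X * Y" g] by (simp add: coef_mult_alg[OF X] g)
  next
    case False
    hence "?D = {}" by (auto intro: permutes_compose)
    hence "gmult n (galg_of X) (galg_of Y) \<pi> = 0" by (simp only: gmult_def sum.empty)
    moreover have "galg_of (X * Y) \<pi> = 0"
      using False alg_mult[OF X Y] by (auto simp: galg_of_def alg_iff Sn_iff)
    ultimately show ?thesis by simp
  qed
qed

text \<open>A property that survives all formation rules of \<open>jm_algebra\<close>. The second
  clause yields commutativity of the algebra when applied twice; in the third, the scalar depends on
  the eigenvalues c alone and not on v, and on this the uniqueness of seminormal units
  rests.\<close>

definition jm_like :: "nat \<Rightarrow> sga \<Rightarrow> bool" where
  "jm_like n X \<longleftrightarrow> X \<in> alg n \<and>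
    (\<forall>Z. (\<forall>k\<in>{1..n}. Z * JM k = JM k * Z) \<longrightarrow> X * Z = Z * X) \<and>
    (\<forall>c. \<exists>\<chi>. \<forall>v. (\<forall>k\<in>{1..n}. JM k * v = c k *\<^sub>C v) \<longrightarrow> X * v = \<chi> *\<^sub>C v)"

lemma jm_likeI:
  assumes "X \<in> alg n"
    and "\<And>Z. (\<And>k. k \<in> {1..n} \<Longrightarrow> Z * JM k = JM k * Z) \<Longrightarrow> X * Z = Z * X"
    and "\<And>c. \<exists>\<chi>. \<forall>v. (\<forall>k\<in>{1..n}. JM k * v = c k *\<^sub>C v) \<longrightarrow> X * v = \<chi> *\<^sub>C v"
  shows "jm_like n X"
  using assms unfolding jm_like_def by blast

lemma jm_likeD:
  assumes "jm_like n X"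
  shows "X \<in> alg n"
    and "(\<And>k. k \<in> {1..n} \<Longrightarrow> Z * JM k = JM k * Z) \<Longrightarrow> X * Z = Z * X"
    and "\<exists>\<chi>. \<forall>v. (\<forall>k\<in>{1..n}. JM k * v = c k *\<^sub>C v) \<longrightarrow> X * v = \<chi> *\<^sub>C v"
  using assms unfolding jm_like_def by blast+

lemma jm_like_one: "jm_like n 1"
  by (rule jm_likeI) (auto intro: exI[of _ 1])

lemma jm_like_JM: "k \<in> {1..n} \<Longrightarrow> jm_like n (JM k)"
  by (rule jm_likeI) (auto simp: JM_alg)

lemma jm_like_scl:
  assumes "jm_like n X"
  shows "jm_like n (c *\<^sub>C X)"
proof (rule jm_likeI)
  show "c *\<^sub>C X \<in> alg n" by (intro alg_scl jm_likeD(1)[OF assms])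
  show "c *\<^sub>C X * Z = Z * (c *\<^sub>C X)" if "\<And>k. k \<in> {1..n} \<Longrightarrow> Z * JM k = JM k * Z" for Z
    using jm_likeD(2)[OF assms that] by simp
  show "\<exists>\<chi>. \<forall>v. (\<forall>k\<in>{1..n}. JM k * v = d k *\<^sub>C v) \<longrightarrow> c *\<^sub>C X * v = \<chi> *\<^sub>C v" for d
    using jm_likeD(3)[OF assms, of d] by (metis scl_mult scl_scl)
qed

lemma jm_like_add:
  assumes X: "jm_like n X" and Y: "jm_like n Y"
  shows "jm_like n (X + Y)"
proof (rule jm_likeI)
  show "X + Y \<in> alg n" by (intro alg_add jm_likeD(1)[OF X] jm_likeD(1)[OF Y])
  show "(X + Y) * Z = Z * (X + Y)" if "\<And>k. k \<in> {1..n} \<Longrightarrow> Z * JM k = JM k * Z" for Z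
    using jm_likeD(2)[OF X that] jm_likeD(2)[OF Y that] by (simp add: distrib_left distrib_right)
  show "\<exists>\<chi>. \<forall>v. (\<forall>k\<in>{1..n}. JM k * v = d k *\<^sub>C v) \<longrightarrow> (X + Y) * v = \<chi> *\<^sub>C v" for d
    using jm_likeD(3)[OF X, of d] jm_likeD(3)[OF Y, of d] by (metis distrib_right scl_add_left)
qed

lemma jm_like_mult:
  assumes X: "jm_like n X" and Y: "jm_like n Y"
  shows "jm_like n (X * Y)"
proof (rule jm_likeI)
  show "X * Y \<in> alg n" by (intro alg_mult jm_likeD(1)[OF X] jm_likeD(1)[OF Y])
  show "X * Y * Z = Z * (X * Y)" if "\<And>k. k \<in> {1..n} \<Longrightarrow> Z * JM k = JM k * Z" for Z
    using jm_likeD(2)[OF X that] jm_likeD(2)[OF Y that] commute_mult[of Z X Y] by simp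
  show "\<exists>\<chi>. \<forall>v. (\<forall>k\<in>{1..n}. JM k * v = d k *\<^sub>C v) \<longrightarrow> X * Y * v = \<chi> *\<^sub>C v" for d
    using jm_likeD(3)[OF X, of d] jm_likeD(3)[OF Y, of d] by (metis mult.assoc mult_scl scl_scl)
qed

lemma galg_of_one: "galg_of 1 = gdelta id"
  using gdelta_conv[of id] by (simp flip: zero_fperm_def)

lemma jm_algebraE:
  assumes "Y \<in> jm_algebra n"
  obtains X where "jm_like n X" "Y = galg_of X"
proof -
  from assms have "\<exists>X. jm_like n X \<and> Y = galg_of X"
  proof induction
    case unit
    show ?case using jm_like_one galg_of_one by metis
  next
    case (gen k)
    thus ?case using jm_like_JM jucys_murphy_conv by blast
  next
    case (scale X c)
    thus ?case using jm_like_scl galg_of_scl by metis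
  next
    case (plus X Y)
    thus ?case using jm_like_add galg_of_add by metis
  next
    case (mult X Y)
    then obtain X' Y' where "jm_like n X'" "X = galg_of X'" "jm_like n Y'" "Y = galg_of Y'" by blast
    thus ?case using jm_like_mult gmult_galg_of jm_likeD(1) by metis
  qed
  thus ?thesis using that by blast
qed

lemma jm_algebra_like: "galg_of X \<in> jm_algebra n \<Longrightarrow> jm_like n X"
  by (metis jm_algebraE galg_of_inject)

lemmas jm_algebra_galg_of = jm_likeD[OF jm_algebra_like]

lemma jm_algebra_commute:
  assumes "galg_of X \<in> jm_algebra n" "galg_of Y \<in> jm_algebra n"
  shows "X * Y = Y * X"
proof (rule jm_algebra_galg_of(2)[OF assms(1)])
  show "Y * JM k = JM k * Y" for k
    by (rule jm_algebra_galg_of(2)[OF assms(2)]) (rule JM_commute)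
qed

text \<open>Resolves the definite description. Both primitivity and uniqueness follow from the fact
  that the algebra acts by a scalar on each joint eigenspace of the Jucys-Murphy elements.\<close>

lemma seminormal_unit_eq:
  assumes E: "galg_of E \<in> jm_algebra n" "E * E = E" "E \<noteq> 0"
    and JE: "\<And>k. k \<in> {1..n} \<Longrightarrow> JM k * E = of_int (box_content lam T k) *\<^sub>C E"
  shows "seminormal_unit n lam T = galg_of E"
  unfolding seminormal_unit_def
proof (rule the_equality)
  let ?c = "\<lambda>k. complex_of_int (box_content lam T k)"
  note Ea = jm_algebra_galg_of(1)[OF E(1)]
  have scalar: "\<exists>\<chi>. X * E = \<chi> *\<^sub>C E" if "galg_of X \<in> jm_algebra n" for X
    using jm_algebra_galg_of(3)[OF that, of ?c] JE by blast
  show "primitive_idempotent n (jm_algebra n) (galg_of E) \<and>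
    (\<forall>k\<in>{1..n}. gmult n (jucys_murphy k) (galg_of E)
      = (\<lambda>\<pi>. of_int (box_content lam T k) * galg_of E \<pi>))"
  proof
    show "primitive_idempotent n (jm_algebra n) (galg_of E)"
      unfolding primitive_idempotent_def
    proof (intro conjI ballI impI)
      show "galg_of E \<in> jm_algebra n" by fact
      show "galg_of E \<noteq> (\<lambda>_. 0)" using E(3) galg_of_inject[of E 0] by (simp add: galg_of_zero)
      show "gmult n (galg_of E) (galg_of E) = galg_of E"
        using E(2) by (simp add: gmult_galg_of[OF Ea Ea])
    next
      fix f g assume fg: "f \<in> jm_algebra n" "g \<in> jm_algebra n"
        and h: "gmult n f f = f \<and> gmult n g g = g \<and> gmult n f g = (\<lambda>_. 0) \<and>
          gmult n g f = (\<lambda>_. 0) \<and> galg_of E = (\<lambda>\<pi>. f \<pi> + g \<pi>)"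
      obtain X where X: "X \<in> alg n" "f = galg_of X" using fg(1) jm_algebraE jm_likeD(1) by metis
      obtain Y where Y: "Y \<in> alg n" "g = galg_of Y" using fg(2) jm_algebraE jm_likeD(1) by metis
      have h': "X * X = X" "Y * Y = Y" "X * Y = 0" "Y * X = 0" "E = X + Y"
      proof -
        note g = gmult_galg_of[OF X(1) X(1)] gmult_galg_of[OF X(1) Y(1)]
          gmult_galg_of[OF Y(1) X(1)] gmult_galg_of[OF Y(1) Y(1)]
        have "galg_of (X * X) = galg_of X" "galg_of (Y * Y) = galg_of Y"
          "galg_of (X * Y) = galg_of 0" "galg_of (Y * X) = galg_of 0"
          using h by (simp_all only: X(2) Y(2) g galg_of_zero)
        thus "X * X = X" "Y * Y = Y" "X * Y = 0" "Y * X = 0" by (simp_all only: galg_of_inject)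
        have "galg_of E = galg_of (X + Y)"
          using h by (simp only: X(2) Y(2) galg_of_add)
        thus "E = X + Y" by (simp only: galg_of_inject)
      qed
      obtain x y where xy: "X * E = x *\<^sub>C E" "Y * E = y *\<^sub>C E"
        using scalar fg X(2) Y(2) by blast
      \<comment> \<open>The summands act on E by scalars, so they are multiples of E; since their
        product is 0, one of the scalars is 0.\<close>
      have "X * E = X" "Y * E = Y" using h' by (simp_all add: distrib_left)
      hence XY: "X = x *\<^sub>C E" "Y = y *\<^sub>C E" using xy by simp_all
      have "X * Y = (y * x) *\<^sub>C E" unfolding XY by (simp add: E(2))
      hence "y * x = 0" using h'(3) E(3) scl_eq_0_iff by metis
      hence "X = 0 \<or> Y = 0" using XY by (auto simp: scl_eq_0_iff)
      thus "f = (\<lambda>_. 0) \<or> g = (\<lambda>_. 0)" using X(2) Y(2) galg_of_zero by auto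
    qed
    show "\<forall>k\<in>{1..n}. gmult n (jucys_murphy k) (galg_of E)
      = (\<lambda>\<pi>. of_int (box_content lam T k) * galg_of E \<pi>)"
      using JE by (auto simp: jucys_murphy_conv gmult_galg_of JM_alg Ea galg_of_scl)
  qed
  fix e assume e: "primitive_idempotent n (jm_algebra n) e \<and>
    (\<forall>k\<in>{1..n}. gmult n (jucys_murphy k) e = (\<lambda>\<pi>. of_int (box_content lam T k) * e \<pi>))"
  hence ejm: "e \<in> jm_algebra n" by (simp add: primitive_idempotent_def)
  then obtain X where X: "X \<in> alg n" "e = galg_of X" using jm_algebraE jm_likeD(1) by metis
  have XX: "X * X = X" and X0: "X \<noteq> 0"
    using e gmult_galg_of[OF X(1) X(1)] galg_of_inject
    unfolding primitive_idempotent_def X(2) by (auto simp: galg_of_zero)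
  have JX: "JM k * X = ?c k *\<^sub>C X" if "k \<in> {1..n}" for k
    using e that gmult_galg_of[OF JM_alg X(1), of k]
    unfolding jucys_murphy_conv X(2) galg_of_scl[symmetric] by (auto simp: galg_of_inject)
  \<comment> \<open>The same scalar serves X and E; idempotency of X makes it 1, so X E = E, and
    symmetrically E X = X.\<close>
  obtain \<chi> where "X * X = \<chi> *\<^sub>C X" "X * E = \<chi> *\<^sub>C E"
    using jm_algebra_galg_of(3)[of X n ?c] ejm X(2) JX JE by blast
  hence 1: "X * E = E" using XX X0 scl_cancel_right[OF X0, of \<chi> 1] by simp
  obtain \<xi> where "E * E = \<xi> *\<^sub>C E" "E * X = \<xi> *\<^sub>C X"
    using jm_algebra_galg_of(3)[OF E(1), of ?c] JX JE by blast
  hence 2: "E * X = X" using E(2,3) scl_cancel_right[OF E(3), of \<xi> 1] by simp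
  have "X * E = E * X" using jm_algebra_commute[OF _ E(1)] ejm X(2) by blast
  thus "e = galg_of E" using 1 2 X(2) by simp
qed

section \<open>Seminormal units of hooks and near-hooks\<close>

lemma jm_algebra_diff:
  assumes "galg_of X \<in> jm_algebra n" "galg_of Y \<in> jm_algebra n"
  shows "galg_of (X - Y) \<in> jm_algebra n"
proof -
  have "galg_of (X + (- 1) *\<^sub>C Y) \<in> jm_algebra n"
    unfolding galg_of_add galg_of_scl by (intro jm_algebra.plus jm_algebra.scale assms)
  moreover have "X + (- 1) *\<^sub>C Y = X - Y" by (simp add: scl_minus_left)
  ultimately show ?thesis by simp
qed

lemma jm_algebra_JM_mult:
  assumes "k \<in> {1..n}" "galg_of Y \<in> jm_algebra n"
  shows "galg_of (JM k * Y) \<in> jm_algebra n"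
  using jm_algebra.mult[OF jm_algebra.gen[OF assms(1)] assms(2)] assms
    gmult_galg_of[OF JM_alg jm_algebra_galg_of(1)[OF assms(2)], of k]
  by (simp add: jucys_murphy_conv)

lemma jm_algebra_add:
  assumes "galg_of X \<in> jm_algebra n" "galg_of Y \<in> jm_algebra n"
  shows "galg_of (X + Y) \<in> jm_algebra n"
  unfolding galg_of_add by (intro jm_algebra.plus assms)

lemma jm_algebra_scl:
  "galg_of X \<in> jm_algebra n \<Longrightarrow> galg_of (c *\<^sub>C X) \<in> jm_algebra n"
  unfolding galg_of_scl by (rule jm_algebra.scale)

lemma jm_algebra_proj:
  assumes "k \<in> {1..n}" "galg_of v \<in> jm_algebra n"
  shows "galg_of (proj_arm (JM k) a b v) \<in> jm_algebra n"
    and "galg_of (proj_leg (JM k) a b v) \<in> jm_algebra n"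
    and "galg_of (proj_zero (JM k) a b v) \<in> jm_algebra n"
  using assms unfolding proj_defs
  by (auto intro!: jm_algebra_diff jm_algebra_add jm_algebra_scl jm_algebra_JM_mult)

lemma jm_algebra_one: "galg_of 1 \<in> jm_algebra n"
  using jm_algebra.unit[of n] by (simp add: galg_of_one)

lemma jm_algebra_hookE: "m \<ge> 1 \<Longrightarrow> m \<le> n \<Longrightarrow> galg_of (hookE m S) \<in> jm_algebra n"
proof (induction m rule: nat_induct_at_least)
  case base
  thus ?case by (simp add: hookE_1 jm_algebra_one)
next
  case (Suc m)
  thus ?case by (simp add: hookE_Suc jm_algebra_proj)
qed

lemma seminormal_unit_hook:
  assumes n: "n \<ge> 1"
    and c: "\<And>k. k \<in> {1..n} \<Longrightarrow> of_int (box_content lam T k) = leg_content S k"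
  shows "seminormal_unit n lam T = galg_of (hookE n S)"
proof (rule seminormal_unit_eq)
  show "galg_of (hookE n S) \<in> jm_algebra n" using n by (intro jm_algebra_hookE) auto
  show "hookE n S * hookE n S = hookE n S" by (rule hookE_idem[OF n])
  have "legs S n \<le> n - 1" using legs_less[OF n, of S] by linarith
  hence "coef (hookE n S) 0 \<noteq> 0" by (simp add: trace_hookE[OF n])
  thus "hookE n S \<noteq> 0" by auto
  show "JM k * hookE n S = of_int (box_content lam T k) *\<^sub>C hookE n S" if "k \<in> {1..n}" for k
    using JM_hookE[OF that] c[OF that] by simp
qed

lemma seminormal_unit_near_hook:
  assumes m: "m \<ge> 1" and S: "1 \<le> legs S m" "legs S m \<le> m - 2"
    and c: "\<And>k. k \<in> {1..m} \<Longrightarrow> of_int (box_content lam T k) = leg_content S k"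
    and c0: "box_content lam T (Suc m) = 0"
  shows "seminormal_unit (Suc m) lam T = galg_of (hookE0 m S)"
proof (rule seminormal_unit_eq)
  show "galg_of (hookE0 m S) \<in> jm_algebra (Suc m)"
    using m by (intro jm_algebra_hookE jm_algebra_proj) auto
  show "hookE0 m S * hookE0 m S = hookE0 m S" by (rule hookE0_idem[OF m])
  have k: "legs S m < m" by (rule legs_less[OF m])
  have e: "arm m (legs S m) - 1 = of_nat (m - 1 - legs S m)"
    using k S by (simp add: arm_def of_nat_diff)
  \<comment> \<open>The two bounds keep the identity coefficient of \<open>hookE0 m S\<close> away
    from 0; they say that the box \<open>(1, 1)\<close> can be added.\<close>
  have "m - 1 - legs S m \<noteq> 0" using S k by linarith
  hence "arm m (legs S m) - 1 \<noteq> 0" unfolding e of_nat_eq_0_iff .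
  moreover have "leg (legs S m) - 1 \<noteq> 0"
    unfolding leg_def add_diff_cancel_right' of_nat_eq_0_iff using S(1) by linarith
  moreover have "(m - 1) choose legs S m \<noteq> 0" using k by simp
  ultimately have "coef (hookE0 m S) 0 \<noteq> 0"
    unfolding trace_hookE0[OF m]
    using arm_leg_nonzero(1)[OF k] arm_leg_nonzero(2)[of "legs S m"] by simp
  thus "hookE0 m S \<noteq> 0" by auto
  show "JM k * hookE0 m S = of_int (box_content lam T k) *\<^sub>C hookE0 m S" if "k \<in> {1..Suc m}" for k
  proof (cases "k = Suc m")
    case True
    thus ?thesis using JM_hookE0_top[OF m] c0 by simp
  next
    case False
    hence "k \<in> {1..m}" using that by auto
    thus ?thesis using JM_hookE0[OF m] c by simp
  qed
qed

section \<open>Near-conjugacy classes\<close>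

lemma ex_bij_betw_of_image_mset_eq:
  assumes "finite A" "finite B" "image_mset c (mset_set A) = image_mset d (mset_set B)"
  shows "\<exists>f. bij_betw f A B \<and> (\<forall>x\<in>A. d (f x) = c x)"
  using assms
proof (induction A arbitrary: B rule: finite_induct)
  case empty
  hence "B = {}" by (metis image_mset_is_empty_iff mset_set.empty mset_set_empty_iff)
  thus ?case by (auto simp: bij_betw_def)
next
  case (insert x A)
  have "c x \<in># image_mset d (mset_set B)"
    using insert by (metis image_mset_add_mset mset_set.insert union_single_eq_member)
  then obtain y where y: "y \<in> B" "d y = c x" using insert.prems by auto
  have "add_mset (c x) (image_mset c (mset_set A)) = add_mset (d y) (image_mset d (mset_set (B - {y})))"
    using insert y by (simp add: mset_set.remove[of B y])
  hence "image_mset c (mset_set A) = image_mset d (mset_set (B - {y}))" using y by simp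
  then obtain f where f: "bij_betw f A (B - {y})" "\<forall>x\<in>A. d (f x) = c x"
    using insert.IH[of "B - {y}"] insert.prems by auto
  have "bij_betw (f(x := y)) (insert x A) (insert y (B - {y}))"
  proof (rule bij_betw_combine[of _ A _ "{x}" "{y}", simplified])
    show "bij_betw (f(x := y)) A (B - {y})"
      using f(1) insert.hyps by (subst bij_betw_cong[of _ _ f]) auto
  qed (auto simp: bij_betw_def)
  moreover have "insert y (B - {y}) = B" using y by auto
  ultimately have "bij_betw (f(x := y)) (insert x A) B" by (simp only:)
  moreover have "\<forall>z\<in>insert x A. d ((f(x := y)) z) = c z" using f(2) y insert.hyps by auto
  ultimately show ?case by blast
qed

text \<open>Applied to the sets of cycles, weighted by length; the marked elements are the two
  cycles through n, which have to correspond.\<close>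

lemma ex_bij_betw_marked:
  assumes fin: "finite A" "finite B" and eq: "image_mset c (mset_set A) = image_mset d (mset_set B)"
    and a: "a \<in> A" and b: "b \<in> B" and ab: "c a = d b"
  shows "\<exists>f. bij_betw f A B \<and> f a = b \<and> (\<forall>x\<in>A. d (f x) = c x)"
proof -
  have "add_mset (c a) (image_mset c (mset_set (A - {a})))
      = add_mset (d b) (image_mset d (mset_set (B - {b})))"
    using eq mset_set.remove[OF fin(1) a] mset_set.remove[OF fin(2) b] by simp
  hence "image_mset c (mset_set (A - {a})) = image_mset d (mset_set (B - {b}))" using ab by simp
  then obtain f where f: "bij_betw f (A - {a}) (B - {b})" "\<forall>x\<in>A - {a}. d (f x) = c x"
    using ex_bij_betw_of_image_mset_eq[of "A - {a}" "B - {b}" c d] fin by auto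
  have "bij_betw (f(a := b)) ((A - {a}) \<union> {a}) ((B - {b}) \<union> {b})"
  proof (rule bij_betw_combine)
    show "bij_betw (f(a := b)) (A - {a}) (B - {b})"
      using f(1) by (subst bij_betw_cong[of _ _ f]) auto
  qed (auto simp: bij_betw_def)
  hence "bij_betw (f(a := b)) A B" using a b by (simp add: insert_absorb)
  moreover have "\<forall>z\<in>A. d ((f(a := b)) z) = c z" using f(2) ab by auto
  ultimately show ?thesis by (intro exI[of _ "f(a := b)"] conjI) (simp_all only: fun_upd_same)
qed

text \<open>The i-th iterates from b and from c are matched; equal orbit sizes make both sequences
  return after the same number N of steps.\<close>

lemma orbit_conjugation:
  fixes f g :: "'a \<Rightarrow> 'a"
  assumes f: "permutation f" and g: "permutation g"
    and card: "card (orbit f b) = card (orbit g c)"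
  shows "\<exists>t. bij_betw t (orbit f b) (orbit g c) \<and> t b = c \<and> (\<forall>x\<in>orbit f b. t (f x) = g (t x))"
proof -
  define N where "N = funpow_dist1 f b b"
  note bo = permutation_self_in_orbit[OF f, of b] and co = permutation_self_in_orbit[OF g, of c]
  have fo: "orbit f b = (\<lambda>i. (f ^^ i) b) ` {0..<N}" and fi: "inj_on (\<lambda>i. (f ^^ i) b) {0..<N}"
    using orbit_conv_funpow_dist1[OF bo] inj_on_funpow_dist1[OF bo] by (auto simp: N_def)
  have go': "orbit g c = (\<lambda>i. (g ^^ i) c) ` {0..<funpow_dist1 g c c}"
    and gi': "inj_on (\<lambda>i. (g ^^ i) c) {0..<funpow_dist1 g c c}"
    using orbit_conv_funpow_dist1[OF co] inj_on_funpow_dist1[OF co] by auto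
  have "funpow_dist1 g c c = N"
    using card card_image[OF fi] card_image[OF gi'] fo go' by simp
  hence go: "orbit g c = (\<lambda>i. (g ^^ i) c) ` {0..<N}" and gi: "inj_on (\<lambda>i. (g ^^ i) c) {0..<N}"
    and gN: "(g ^^ N) c = c"
    using go' gi' funpow_dist1_prop[OF co] by (auto simp del: funpow.simps)
  have fN: "(f ^^ N) b = b" using funpow_dist1_prop[OF bo] by (simp add: N_def)
  have N0: "N > 0" by (simp add: N_def)
  define t where "t = (\<lambda>x. (g ^^ (inv_into {0..<N} (\<lambda>i. (f ^^ i) b) x)) c)"
  have t: "t ((f ^^ i) b) = (g ^^ i) c" if "i < N" for i
    unfolding t_def using inv_into_f_f[OF fi, of i] that by simp
  have "bij_betw t (orbit f b) (orbit g c)"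
    unfolding bij_betw_def
  proof
    show "inj_on t (orbit f b)"
    proof (rule inj_onI)
      fix x y assume xy: "x \<in> orbit f b" "y \<in> orbit f b" "t x = t y"
      obtain i j where ij: "i < N" "j < N" "x = (f ^^ i) b" "y = (f ^^ j) b"
        using xy fo by auto
      hence "i = j" using xy(3) inj_onD[OF gi, of i j] by (simp add: t)
      thus "x = y" using ij by simp
    qed
    show "t ` orbit f b = orbit g c"
      unfolding fo go by (auto simp: t image_image intro!: image_cong)
  qed
  moreover have "t b = c" using t[of 0] N0 by simp
  moreover have "t (f x) = g (t x)" if x: "x \<in> orbit f b" for x
  proof -
    obtain i where i: "i < N" "x = (f ^^ i) b" using x fo by auto
    show ?thesis
    proof (cases "Suc i < N")
      case True
      thus ?thesis using t[of "Suc i"] t[of i] i by simp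
    next
      case False
      hence "N = Suc i" using i by simp
      thus ?thesis using fN gN t[of 0] t[of i] i by simp
    qed
  qed
  ultimately show ?thesis by blast
qed

lemma orbits_permutes:
  assumes "\<pi> permutes {1..n::nat}"
  shows orbit_self: "x \<in> orbit \<pi> x"
    and orbit_in: "x \<in> {1..n} \<Longrightarrow> orbit \<pi> x \<subseteq> {1..n}"
    and orbit_eq_of_mem: "y \<in> orbit \<pi> x \<Longrightarrow> orbit \<pi> y = orbit \<pi> x"
proof -
  have p: "permutation \<pi>" using assms by (rule permutes_imp_permutation)
  show "x \<in> orbit \<pi> x" by (rule permutation_self_in_orbit[OF p])
  show "x \<in> {1..n} \<Longrightarrow> orbit \<pi> x \<subseteq> {1..n}" by (rule permutes_orbit_subset[OF assms])
  show "y \<in> orbit \<pi> x \<Longrightarrow> orbit \<pi> y = orbit \<pi> x"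
    using orbit_cyclic_eq3[OF cyclic_on_orbit'[OF p]] by blast
qed

text \<open>Cycles are paired by length, the two through n with each other, and each pair is aligned
  by \<open>orbit_conjugation\<close>. Aligning the marked pair at n itself makes the conjugating
  permutation fix n, so conjugacy holds already under S_{n-1}.\<close>

lemma near_class_conjugate:
  assumes P: "\<pi> \<in> near_class n \<mu> j" and Q: "\<rho> \<in> near_class n \<mu> j" and n: "n \<ge> 1"
  obtains \<tau> where "\<tau> permutes {1..n}" "\<tau> n = n" "\<tau> \<circ> \<pi> = \<rho> \<circ> \<tau>"
proof -
  have p: "\<pi> permutes {1..n}" and q: "\<rho> permutes {1..n}"
    using P Q by (auto simp: near_class_def)
  have pp: "permutation \<pi>" "permutation \<rho>" using p q permutes_imp_permutation by auto
  let ?A = "orbit \<pi> ` {1..n}" and ?B = "orbit \<rho> ` {1..n}"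
  let ?a = "orbit \<pi> n" and ?b = "orbit \<rho> n"
  have nin: "n \<in> {1..n}" using n by simp
  have ab: "?a \<in> ?A" "?b \<in> ?B" using nin by blast+
  have cab: "card ?a = card ?b" using P Q by (simp add: near_class_def)
  have "image_mset card (mset_set ?A) = image_mset card (mset_set ?B)"
    using P Q by (simp add: near_class_def cycle_type_def)
  then obtain f where f': "bij_betw f ?A ?B" "f ?a = ?b" "\<forall>w\<in>?A. card (f w) = card w"
    using ex_bij_betw_marked[where c = card and d = card, OF _ _ _ ab cab] by blast
  have f: "inj_on f ?A" "\<And>w. w \<in> ?A \<Longrightarrow> f w \<in> ?B \<and> card (f w) = card w" "f ?a = ?b"
    using f' bij_betwE[OF f'(1)] bij_betw_imp_inj_on[OF f'(1)] by blast+
  have "\<exists>t. bij_betw t w (f w) \<and> (w = ?a \<longrightarrow> t n = n) \<and> (\<forall>x\<in>w. t (\<pi> x) = \<rho> (t x))"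
    if w: "w \<in> ?A" for w
  proof (cases "w = ?a")
    case True
    thus ?thesis using orbit_conjugation[OF pp cab] f(3) by auto
  next
    case False
    obtain x y where xy: "w = orbit \<pi> x" "f w = orbit \<rho> y" using w f(2)[OF w] by auto
    hence "card (orbit \<pi> x) = card (orbit \<rho> y)" using f(2)[OF w] by simp
    from orbit_conjugation[OF pp this] show ?thesis using xy False by auto
  qed
  then obtain t where t: "\<And>w. w \<in> ?A \<Longrightarrow> bij_betw (t w) w (f w)"
      "t ?a n = n" "\<And>w x. w \<in> ?A \<Longrightarrow> x \<in> w \<Longrightarrow> t w (\<pi> x) = \<rho> (t w x)"
    using ab(1) by metis
  define \<tau> where "\<tau> = (\<lambda>x. if x \<in> {1..n} then t (orbit \<pi> x) x else x)"
  have mem: "\<tau> x \<in> f (orbit \<pi> x)" if "x \<in> {1..n}" for x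
    using t(1)[of "orbit \<pi> x"] orbit_self[OF p, of x] that by (auto simp: \<tau>_def bij_betw_def)
  have B: "w \<subseteq> {1..n}" if "w \<in> ?B" for w using that orbit_in[OF q] by blast
  have disj: "w = w'" if "w \<in> ?B" "w' \<in> ?B" "z \<in> w" "z \<in> w'" for w w' z
    using that orbit_eq_of_mem[OF q] by (metis (no_types, lifting) imageE)
  have inj: "inj_on \<tau> {1..n}"
  proof (rule inj_onI)
    fix x y assume xy: "x \<in> {1..n}" "y \<in> {1..n}" "\<tau> x = \<tau> y"
    have "f (orbit \<pi> x) = f (orbit \<pi> y)"
      using mem[OF xy(1)] mem[OF xy(2)] xy f(2) by (intro disj[of _ _ "\<tau> x"]) auto
    hence oo: "orbit \<pi> x = orbit \<pi> y" using xy inj_onD[OF f(1)] by blast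
    hence "t (orbit \<pi> x) x = t (orbit \<pi> x) y" using xy by (simp add: \<tau>_def)
    moreover have "x \<in> orbit \<pi> x" "y \<in> orbit \<pi> x" using orbit_self[OF p] oo by auto
    ultimately show "x = y" using t(1)[of "orbit \<pi> x"] xy by (auto simp: bij_betw_def dest: inj_onD)
  qed
  have "\<tau> ` {1..n} \<subseteq> {1..n}"
  proof
    fix z assume "z \<in> \<tau> ` {1..n}"
    then obtain x where x: "x \<in> {1..n}" "z = \<tau> x" by blast
    have "f (orbit \<pi> x) \<in> ?B" using f(2) x by blast
    thus "z \<in> {1..n}" using B mem[OF x(1)] x by blast
  qed
  hence "bij_betw \<tau> {1..n} {1..n}"
    using inj by (simp add: bij_betw_def endo_inj_surj)
  hence "\<tau> permutes {1..n}" by (rule bij_imp_permutes) (auto simp: \<tau>_def)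
  moreover have "\<tau> n = n" using n t(2) by (simp add: \<tau>_def)
  moreover have "\<tau> \<circ> \<pi> = \<rho> \<circ> \<tau>"
  proof
    fix x
    show "(\<tau> \<circ> \<pi>) x = (\<rho> \<circ> \<tau>) x"
    proof (cases "x \<in> {1..n}")
      case True
      have "\<pi> x \<in> {1..n}" using True by (simp only: permutes_in_image[OF p])
      moreover have "orbit \<pi> (\<pi> x) = orbit \<pi> x" by (rule permutation_orbit_step[OF pp(1)])
      ultimately show ?thesis using True t(3)[of "orbit \<pi> x" x] orbit_self[OF p, of x]
        by (simp add: \<tau>_def)
    next
      case False
      hence "\<pi> x = x" "\<rho> x = x" using p q by (meson permutes_not_in)+
      thus ?thesis using False by (auto simp: \<tau>_def)
    qed
  qed
  ultimately show ?thesis using that by blast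
qed

lemma cent_near_class_const:
  assumes x: "x \<in> cent m" and "\<pi> \<in> near_class (Suc m) \<mu> j" "\<rho> \<in> near_class (Suc m) \<mu> j"
  shows "galg_of x \<pi> = galg_of x \<rho>"
proof -
  obtain \<tau> where t: "\<tau> permutes {1..Suc m}" "\<tau> (Suc m) = Suc m" "\<tau> \<circ> \<pi> = \<rho> \<circ> \<tau>"
    using near_class_conjugate[OF assms(2,3)] by auto
  have p: "\<pi> permutes {1..Suc m}" "\<rho> permutes {1..Suc m}"
    using assms by (auto simp: near_class_def)
  define g k h where ghk: "g = Abs_fperm \<pi>" "k = Abs_fperm \<rho>" "h = Abs_fperm \<tau>"
  have pf: "perm_fun g = \<pi>" "perm_fun k = \<rho>" "perm_fun h = \<tau>"
    using p t unfolding ghk by (auto simp: permutes_imp_permutation)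
  have h: "h \<in> Sn m" by (rule Sn_Suc_fix) (simp_all only: Sn_iff pf t(1,2))
  have "perm_fun (h + g) = perm_fun (k + h)" unfolding perm_fun_add pf by (rule t(3))
  hence "h + g = k + h" by (simp only: perm_fun_inject)
  hence "h + g - h = k" by (simp add: diff_eq_eq)
  hence "coef x k = coef x g" using cent_coef[OF x h, of g] by simp
  thus ?thesis unfolding pf(1,2)[symmetric] galg_of_perm_fun by simp
qed

section \<open>Coefficients in the basis of near-class sums\<close>

lemma finite_near_class: "finite (near_class n \<mu> j)"
  by (rule finite_subset[OF _ finite_permutations[of "{1..n}"]]) (auto simp: near_class_def)

lemma K_elt_eq: "K_elt n \<nu> l \<rho> = (if \<rho> \<in> near_class n \<nu> l then 1 else 0)"
  by (simp add: K_elt_def gdelta_def finite_near_class)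

lemma finite_partitions: "finite (partitions n)"
proof (rule finite_subset)
  show "partitions n \<subseteq> mset ` {xs. set xs \<subseteq> {1..n} \<and> length xs \<le> n}"
  proof
    fix lam assume lam: "lam \<in> partitions n"
    obtain xs where xs: "mset xs = lam" using ex_mset by blast
    have s: "sum_list xs = n" and z: "0 \<notin> set xs"
      using lam xs by (auto simp: partitions_def sum_mset_sum_list[symmetric])
    have "x \<le> n" if "x \<in> set xs" for x using member_le_sum_list[OF that] s by simp
    moreover have "length xs \<le> sum_list xs" using z by (induction xs) auto
    moreover have "x \<ge> 1" if "x \<in> set xs" for x using that z by (metis One_nat_def Suc_leI gr0I)
    ultimately show "lam \<in> mset ` {xs. set xs \<subseteq> {1..n} \<and> length xs \<le> n}"
      using xs s by auto
  qed
  show "finite (mset ` {xs. set xs \<subseteq> {1..n} \<and> length xs \<le> n})"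
    by (intro finite_imageI finite_lists_length_le) auto
qed

text \<open>The sum in \<open>K_coeff\<close> runs over this set and would be 0 by convention if the
  set were infinite.\<close>

lemma finite_marked_partitions: "finite {(\<nu>, l). \<nu> \<in> partitions n \<and> l \<in># \<nu>}"
proof -
  have "{(\<nu>, l). \<nu> \<in> partitions n \<and> l \<in># \<nu>} = (SIGMA \<nu>:partitions n. set_mset \<nu>)" by auto
  thus ?thesis using finite_partitions by auto
qed

lemma cycle_type_partition:
  assumes p: "\<pi> permutes {1..n}"
  shows "cycle_type n \<pi> \<in> partitions n"
proof -
  let ?O = "orbit \<pi> ` {1..n}"
  have "sum_mset (cycle_type n \<pi>) = (\<Sum>w\<in>?O. card w)"
    by (simp add: cycle_type_def sum_unfold_sum_mset)
  also have "\<dots> = card (\<Union>?O)"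
  proof (rule card_Union_disjoint[symmetric])
    show "pairwise disjnt ?O"
      unfolding pairwise_def disjnt_def
    proof (clarify, rule ccontr)
      fix x y assume "orbit \<pi> x \<noteq> orbit \<pi> y" "orbit \<pi> x \<inter> orbit \<pi> y \<noteq> {}"
      then obtain z where "z \<in> orbit \<pi> x" "z \<in> orbit \<pi> y" by blast
      thus False using orbit_eq_of_mem[OF p] \<open>orbit \<pi> x \<noteq> orbit \<pi> y\<close> by metis
    qed
    show "finite A" if "A \<in> ?O" for A
    proof -
      obtain x where "x \<in> {1..n}" "A = orbit \<pi> x" using \<open>A \<in> ?O\<close> by blast
      thus ?thesis using finite_subset[OF orbit_in[OF p]] by blast
    qed
  qed
  also have "\<Union>?O = {1..n}"
    using orbit_in[OF p] orbit_self[OF p] by blast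
  finally have "sum_mset (cycle_type n \<pi>) = n" by simp
  moreover have "card (orbit \<pi> x) \<noteq> 0" if "x \<in> {1..n}" for x
    using orbit_in[OF p that] orbit_self[OF p, of x] by (metis card_0_eq empty_iff finite_atLeastAtMost finite_subset)
  hence "0 \<notin># cycle_type n \<pi>"
    by (fastforce simp: cycle_type_def)
  ultimately show ?thesis by (simp add: partitions_def)
qed

text \<open>Each permutation of \<open>{1..n}\<close> lies in exactly one near-class, so an
  expansion evaluated at \<open>\<pi>\<close> shows the single coefficient belonging to its class;
  this gives uniqueness. Existence holds because the coefficients of x are constant on
  near-classes.\<close>

lemma K_coeff_eq:
  assumes x: "x \<in> cent m" "x \<in> alg (Suc m)" and n: "n = Suc m"
    and \<mu>: "\<mu> \<in> partitions n" "j \<in># \<mu>" and \<pi>: "\<pi> \<in> near_class n \<mu> j"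
  shows "K_coeff n \<mu> j (galg_of x) = galg_of x \<pi>"
  unfolding K_coeff_def
proof (rule the_equality)
  let ?I = "{(\<nu>, l). \<nu> \<in> partitions n \<and> l \<in># \<nu>}"
  have eval: "(\<Sum>(\<nu>, l)\<in>?I. a \<nu> l * K_elt n \<nu> l \<rho>) = a (cycle_type n \<rho>) (card (orbit \<rho> n))"
    if r: "\<rho> permutes {1..n}" for a and \<rho> :: "nat \<Rightarrow> nat"
  proof -
    let ?p = "(cycle_type n \<rho>, card (orbit \<rho> n))"
    have nin: "n \<in> {1..n}" using n by simp
    have "card (orbit \<rho> n) \<in># cycle_type n \<rho>"
      unfolding cycle_type_def using nin by auto
    hence pin: "?p \<in> ?I" using cycle_type_partition[OF r] by simp
    have "(\<Sum>(\<nu>, l)\<in>?I. a \<nu> l * K_elt n \<nu> l \<rho>) = (\<Sum>q\<in>?I. if q = ?p then a (fst q) (snd q) else 0)"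
      using r by (intro sum.cong refl) (auto simp: K_elt_eq near_class_def split: if_splits)
    also have "\<dots> = a (cycle_type n \<rho>) (card (orbit \<rho> n))"
      using pin by (simp add: finite_marked_partitions)
    finally show ?thesis .
  qed
  \<comment> \<open>On an empty class the value is arbitrary, but there it multiplies a vanishing
    \<open>K_elt\<close>.\<close>
  define a where "a = (\<lambda>\<nu> l. galg_of x (SOME \<rho>. \<rho> \<in> near_class n \<nu> l))"
  have aval: "a \<nu> l = galg_of x \<rho>" if "\<rho> \<in> near_class n \<nu> l" for \<nu> l \<rho>
  proof -
    have "(SOME \<rho>. \<rho> \<in> near_class n \<nu> l) \<in> near_class n \<nu> l" 
      using that by (rule someI[where P = "\<lambda>\<rho>. \<rho> \<in> near_class n \<nu> l"])
    thus ?thesis unfolding a_def using cent_near_class_const[OF x(1)] that n by blast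
  qed
  have "galg_of x = (\<lambda>\<rho>. \<Sum>(\<nu>, l)\<in>?I. a \<nu> l * K_elt n \<nu> l \<rho>)"
  proof
    fix \<rho>
    show "galg_of x \<rho> = (\<Sum>(\<nu>, l)\<in>?I. a \<nu> l * K_elt n \<nu> l \<rho>)"
    proof (cases "\<rho> permutes {1..n}")
      case True
      hence "\<rho> \<in> near_class n (cycle_type n \<rho>) (card (orbit \<rho> n))" by (simp add: near_class_def)
      thus ?thesis using eval[OF True, of a] aval by simp
    next
      case False
      hence "galg_of x \<rho> = 0" using x(2) n by (auto simp: galg_of_def alg_iff Sn_iff)
      moreover have "(\<Sum>(\<nu>, l)\<in>?I. a \<nu> l * K_elt n \<nu> l \<rho>) = 0"
        using False by (intro sum.neutral) (auto simp: K_elt_eq near_class_def)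
      ultimately show ?thesis by simp
    qed
  qed
  moreover have "galg_of x \<pi> = a \<mu> j" using aval[OF \<pi>] by simp
  ultimately show "\<exists>a. galg_of x \<pi> = a \<mu> j \<and>
      galg_of x = (\<lambda>\<rho>. \<Sum>(\<nu>, l)\<in>?I. a \<nu> l * K_elt n \<nu> l \<rho>)" by blast
  fix c assume "\<exists>a. c = a \<mu> j \<and> galg_of x = (\<lambda>\<rho>. \<Sum>(\<nu>, l)\<in>?I. a \<nu> l * K_elt n \<nu> l \<rho>)"
  then obtain b where b: "c = b \<mu> j" "galg_of x = (\<lambda>\<rho>. \<Sum>(\<nu>, l)\<in>?I. b \<nu> l * K_elt n \<nu> l \<rho>)"
    by blast
  have "galg_of x \<pi> = b (cycle_type n \<pi>) (card (orbit \<pi> n))"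
    unfolding b(2) using \<pi> by (intro eval) (simp add: near_class_def)
  thus "c = galg_of x \<pi>" using b(1) \<pi> by (simp add: near_class_def)
qed

section \<open>The sum of a near-conjugacy class\<close>

definition near_elt :: "nat \<Rightarrow> nat multiset \<Rightarrow> nat \<Rightarrow> sga" where
  "near_elt n lam i = (\<Sum>g\<in>{g\<in>Sn n. perm_fun g \<in> near_class n lam i}. el g)"

lemma coef_near_elt: "coef (near_elt n lam i) g = (if perm_fun g \<in> near_class n lam i then 1 else 0)"
proof -
  have "perm_fun g \<in> near_class n lam i \<Longrightarrow> g \<in> Sn n" by (simp add: near_class_def Sn_iff)
  thus ?thesis by (auto simp: near_elt_def lookup_sum coef_el)
qed

lemma near_elt_alg: "near_elt n lam i \<in> alg n"
  unfolding near_elt_def by (intro alg_sum alg_el) auto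

lemma card_near_class: "card {g\<in>Sn n. perm_fun g \<in> near_class n lam i} = card (near_class n lam i)"
proof -
  have "perm_fun ` {g\<in>Sn n. perm_fun g \<in> near_class n lam i} = near_class n lam i"
    using Sn_image[of n] by (auto simp: near_class_def image_iff)
  thus ?thesis using card_image[OF inj_perm_fun] by metis
qed

lemma orbit_conj_image:
  assumes f: "permutation f" and t: "bij t"
  shows "orbit (t \<circ> f \<circ> inv t) (t x) = t ` orbit f x"
  using orbit_inverse[OF permutation_self_in_orbit[OF f], where f=t and g'="t \<circ> f \<circ> inv t"] t
  by (simp add: bij_is_inj inv_f_f)

lemma near_class_conj_iff:
  assumes h: "h \<in> Sn m"
  shows "perm_fun (h + g - h) \<in> near_class (Suc m) lam i \<longleftrightarrow> perm_fun g \<in> near_class (Suc m) lam i"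
proof -
  have "perm_fun (h + g - h) \<in> near_class (Suc m) lam i"
    if g: "perm_fun g \<in> near_class (Suc m) lam i" and h: "h \<in> Sn m" for g h
  proof -
    let ?n = "Suc m"
    define t where "t = perm_fun h"
    have t: "t permutes {1..?n}" "bij t" "t ?n = ?n"
      using h Sn_mono[of m ?n] Sn_fix[OF h, of ?n] by (auto simp: t_def Sn_iff)
    have G: "perm_fun g permutes {1..?n}" using g by (simp add: near_class_def)
    have e: "perm_fun (h + g - h) = t \<circ> perm_fun g \<circ> inv t"
      by (simp only: diff_conv_add_uminus perm_fun_add perm_fun_minus t_def)
    have w: "orbit (t \<circ> perm_fun g \<circ> inv t) (t x) = t ` orbit (perm_fun g) x" for x
      using t by (intro orbit_conj_image) auto
    have c: "card (t ` A) = card A" for A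
      using t(2) by (intro card_image) (meson bij_is_inj inj_on_subset subset_UNIV)
    have "t ` {1..?n} = {1..?n}" using permutes_image[OF t(1)] .
    hence "orbit (t \<circ> perm_fun g \<circ> inv t) ` {1..?n} = (\<lambda>x. orbit (t \<circ> perm_fun g \<circ> inv t) (t x)) ` {1..?n}"
      by (metis image_image)
    also have "\<dots> = (`) t ` (orbit (perm_fun g) ` {1..?n})"
      unfolding w by (simp add: image_image)
    finally have im: "orbit (t \<circ> perm_fun g \<circ> inv t) ` {1..?n} = (`) t ` (orbit (perm_fun g) ` {1..?n})" .
    have "inj_on ((`) t) (orbit (perm_fun g) ` {1..?n})"
      using t(2) by (auto intro!: inj_onI simp: bij_is_inj inj_image_eq_iff)
    hence "mset_set (orbit (t \<circ> perm_fun g \<circ> inv t) ` {1..?n})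
        = image_mset ((`) t) (mset_set (orbit (perm_fun g) ` {1..?n}))"
      unfolding im by (rule image_mset_mset_set[symmetric])
    hence "cycle_type ?n (t \<circ> perm_fun g \<circ> inv t) = cycle_type ?n (perm_fun g)"
      by (simp add: cycle_type_def multiset.map_comp o_def c)
    moreover have "card (orbit (t \<circ> perm_fun g \<circ> inv t) ?n) = card (orbit (perm_fun g) ?n)"
      using w[of ?n] t(3) c by simp
    moreover have "t \<circ> perm_fun g \<circ> inv t permutes {1..?n}"
      using G t(1) by (intro permutes_compose permutes_inv)
    ultimately show ?thesis using g unfolding e by (simp add: near_class_def)
  qed
  note conj = this
  \<comment> \<open>The converse is the same implication for \<open>- h\<close>, which undoes the
    conjugation.\<close>
  have e: "- h + (h + g - h) - (- h) = g"
    by (simp add: diff_conv_add_uminus add.assoc del: add_uminus_conv_diff)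
  show ?thesis using conj[OF _ h, of g] conj[of "h + g - h" "- h"] h unfolding e by auto
qed

lemma near_elt_cent: "near_elt (Suc m) lam i \<in> cent m"
  unfolding cent_def
proof (clarify, rule sga_eqI)
  fix h g assume h: "h \<in> Sn m"
  have "h + (- h + g) - h = g - h" by (simp add: add.assoc[symmetric])
  thus "coef (el h * near_elt (Suc m) lam i) g = coef (near_elt (Suc m) lam i * el h) g"
    using near_class_conj_iff[OF h, of "- h + g" lam i]
    by (simp add: coef_el_mult coef_mult_el coef_near_elt)
qed

lemma near_class_minus: "perm_fun (- g) \<in> near_class n lam i \<longleftrightarrow> perm_fun g \<in> near_class n lam i"
proof -
  have w: "orbit (perm_fun (- g)) = orbit (perm_fun g)"
    by (rule ext) (simp add: perm_fun_minus orbit_inv_eq)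
  have "perm_fun (- g) permutes {1..n} \<longleftrightarrow> perm_fun g permutes {1..n}"
    using Sn_minus[of g n] by (simp add: Sn_iff)
  thus ?thesis by (simp add: near_class_def cycle_type_def w)
qed

text \<open>The coefficient of the identity collects the coefficients of x at the inverses of the
  class members; the class is closed under inversion and x is constant on it.\<close>

lemma trace_near_elt:
  assumes x: "x \<in> cent m" and \<pi>: "\<pi> \<in> near_class (Suc m) lam i"
  shows "coef (near_elt (Suc m) lam i * x) 0 = of_nat (card (near_class (Suc m) lam i)) * galg_of x \<pi>"
proof -
  let ?C = "{g\<in>Sn (Suc m). perm_fun g \<in> near_class (Suc m) lam i}"
  have "coef (near_elt (Suc m) lam i * x) 0 = (\<Sum>g\<in>?C. galg_of x (perm_fun (- g)))"
    by (simp add: near_elt_def sum_distrib_right lookup_sum coef_el_mult)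
  also have "\<dots> = (\<Sum>g\<in>?C. galg_of x \<pi>)"
  proof (rule sum.cong[OF refl])
    fix g assume "g \<in> ?C"
    hence "perm_fun (- g) \<in> near_class (Suc m) lam i" by (simp add: near_class_minus)
    thus "galg_of x (perm_fun (- g)) = galg_of x \<pi>" by (rule cent_near_class_const[OF x _ \<pi>])
  qed
  finally show ?thesis by (simp add: card_near_class)
qed

section \<open>Full cycles and dipoles\<close>

text \<open>Multiplying by \<open>(a, m + 1)\<close> on the left inserts m + 1 just before a in the
  cycle of a and changes nothing else.\<close>

lemma cyclic_on_insert_point:
  assumes t: "\<tau> permutes {1..m}" and a: "a \<in> {1..m}"
  shows "cyclic_on (transpose a (Suc m) \<circ> \<tau>) {1..Suc m} \<longleftrightarrow> cyclic_on \<tau> {1..m}"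
proof -
  let ?n = "Suc m"
  let ?g = "transpose a ?n \<circ> \<tau>"
  have tn: "\<tau> ?n = ?n" using t by (auto simp: permutes_def)
  have tin: "\<tau> y \<in> {1..m} \<longleftrightarrow> y \<in> {1..m}" for y using permutes_in_image[OF t] .
  have gn: "?g ?n = a" using a by (simp add: tn)
  have g: "?g permutes {1..?n}"
    using t a by (intro permutes_compose permutes_swap_id) (auto intro: permutes_subset)
  show ?thesis
  proof
    assume "cyclic_on \<tau> {1..m}"
    hence o: "orbit \<tau> a = {1..m}" using a by (rule orbit_cyclic_eq3)
    have aorb: "a \<in> orbit ?g ?n" using orbit.base[of ?g ?n] gn by simp
    have "y \<in> orbit ?g ?n" if "y \<in> orbit \<tau> a" for y
      using that
    proof induction
      case base
      show ?case
      proof (cases "\<tau> a = a")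
        case False
        have "\<tau> a \<noteq> ?n" using tin[of a] a by auto
        hence "?g a = \<tau> a" using False by simp
        thus ?thesis using orbit.step[OF aorb] by (simp only:)
      qed (use aorb in \<open>simp only:\<close>)
    next
      case (step y)
      hence y: "y \<in> {1..m}" using o by simp
      show ?case
      proof (cases "\<tau> y = a")
        case False
        have "\<tau> y \<noteq> ?n" using tin[of y] y by auto
        hence "?g y = \<tau> y" using False by simp
        thus ?thesis using orbit.step[OF step.IH] by (simp only:)
      qed (use aorb in \<open>simp only:\<close>)
    qed
    hence "{1..?n} \<subseteq> orbit ?g ?n" using o orbit_self[OF g, of ?n] by (auto simp: le_Suc_eq)
    moreover have "orbit ?g ?n \<subseteq> {1..?n}" by (rule orbit_in[OF g]) simp
    ultimately show "cyclic_on ?g {1..?n}" unfolding cyclic_on_def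
      by (intro bexI[of _ ?n]) auto
  next
    assume "cyclic_on ?g {1..?n}"
    hence o: "orbit ?g ?n = {1..?n}" by (rule orbit_cyclic_eq3) simp
    have "y \<noteq> ?n \<longrightarrow> y \<in> orbit \<tau> a" if "y \<in> orbit ?g ?n" for y
      using that
    proof induction
      case base
      show ?case using gn orbit_self[OF t, of a] by simp
    next
      case (step y)
      show ?case
      proof
        assume ne: "?g y \<noteq> ?n"
        show "?g y \<in> orbit \<tau> a"
        proof (cases "y = ?n")
          case True
          thus ?thesis using gn orbit_self[OF t, of a] by simp
        next
          case False
          hence y: "y \<in> orbit \<tau> a" "y \<in> {1..m}" using step o by auto
          have "\<tau> y \<noteq> ?n" using tin[of y] y by auto
          moreover have "\<tau> y \<noteq> a" using ne by auto
          ultimately have "?g y = \<tau> y" by simp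
          thus ?thesis using orbit.step[OF y(1)] by (simp only:)
        qed
      qed
    qed
    hence "{1..m} \<subseteq> orbit \<tau> a" using o by auto
    moreover have "orbit \<tau> a \<subseteq> {1..m}" by (rule orbit_in[OF t a])
    ultimately show "cyclic_on \<tau> {1..m}" unfolding cyclic_on_def using a by blast
  qed
qed

section \<open>Full cycles and the product of Jucys-Murphy elements\<close>

definition full_cycles :: "nat \<Rightarrow> fperm set" where
  "full_cycles m = {g \<in> Sn m. cyclic_on (perm_fun g) {1..m}}"

lemma finite_full_cycles [simp]: "finite (full_cycles m)"
  by (simp add: full_cycles_def)

lemma full_cycles_minus: "- g \<in> full_cycles m \<longleftrightarrow> g \<in> full_cycles m"
  by (simp add: full_cycles_def perm_fun_minus cyclic_on_def orbit_inv_eq)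

lemma tp_add_full_cycle:
  assumes "g \<in> Sn m" "a \<in> {1..m}"
  shows "tp a (Suc m) + g \<in> full_cycles (Suc m) \<longleftrightarrow> g \<in> full_cycles m"
proof -
  have "tp a (Suc m) + g \<in> Sn (Suc m)"
    using assms Sn_mono[of m "Suc m"] by (intro Sn_add tp_in_Sn) auto
  thus ?thesis
    using assms cyclic_on_insert_point[of "perm_fun g" m a]
    by (simp add: full_cycles_def perm_fun_add Sn_iff[of g])
qed

text \<open>Every full cycle of S_{m+1} arises exactly once by inserting m + 1 into a full cycle of
  S_m before a point a, and choosing a means choosing a summand of \<open>JM (Suc m)\<close>. At
  size 1 the identity is the full cycle, in accordance with the empty product.\<close>

lemma JM_prod_full_cycles: "m \<ge> 1 \<Longrightarrow> JM_prod m = (\<Sum>g\<in>full_cycles m. el g)"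
proof (induction m rule: nat_induct_at_least)
  case base
  have "orbit id (1::nat) = {1}" by (simp only: orbit_eq_singleton_iff id_apply)
  hence c: "cyclic_on id {1..1::nat}" unfolding cyclic_on_def by (intro bexI[of _ 1]) simp_all
  have "full_cycles 1 = {0}"
    unfolding full_cycles_def Sn_le1[OF order.refl]
    by (rule Set.set_eqI) (use c in \<open>auto simp del: One_nat_def\<close>)
  thus ?case by (simp add: JM_prod.simps(2))
next
  case (Suc m)
  let ?n = "Suc m"
  have "JM_prod ?n = (\<Sum>a\<in>{1..m}. \<Sum>g\<in>full_cycles m. el (tp a ?n + g))"
    using Suc by (simp add: JM_prod_Suc JM_def atLeastLessThanSuc_atLeastAtMost
        sum_distrib_left sum_distrib_right el_add sum.swap[of _ "full_cycles m"])
  also have "\<dots> = (\<Sum>(a, g)\<in>{1..m} \<times> full_cycles m. el (tp a ?n + g))"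
    by (simp add: sum.cartesian_product)
  also have "\<dots> = (\<Sum>g\<in>full_cycles ?n. el g)"
  proof (rule sum.reindex_bij_witness[where j="\<lambda>(a, g). tp a ?n + g"
          and i="\<lambda>g. (perm_fun g ?n, tp (perm_fun g ?n) ?n + g)"])
    fix q assume "q \<in> {1..m} \<times> full_cycles m"
    then obtain a h where q: "q = (a, h)" "a \<in> {1..m}" "h \<in> full_cycles m" by auto
    have hn: "perm_fun h ?n = ?n" using q by (intro Sn_fix[of h m]) (auto simp: full_cycles_def)
    have an: "perm_fun (tp a ?n + h) ?n = a" by (simp add: perm_fun_add hn)
    show "(perm_fun (case q of (a, g) \<Rightarrow> tp a ?n + g) ?n,
        tp (perm_fun (case q of (a, g) \<Rightarrow> tp a ?n + g) ?n) ?n + (case q of (a, g) \<Rightarrow> tp a ?n + g)) = q"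
      by (simp add: q(1) an add.assoc[symmetric])
    show "(case q of (a, g) \<Rightarrow> tp a ?n + g) \<in> full_cycles ?n"
      using q tp_add_full_cycle[of h m a] by (auto simp: full_cycles_def[of m])
    show "el (case q of (a, g) \<Rightarrow> tp a ?n + g) = (case q of (a, g) \<Rightarrow> el (tp a ?n + g))"
      by (simp add: q)
  next
    fix g assume g: "g \<in> full_cycles ?n"
    show "(case (perm_fun g ?n, tp (perm_fun g ?n) ?n + g) of (a, g) \<Rightarrow> tp a ?n + g) = g"
      by (simp add: add.assoc[symmetric])
    have gS: "g \<in> Sn ?n" and cyc: "cyclic_on (perm_fun g) {1..?n}"
      using g by (auto simp: full_cycles_def)
    have "perm_fun g ?n \<noteq> ?n"
    proof
      assume "perm_fun g ?n = ?n"
      hence "orbit (perm_fun g) ?n = {?n}" by (simp add: orbit_eq_singleton_iff)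
      moreover have "orbit (perm_fun g) ?n = {1..?n}" using cyc by (rule orbit_cyclic_eq3) simp
      moreover have "m \<in> {1..?n}" using Suc.hyps by simp
      ultimately show False by (metis n_not_Suc_n singletonD)
    qed
    moreover have "perm_fun g ?n \<in> {1..?n}"
      using gS permutes_in_image[of "perm_fun g" "{1..?n}" ?n] by (simp add: Sn_iff)
    ultimately have a: "perm_fun g ?n \<in> {1..m}" by auto
    have "tp (perm_fun g ?n) ?n + g \<in> Sn ?n" using gS a by (intro Sn_add tp_in_Sn) auto
    hence h: "tp (perm_fun g ?n) ?n + g \<in> Sn m"
      by (rule Sn_Suc_fix) (simp add: perm_fun_add)
    have "tp (perm_fun g ?n) ?n + (tp (perm_fun g ?n) ?n + g) = g"
      by (simp add: add.assoc[symmetric])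
    hence "tp (perm_fun g ?n) ?n + g \<in> full_cycles m"
      using tp_add_full_cycle[OF h a] g by simp
    thus "(perm_fun g ?n, tp (perm_fun g ?n) ?n + g) \<in> {1..m} \<times> full_cycles m"
      using a by simp
  qed
  finally show ?case .
qed

lemma coef_JM_prod_near_elt:
  assumes "m \<ge> 1"
  shows "coef (JM_prod m * near_elt n lam i) r
    = of_nat (card {g\<in>full_cycles m. perm_fun (g + r) \<in> near_class n lam i})"
proof -
  have "coef (JM_prod m * near_elt n lam i) r
      = (\<Sum>g\<in>full_cycles m. coef (near_elt n lam i) (- g + r))"
    by (simp add: JM_prod_full_cycles[OF assms] sum_distrib_right lookup_sum coef_el_mult)
  also have "\<dots> = (\<Sum>g\<in>full_cycles m. coef (near_elt n lam i) (g + r))"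
    by (rule sum.reindex_bij_witness[where i="\<lambda>g. - g" and j="\<lambda>g. - g"])
       (auto simp: full_cycles_minus)
  finally show ?thesis by (simp add: coef_near_elt sum.If_cases Int_def)
qed


section \<open>Counting dipoles through full cycles\<close>

definition root_list :: "nat \<Rightarrow> nat \<Rightarrow> nat list" where
  "root_list n p = [n] @ [1..<p] @ [n - 1] @ [p..<n - 1]"

definition root_elt :: "nat \<Rightarrow> nat \<Rightarrow> fperm" where
  "root_elt m p = tp m (Suc m) + Abs_fperm (root_rotation (Suc m) p)"

lemma perm_fun_root_elt:
  "perm_fun (root_elt m p) = transpose m (Suc m) \<circ> root_rotation (Suc m) p"
  by (simp add: root_elt_def perm_fun_add root_rotation_def permutation_of_cycle)

text \<open>The condition \<open>inv \<sigma> n = n - 1\<close> says that \<open>\<sigma>\<close>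
  times s fixes n. So \<open>\<sigma>\<close> is written as g s with g in S_m, and the second s is
  absorbed into \<open>root_elt m p\<close>.\<close>

lemma card_dipoles:
  assumes m: "m \<ge> 1"
  shows "card (dipoles (Suc m) p lam i)
    = card {g\<in>full_cycles m. perm_fun (g + root_elt m p) \<in> near_class (Suc m) lam i}"
proof -
  let ?n = "Suc m" and ?C = "root_rotation (Suc m) p"
  let ?s = "transpose m (Suc m)"
  let ?G = "{g\<in>full_cycles m. perm_fun (g + root_elt m p) \<in> near_class ?n lam i}"
  have prod: "perm_fun (g + root_elt m p) = (perm_fun g \<circ> ?s) \<circ> ?C" for g
    by (simp add: perm_fun_add perm_fun_root_elt o_assoc)
  \<comment> \<open>Turns the multiplication by s on the right into one by a transposition on the
    left, the form in which \<open>cyclic_on_insert_point\<close> applies.\<close>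
  have swap: "perm_fun g \<circ> ?s = transpose (perm_fun g m) ?n \<circ> perm_fun g" if "g \<in> Sn m" for g
  proof -
    have "perm_fun g ?n = ?n" using that by (rule Sn_fix) simp
    moreover have "g + tp m ?n = tp (perm_fun g m) (perm_fun g ?n) + g"
      using tp_conj[of g m ?n] by (simp add: diff_eq_eq)
    ultimately show ?thesis by (metis perm_fun_add perm_fun_tp)
  qed
  have cyc: "cyclic_on (perm_fun g \<circ> ?s) {1..?n} \<longleftrightarrow> cyclic_on (perm_fun g) {1..m}" if g: "g \<in> Sn m" for g
  proof -
    have "perm_fun g m \<in> {1..m}" using g m permutes_in_image[of "perm_fun g" "{1..m}" m] by (simp add: Sn_iff)
    thus ?thesis unfolding swap[OF g] using g by (intro cyclic_on_insert_point) (auto simp: Sn_iff)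
  qed
  have "bij_betw (\<lambda>g. perm_fun g \<circ> ?s) ?G (dipoles ?n p lam i)"
    unfolding bij_betw_def
  proof
    show "inj_on (\<lambda>g. perm_fun g \<circ> ?s) ?G"
    proof (rule inj_onI)
      fix g h assume "perm_fun g \<circ> ?s = perm_fun h \<circ> ?s"
      hence "(perm_fun g \<circ> ?s) \<circ> ?s = (perm_fun h \<circ> ?s) \<circ> ?s" by simp
      hence "perm_fun g = perm_fun h" by (simp add: comp_assoc)
      thus "g = h" by (simp add: perm_fun_inject)
    qed
    show "(\<lambda>g. perm_fun g \<circ> ?s) ` ?G = dipoles ?n p lam i"
    proof (intro set_eqI iffI)
      fix \<sigma> assume "\<sigma> \<in> (\<lambda>g. perm_fun g \<circ> ?s) ` ?G"
      then obtain g where g: "g \<in> Sn m" "cyclic_on (perm_fun g) {1..m}" "\<sigma> = perm_fun g \<circ> ?s"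
          "perm_fun (g + root_elt m p) \<in> near_class ?n lam i" by (auto simp: full_cycles_def)
      have "tp m ?n \<in> Sn ?n" using m by (intro tp_in_Sn) auto
      hence "g + tp m ?n \<in> Sn ?n" using g(1) Sn_mono[of m ?n] by (intro Sn_add) auto
      hence sp: "\<sigma> permutes {1..?n}" using g(3) by (simp add: Sn_iff perm_fun_add)
      have "perm_fun g ?n = ?n" using g(1) by (rule Sn_fix) simp
      hence "\<sigma> m = ?n" using g(3) by simp
      hence "inv \<sigma> ?n = m" using permutes_inverses(2)[OF sp, of m] by simp
      thus "\<sigma> \<in> dipoles ?n p lam i"
        using sp g cyc[OF g(1)] prod[of g] by (simp add: dipoles_def)
    next
      fix \<sigma> assume s: "\<sigma> \<in> dipoles ?n p lam i"
      hence sp: "\<sigma> permutes {1..?n}" and inv: "inv \<sigma> ?n = m" by (auto simp: dipoles_def)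
      define g where "g = Abs_fperm \<sigma> + tp m ?n"
      have pg: "perm_fun g = \<sigma> \<circ> ?s"
        using permutes_imp_permutation[OF sp] by (simp add: g_def perm_fun_add)
      have "tp m ?n \<in> Sn ?n" using m by (intro tp_in_Sn) auto
      moreover have "Abs_fperm \<sigma> \<in> Sn ?n" using sp permutes_imp_permutation[OF sp] by (simp add: Sn_iff)
      ultimately have "g \<in> Sn ?n" unfolding g_def by (intro Sn_add)
      moreover have "\<sigma> m = ?n" using inv permutes_inverses(1)[OF sp, of ?n] by simp
      hence "perm_fun g ?n = ?n" by (simp add: pg)
      ultimately have g: "g \<in> Sn m" by (rule Sn_Suc_fix)
      have e: "perm_fun g \<circ> ?s = \<sigma>" by (simp add: pg comp_assoc)
      hence "g \<in> ?G" using s g cyc[OF g] prod[of g] by (simp add: dipoles_def full_cycles_def)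
      thus "\<sigma> \<in> (\<lambda>g. perm_fun g \<circ> ?s) ` ?G" using e by (metis (no_types, lifting) image_eqI)
    qed
  qed
  thus ?thesis by (rule bij_betw_same_card[symmetric])
qed

text \<open>Multiplying by s cuts the root rotation into the cycles (n, 1, ..., p - 1) and (m, p,
  ..., m - 1). For p = 1 the first of them is a fixed point, for p = m the second.\<close>

lemma root_elt_apply:
  assumes p: "1 \<le> p" "p \<le> m"
  shows "perm_fun (root_elt m p) (Suc m) = (if p = 1 then Suc m else 1)"
    and "x \<in> {1..<p} \<Longrightarrow> perm_fun (root_elt m p) x = (if x = p - 1 then Suc m else Suc x)"
    and "perm_fun (root_elt m p) m = (if p = m then m else p)"
    and "x \<in> {p..<m} \<Longrightarrow> perm_fun (root_elt m p) x = (if x = m - 1 then m else Suc x)"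
proof -
  let ?n = "Suc m"
  let ?L = "root_list ?n p"
  have len: "length ?L = ?n" using p by (simp add: root_list_def)
  have dist: "distinct ?L" using p by (auto simp: root_list_def)
  have C: "root_rotation ?n p = cycle_of_list ?L"
    by (simp add: root_rotation_def root_list_def)
  \<comment> \<open>Numbers below p stand at their own index, m stands at index p, and the numbers
    from p on are shifted by one.\<close>
  have nth: "?L ! 0 = ?n" "\<And>x. x \<in> {1..<p} \<Longrightarrow> ?L ! x = x" "?L ! p = m"
      "\<And>x. x \<in> {p..<m} \<Longrightarrow> ?L ! Suc x = x"
    using p by (auto simp: root_list_def nth_append nth_Cons')
  have rot: "root_rotation ?n p (?L ! k) = ?L ! (Suc k mod ?n)" if "k < ?n" for k
  proof -
    have "map (cycle_of_list ?L) ?L ! k = rotate1 ?L ! k"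
      using cyclic_rotation[OF dist, of 1] by simp
    moreover have "rotate1 ?L ! k = ?L ! (Suc k mod ?n)"
      using nth_rotate1[of k ?L] len that by simp
    ultimately show ?thesis using that len C by simp
  qed
  show "perm_fun (root_elt m p) ?n = (if p = 1 then ?n else 1)"
    using rot[of 0] nth p by (auto simp: perm_fun_root_elt transpose_def)
  show "perm_fun (root_elt m p) x = (if x = p - 1 then ?n else Suc x)" if x: "x \<in> {1..<p}"
  proof -
    have "root_rotation ?n p x = ?L ! Suc x" using rot[of x] nth(2)[OF x] x p by simp
    moreover have "?L ! Suc x = (if x = p - 1 then m else Suc x)"
    proof (cases "x = p - 1")
      case True
      hence "Suc x = p" using x by simp
      thus ?thesis using nth(3) True by simp
    next
      case False
      hence "Suc x \<in> {1..<p}" using x by auto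
      thus ?thesis using nth(2) False by simp
    qed
    ultimately show ?thesis using x p by (auto simp: perm_fun_root_elt transpose_def)
  qed
  show "perm_fun (root_elt m p) m = (if p = m then m else p)"
  proof (cases "p = m")
    case True
    thus ?thesis using rot[of p] nth(1,3) by (simp add: perm_fun_root_elt)
  next
    case False
    hence "p \<in> {p..<m}" using p by simp
    hence "root_rotation ?n p m = p" using rot[of p] nth(3,4) p False by simp
    thus ?thesis using False p by (simp add: perm_fun_root_elt transpose_def)
  qed
  show "perm_fun (root_elt m p) x = (if x = m - 1 then m else Suc x)" if x: "x \<in> {p..<m}"
  proof (cases "x = m - 1")
    case True
    hence e: "Suc (Suc x) = ?n" using x by auto
    have "root_rotation ?n p x = ?n" using rot[of "Suc x"] nth(1) nth(4)[OF x] x e by simp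
    thus ?thesis using True by (simp add: perm_fun_root_elt)
  next
    case False
    hence x': "Suc x \<in> {p..<m}" using x by auto
    have "root_rotation ?n p x = Suc x"
      using rot[of "Suc x"] nth(4)[OF x] nth(4)[OF x'] x x' by simp
    thus ?thesis using False x' by (simp add: perm_fun_root_elt transpose_def)
  qed
qed

lemma root_elt_near_class:
  assumes p: "1 \<le> p" "p \<le> m"
  shows "perm_fun (root_elt m p) \<in> near_class (Suc m) {#p, Suc m - p#} p"
proof -
  let ?n = "Suc m"
  define r where "r = perm_fun (root_elt m p)"
  have r1: "r ?n = (if p = 1 then ?n else 1)"
    and r2: "\<And>x. x \<in> {1..<p} \<Longrightarrow> r x = (if x = p - 1 then ?n else Suc x)"
    and r3: "r m = (if p = m then m else p)"
    and r4: "\<And>x. x \<in> {p..<m} \<Longrightarrow> r x = (if x = m - 1 then m else Suc x)"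
    unfolding r_def using root_elt_apply[OF p] by blast+
  have perm: "r permutes {1..?n}"
  proof -
    have "root_rotation ?n p permutes set (root_list ?n p)"
      unfolding root_rotation_def root_list_def by (rule cycle_permutes)
    moreover have "set (root_list ?n p) = {1..?n}" using p by (auto simp: root_list_def)
    ultimately have "root_rotation ?n p permutes {1..?n}" by simp
    moreover have "transpose m ?n permutes {1..?n}" using p by (intro permutes_swap_id) auto
    ultimately show ?thesis unfolding r_def perm_fun_root_elt by (intro permutes_compose)
  qed
  let ?A = "insert ?n {1..<p}" and ?B = "insert m {p..<m}"
  have A: "orbit r ?n = ?A"
  proof
    show "orbit r ?n \<subseteq> ?A"
    proof
      fix y assume "y \<in> orbit r ?n"
      thus "y \<in> ?A"
      proof induction
        case base
        show ?case using r1 p by auto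
      next
        case (step y)
        thus ?case using r1 r2[of y] p by (cases "y = ?n") auto
      qed
    qed
    have n: "?n \<in> orbit r ?n" by (rule orbit_self[OF perm])
    have "x < p \<longrightarrow> x \<in> orbit r ?n" if "x \<ge> 1" for x
      using that
    proof (induction x rule: nat_induct_at_least)
      case base
      show ?case using r1 orbit.base[of r ?n] p by auto
    next
      case (Suc x)
      show ?case
      proof
        assume "Suc x < p"
        hence "x \<in> orbit r ?n" "r x = Suc x" using Suc r2[of x] by auto
        thus "Suc x \<in> orbit r ?n" using orbit.step by metis
      qed
    qed
    thus "?A \<subseteq> orbit r ?n" using n by auto
  qed
  have B: "orbit r m = ?B"
  proof
    show "orbit r m \<subseteq> ?B"
    proof
      fix y assume "y \<in> orbit r m"
      thus "y \<in> ?B"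
      proof induction
        case base
        show ?case using r3 p by auto
      next
        case (step y)
        thus ?case using r3 r4[of y] p by (cases "y = m") auto
      qed
    qed
    have n: "m \<in> orbit r m" by (rule orbit_self[OF perm])
    have "x < m \<longrightarrow> x \<in> orbit r m" if "x \<ge> p" for x
      using that
    proof (induction x rule: nat_induct_at_least)
      case base
      show ?case using r3 orbit.base[of r m] p by auto
    next
      case (Suc x)
      show ?case
      proof
        assume "Suc x < m"
        hence "x \<in> orbit r m" "r x = Suc x" using Suc r4[of x] by auto
        thus "Suc x \<in> orbit r m" using orbit.step by metis
      qed
    qed
    thus "?B \<subseteq> orbit r m" using n by auto
  qed
  have cov: "orbit r x = ?A \<or> orbit r x = ?B" if "x \<in> {1..?n}" for x
  proof -
    have "x \<in> ?A \<or> x \<in> ?B" using that p by auto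
    thus ?thesis using orbit_eq_of_mem[OF perm] A B by metis
  qed
  have "orbit r ` {1..?n} = {?A, ?B}"
  proof
    show "orbit r ` {1..?n} \<subseteq> {?A, ?B}" using cov by blast
    have "?n \<in> {1..?n}" "m \<in> {1..?n}" using p by auto
    thus "{?A, ?B} \<subseteq> orbit r ` {1..?n}" using A B by blast
  qed
  moreover have "?A \<noteq> ?B" using p by auto
  moreover have "card ?A = p" "card ?B = ?n - p" using p by auto
  ultimately have "cycle_type ?n r = {#p, ?n - p#}" by (simp add: cycle_type_def)
  thus ?thesis using perm A \<open>card ?A = p\<close> unfolding r_def[symmetric]
    by (simp add: near_class_def)
qed

section \<open>Tableaux of hook and near-hook shape\<close>

lemma card_image_below:
  fixes f :: "nat \<Rightarrow> nat"
  assumes mono: "\<And>i j. i < j \<Longrightarrow> j < a \<Longrightarrow> f i < f j" and i: "i < a"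
  shows "card {x \<in> f ` {..<a}. x < f i} = i"
proof -
  have "{x \<in> f ` {..<a}. x < f i} = f ` {..<i}"
  proof (intro set_eqI iffI)
    fix x assume "x \<in> {x \<in> f ` {..<a}. x < f i}"
    then obtain j where j: "j < a" "x = f j" "f j < f i" by auto
    have "j < i"
    proof (rule ccontr)
      assume "\<not> j < i"
      hence "i = j \<or> i < j" by auto
      thus False using j mono[of i j] by auto
    qed
    thus "x \<in> f ` {..<i}" using j by auto
  next
    fix x assume "x \<in> f ` {..<i}"
    thus "x \<in> {x \<in> f ` {..<a}. x < f i}" using i mono by auto
  qed
  moreover have "inj_on f {..<i}"
  proof (rule inj_onI)
    fix x y assume "x \<in> {..<i}" "y \<in> {..<i}" "f x = f y"
    thus "x = y" using mono[of x y] mono[of y x] i by (metis lessThan_iff less_irrefl less_trans linorder_neqE_nat)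
  qed
  ultimately show ?thesis by (simp add: card_image)
qed

text \<open>By \<open>card_image_below\<close> the index of a value is its rank in the common set of
  values.\<close>

lemma increasing_unique:
  fixes f g :: "nat \<Rightarrow> nat"
  assumes f: "\<And>i j. i < j \<Longrightarrow> j < a \<Longrightarrow> f i < f j" and g: "\<And>i j. i < j \<Longrightarrow> j < a \<Longrightarrow> g i < g j"
    and eq: "f ` {..<a} = g ` {..<a}" and i: "i < a"
  shows "f i = g i"
proof -
  have "f i \<in> g ` {..<a}" using eq i by blast
  then obtain j where j: "j < a" "f i = g j" by auto
  have "card {x \<in> f ` {..<a}. x < f i} = i" by (rule card_image_below[OF f i])
  moreover have "card {x \<in> g ` {..<a}. x < g j} = j" by (rule card_image_below[OF g j(1)])
  ultimately have "i = j" using eq j(2) by simp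
  thus ?thesis using j by simp
qed

text \<open>First row of a boxes, l boxes below the corner, and the inner box \<open>(1, 1)\<close>
  if b holds; one family covers hooks and near-hooks.\<close>

definition diag :: "nat \<Rightarrow> nat \<Rightarrow> bool \<Rightarrow> (nat \<times> nat) set" where
  "diag a l b = {(r, c). r = 0 \<and> c < a \<or> c = 0 \<and> 1 \<le> r \<and> r \<le> l \<or> b \<and> r = 1 \<and> c = 1}"

definition tab_leg :: "nat \<Rightarrow> (nat \<times> nat \<Rightarrow> nat) \<Rightarrow> nat set" where
  "tab_leg l T = (\<lambda>r. T (r, 0)) ` {1..l}"

definition tab_inner :: "bool \<Rightarrow> (nat \<times> nat \<Rightarrow> nat) \<Rightarrow> nat set" where
  "tab_inner b T = (if b then {T (1, 1)} else {})"

text \<open>V holds the entry of the inner box, if there is one, and S the entries of the leg. The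
  last condition makes the inner entry larger than its left and upper neighbours, which are the
  least elements of the leg and of the arm without the corner.\<close>

definition tab_codes :: "nat \<Rightarrow> nat \<Rightarrow> bool \<Rightarrow> (nat set \<times> nat set) set" where
  "tab_codes N l b = {(V, S). V \<subseteq> {2..N} \<and> card V = of_bool b \<and> S \<subseteq> {2..N} - V \<and> card S = l \<and>
     (\<forall>v\<in>V. (\<exists>x\<in>S. x < v) \<and> (\<exists>x\<in>{2..N} - S - V. x < v))}"

locale near_hook_shape =
  fixes lam :: "nat multiset" and a l N :: nat and b :: bool
  assumes diagram: "young_diagram lam = diag a l b"
    and size: "sum_mset lam = N"
    and N: "N = a + l + of_bool b"
    and a1: "a \<ge> 1" and b2: "b \<Longrightarrow> a \<ge> 2 \<and> l \<ge> 1"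
begin

lemma SYT_iff: "T \<in> SYT lam \<longleftrightarrow> T \<in> extensional (diag a l b) \<and> bij_betw T (diag a l b) {1..N} \<and>
   (\<forall>c c'. c < c' \<and> c' < a \<longrightarrow> T (0, c) < T (0, c')) \<and>
   (\<forall>r r'. r < r' \<and> r' \<le> l \<longrightarrow> T (r, 0) < T (r', 0)) \<and>
   (b \<longrightarrow> T (1, 0) < T (1, 1) \<and> T (0, 1) < T (1, 1))"
proof -
  have r: "(\<forall>r c c'. (r, c) \<in> diag a l b \<and> (r, c') \<in> diag a l b \<and> c < c' \<longrightarrow> T (r, c) < T (r, c')) \<longleftrightarrow>
      (\<forall>c c'. c < c' \<and> c' < a \<longrightarrow> T (0, c) < T (0, c')) \<and> (b \<longrightarrow> T (1, 0) < T (1, 1))" (is "?L \<longleftrightarrow> ?R")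
  proof
    assume L: ?L
    have "T (0, c) < T (0, c')" if "c < c'" "c' < a" for c c'
      using L[rule_format, of 0 c c'] that by (simp add: diag_def)
    moreover have "T (1, 0) < T (1, 1)" if b
      using L[rule_format, of 1 0 1] that b2 by (simp add: diag_def)
    ultimately show ?R by blast
  next
    assume ?R
    thus ?L by (auto simp: diag_def)
  qed
  have c: "(\<forall>r r' c. (r, c) \<in> diag a l b \<and> (r', c) \<in> diag a l b \<and> r < r' \<longrightarrow> T (r, c) < T (r', c)) \<longleftrightarrow>
      (\<forall>r r'. r < r' \<and> r' \<le> l \<longrightarrow> T (r, 0) < T (r', 0)) \<and> (b \<longrightarrow> T (0, 1) < T (1, 1))" (is "?L \<longleftrightarrow> ?R")
  proof
    assume L: ?L
    have "T (r, 0) < T (r', 0)" if "r < r'" "r' \<le> l" for r r'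
      using L[rule_format, of r 0 r'] that a1 by (cases "r = 0") (auto simp: diag_def)
    moreover have "T (0, 1) < T (1, 1)" if b
      using L[rule_format, of 0 1 1] that b2 by (simp add: diag_def)
    ultimately show ?R by blast
  next
    assume ?R
    thus ?L by (auto simp: diag_def)
  qed
  show ?thesis unfolding SYT_def mem_Collect_eq diagram size r c by blast
qed

lemma SYT_box:
  assumes T: "T \<in> SYT lam"
  shows tab_arm_mono: "\<And>c c'. c < c' \<Longrightarrow> c' < a \<Longrightarrow> T (0, c) < T (0, c')"
    and tab_leg_mono: "\<And>r r'. r < r' \<Longrightarrow> r' \<le> l \<Longrightarrow> T (r, 0) < T (r', 0)"
    and tab_range: "\<And>q. q \<in> diag a l b \<Longrightarrow> T q \<in> {1..N}"
    and tab_inj: "\<And>q q'. q \<in> diag a l b \<Longrightarrow> q' \<in> diag a l b \<Longrightarrow> T q = T q' \<Longrightarrow> q = q'"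
    and tab_surj: "\<And>j. j \<in> {1..N} \<Longrightarrow> \<exists>q\<in>diag a l b. T q = j"
    and tab_inner_gt: "b \<Longrightarrow> T (1, 0) < T (1, 1) \<and> T (0, 1) < T (1, 1)"
proof -
  note E = T[unfolded SYT_iff]
  have bij: "bij_betw T (diag a l b) {1..N}" using E by blast
  show "\<And>c c'. c < c' \<Longrightarrow> c' < a \<Longrightarrow> T (0, c) < T (0, c')" using E by blast
  show "\<And>r r'. r < r' \<Longrightarrow> r' \<le> l \<Longrightarrow> T (r, 0) < T (r', 0)" using E by blast
  show "b \<Longrightarrow> T (1, 0) < T (1, 1) \<and> T (0, 1) < T (1, 1)" using E by blast
  show "T q \<in> {1..N}" if "q \<in> diag a l b" for q using bij_betwE[OF bij] that by blast
  show "q = q'" if "q \<in> diag a l b" "q' \<in> diag a l b" "T q = T q'" for q q'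
    using inj_onD[OF bij_betw_imp_inj_on[OF bij]] that by blast
  show "\<exists>q\<in>diag a l b. T q = j" if "j \<in> {1..N}" for j
    using bij_betw_imp_surj_on[OF bij] that by (metis imageE)
qed

lemma tab_corner: "T \<in> SYT lam \<Longrightarrow> T (0, 0) = 1"
proof -
  assume T: "T \<in> SYT lam"
  have "(0, 0) \<in> diag a l b" using a1 by (simp add: diag_def)
  hence ge: "T (0, 0) \<in> {1..N}" by (rule tab_range[OF T])
  hence "1 \<in> {1..N}" by simp
  then obtain q where q: "q \<in> diag a l b" "T q = 1" using tab_surj[OF T] by blast
  obtain r c where rc: "q = (r, c)" by (cases q)
  consider "r = 0" "c < a" | "c = 0" "1 \<le> r" "r \<le> l" | "b" "r = 1" "c = 1"
    using q rc by (auto simp: diag_def)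
  thus ?thesis
  proof cases
    case 1
    have "c = 0" using tab_arm_mono[OF T, of 0 c] 1 q rc ge by (cases "c = 0") auto
    thus ?thesis using 1 q rc by simp
  next
    case 2
    hence "T (0, 0) < 1" using tab_leg_mono[OF T, of 0 r] q rc by simp
    thus ?thesis using ge by simp
  next
    case 3
    hence "T (1, 0) < 1" using tab_inner_gt[OF T] q rc by simp
    moreover have "(1, 0) \<in> diag a l b" using 3 b2 by (simp add: diag_def)
    hence "T (1, 0) \<in> {1..N}" by (rule tab_range[OF T])
    ultimately show ?thesis by simp
  qed
qed

lemma tab_arm_eq:
  assumes T: "T \<in> SYT lam"
  shows "(\<lambda>c. T (0, c)) ` {..<a} = {1..N} - tab_leg l T - tab_inner b T"
proof (intro set_eqI iffI)
  fix x assume "x \<in> (\<lambda>c. T (0, c)) ` {..<a}"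
  then obtain c where c: "c < a" "x = T (0, c)" by auto
  have in0: "(0, c) \<in> diag a l b" using c by (simp add: diag_def)
  have "x \<noteq> T (r, 0)" if "r \<in> {1..l}" for r
    using tab_inj[OF T in0, of "(r, 0)"] that c by (auto simp: diag_def)
  moreover have "b \<Longrightarrow> x \<noteq> T (1, 1)"
    using tab_inj[OF T in0, of "(1, 1)"] c by (auto simp: diag_def)
  ultimately have "x \<notin> tab_leg l T" "x \<notin> tab_inner b T"
    unfolding tab_leg_def tab_inner_def by (blast, simp)
  thus "x \<in> {1..N} - tab_leg l T - tab_inner b T"
    using tab_range[OF T in0] c by simp
next
  fix x assume x: "x \<in> {1..N} - tab_leg l T - tab_inner b T"
  then obtain r c where q: "(r, c) \<in> diag a l b" "T (r, c) = x" using tab_surj[OF T, of x] by auto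
  hence "r = 0 \<and> c < a" using x by (auto simp: diag_def tab_leg_def tab_inner_def)
  thus "x \<in> (\<lambda>c. T (0, c)) ` {..<a}" using q by auto
qed

lemma tab_code_in:
  assumes T: "T \<in> SYT lam"
  shows "(tab_inner b T, tab_leg l T) \<in> tab_codes N l b"
proof -
  have c00: "(0, 0) \<in> diag a l b" using a1 by (simp add: diag_def)
  have ge2: "T q \<in> {2..N}" if "q \<in> diag a l b" "q \<noteq> (0, 0)" for q
    using tab_range[OF T that(1)] tab_inj[OF T that(1) c00] tab_corner[OF T] that(2) by fastforce
  have V: "tab_inner b T \<subseteq> {2..N}"
    using ge2[of "(1, 1)"] by (auto simp: tab_inner_def diag_def)
  have "T (r, 0) \<in> {2..N}" if "r \<in> {1..l}" for r using that ge2[of "(r, 0)"] by (auto simp: diag_def)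
  moreover have "T (r, 0) \<notin> tab_inner b T" if "r \<in> {1..l}" for r
    using that tab_inj[OF T, of "(r, 0)" "(1, 1)"] by (auto simp: diag_def tab_inner_def)
  ultimately have S: "tab_leg l T \<subseteq> {2..N} - tab_inner b T" by (auto simp: tab_leg_def)
  have "inj_on (\<lambda>r. T (r, 0)) {1..l}"
  proof (rule inj_onI)
    fix r r' assume "r \<in> {1..l}" "r' \<in> {1..l}" "T (r, 0) = T (r', 0)"
    thus "r = r'" using tab_inj[OF T, of "(r, 0)" "(r', 0)"] by (auto simp: diag_def)
  qed
  hence cS: "card (tab_leg l T) = l" by (simp add: tab_leg_def card_image)
  have "(\<exists>x\<in>tab_leg l T. x < v) \<and> (\<exists>x\<in>{2..N} - tab_leg l T - tab_inner b T. x < v)"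
    if v: "v \<in> tab_inner b T" for v
  proof
    have b: b and v: "v = T (1, 1)" using v by (auto simp: tab_inner_def split: if_splits)
    show "\<exists>x\<in>tab_leg l T. x < v"
      using tab_inner_gt[OF T b] b2[OF b] v by (auto simp: tab_leg_def)
    have "T (0, 1) \<in> (\<lambda>c. T (0, c)) ` {..<a}" using b2[OF b] by auto
    moreover have "T (0, 1) \<in> {2..N}" using ge2[of "(0, 1)"] b2[OF b] by (simp add: diag_def)
    ultimately have "T (0, 1) \<in> {2..N} - tab_leg l T - tab_inner b T" unfolding tab_arm_eq[OF T] by simp
    thus "\<exists>x\<in>{2..N} - tab_leg l T - tab_inner b T. x < v" using tab_inner_gt[OF T b] v by blast
  qed
  thus ?thesis using V S cS by (auto simp: tab_codes_def tab_inner_def)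
qed

lemma tab_code_inj:
  assumes T: "T \<in> SYT lam" and T': "T' \<in> SYT lam"
    and eq: "tab_inner b T = tab_inner b T'" "tab_leg l T = tab_leg l T'"
  shows "T = T'"
proof (rule extensionalityI)
  show "T \<in> extensional (diag a l b)" "T' \<in> extensional (diag a l b)"
    using T T' by (auto simp: SYT_iff)
  fix q assume q: "q \<in> diag a l b"
  obtain r c where rc: "q = (r, c)" by (cases q)
  consider "r = 0" "c < a" | "c = 0" "1 \<le> r" "r \<le> l" | "b" "r = 1" "c = 1"
    using q rc by (auto simp: diag_def)
  thus "T q = T' q"
  proof cases
    case 1
    have "T (0, c) = T' (0, c)"
      by (rule increasing_unique[of a "\<lambda>c. T (0, c)" "\<lambda>c. T' (0, c)" c])
         (auto simp: tab_arm_mono[OF T] tab_arm_mono[OF T'] tab_arm_eq[OF T] tab_arm_eq[OF T'] eq 1)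
    thus ?thesis using rc 1 by simp
  next
    case 2
    have im: "(\<lambda>i. T (Suc i, 0)) ` {..<l} = tab_leg l T" for T :: "nat \<times> nat \<Rightarrow> nat"
    proof -
      have "{1..l} = Suc ` {..<l}" by (simp add: image_Suc_lessThan)
      thus ?thesis by (simp add: tab_leg_def image_image)
    qed
    have "T (Suc (r - 1), 0) = T' (Suc (r - 1), 0)"
      using 2 by (intro increasing_unique[of l "\<lambda>i. T (Suc i, 0)" "\<lambda>i. T' (Suc i, 0)" "r - 1"])
         (auto simp: tab_leg_mono[OF T] tab_leg_mono[OF T'] im eq)
    thus ?thesis using rc 2 by simp
  next
    case 3
    thus ?thesis using eq(1) rc by (simp add: tab_inner_def)
  qed
qed

lemma diag_eq:
  "diag a l b = (Pair 0 ` {..<a} \<union> (\<lambda>r. (r, 0)) ` {1..l}) \<union> (if b then {(1, 1)} else {})"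
  by (auto simp: diag_def)

lemma card_diag: "card (diag a l b) = N"
proof -
  have "card (Pair 0 ` {..<a} \<union> (\<lambda>r. (r, 0::nat)) ` {1..l}) = a + l"
    by (subst card_Un_disjoint) (auto simp: card_image inj_on_def)
  moreover have "(1, 1) \<notin> Pair 0 ` {..<a} \<union> (\<lambda>r. (r, 0)) ` {1..l}" by auto
  ultimately show ?thesis using N unfolding diag_eq by (auto simp: card_insert_if)
qed

lemma finite_diag: "finite (diag a l b)"
  using card_diag N a1 card.infinite by fastforce

text \<open>Arm and leg are filled in increasing order. The corner receives 1, since V and S only
  contain numbers from 2 on.\<close>

lemma tab_code_surj:
  assumes "(V, S) \<in> tab_codes N l b"
  obtains T where "T \<in> SYT lam" "tab_inner b T = V" "tab_leg l T = S"
proof -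
  have V: "V \<subseteq> {2..N}" "card V = of_bool b" and S: "S \<subseteq> {2..N} - V" "card S = l"
    and lt: "\<And>v. v \<in> V \<Longrightarrow> \<exists>x\<in>S. x < v" "\<And>v. v \<in> V \<Longrightarrow> \<exists>x\<in>{2..N} - S - V. x < v"
    using assms by (auto simp: tab_codes_def)
  have finV: "finite V" and finS: "finite S" using V S finite_subset by blast+
  define A where "A = {1..N} - S - V"
  define xs where "xs = sorted_list_of_set A"
  define ys where "ys = sorted_list_of_set S"
  define v where "v = the_elem V"
  have Vv: "V = (if b then {v} else {})"
    using V finV by (cases b) (auto simp: v_def card_1_singleton_iff)
  have "card (S \<union> V) = l + of_bool b" using S V finV finS by (subst card_Un_disjoint) auto
  moreover have "S \<union> V \<subseteq> {1..N}" using S V by auto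
  ultimately have "card ({1..N} - (S \<union> V)) = a"
    using N by (subst card_Diff_subset) (auto simp: finS finV)
  hence cA: "card A = a" by (simp add: A_def Diff_eq Int_assoc)
  have xs: "set xs = A" "length xs = a" "sorted_wrt (<) xs"
    using cA by (auto simp: xs_def A_def strict_sorted_list_of_set)
  have ys: "set ys = S" "length ys = l" "sorted_wrt (<) ys"
    using S finS by (auto simp: ys_def strict_sorted_list_of_set)
  have xm: "xs ! i < xs ! j" if "i < j" "j < a" for i j
    using sorted_wrt_nth_less[OF xs(3)] that xs(2) by simp
  have ym: "ys ! i < ys ! j" if "i < j" "j < l" for i j
    using sorted_wrt_nth_less[OF ys(3)] that ys(2) by simp
  have x0: "xs ! 0 = 1"
  proof -
    have "1 \<in> A" using S V N a1 by (auto simp: A_def)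
    then obtain c where c: "c < a" "xs ! c = 1" using xs by (metis in_set_conv_nth)
    have "xs ! 0 \<in> A" using xs a1 by (metis less_le_trans nth_mem zero_less_one)
    hence "xs ! 0 \<ge> 1" by (auto simp: A_def)
    thus ?thesis using xm[of 0 c] c by (cases "c = 0") auto
  qed
  define T where "T = restrict (\<lambda>(r, c). if r = 0 then xs ! c else if c = 0 then ys ! (r - 1) else v) (diag a l b)"
  have T0: "T (0, c) = xs ! c" if "c < a" for c using that by (simp add: T_def diag_def)
  have T1: "T (r, 0) = ys ! (r - 1)" if "1 \<le> r" "r \<le> l" for r using that by (simp add: T_def diag_def)
  have T2: "T (1, 1) = v" if b using that by (simp add: T_def diag_def)
  have leg: "tab_leg l T = S"
  proof -
    have "tab_leg l T = (\<lambda>r. ys ! (r - 1)) ` {1..l}" unfolding tab_leg_def using T1 by (intro image_cong) auto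
    also have "{1..l} = Suc ` {..<l}" by (simp add: image_Suc_lessThan)
    also have "(\<lambda>r. ys ! (r - 1)) ` (Suc ` {..<l}) = (!) ys ` {..<l}" by (simp add: image_image)
    also have "\<dots> = set ys" using ys(2) by (auto simp: set_conv_nth)
    finally show ?thesis using ys(1) by simp
  qed
  have inner: "tab_inner b T = V" using T2 Vv by (simp add: tab_inner_def)
  have arm: "(\<lambda>c. T (0, c)) ` {..<a} = A"
  proof -
    have "(\<lambda>c. T (0, c)) ` {..<a} = (!) xs ` {..<a}" using T0 by (intro image_cong) auto
    also have "\<dots> = set xs" using xs(2) by (auto simp: set_conv_nth)
    finally show ?thesis using xs(1) by simp
  qed
  have "T ` diag a l b = (\<lambda>c. T (0, c)) ` {..<a} \<union> tab_leg l T \<union> tab_inner b T"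
    unfolding diag_eq image_Un image_image tab_leg_def tab_inner_def by simp
  also have "\<dots> = {1..N}" using S V by (auto simp: arm leg inner A_def)
  finally have im: "T ` diag a l b = {1..N}" .
  hence "inj_on T (diag a l b)" by (intro eq_card_imp_inj_on finite_diag) (simp add: card_diag)
  hence bij: "bij_betw T (diag a l b) {1..N}" using im by (simp add: bij_betw_def)
  have "T \<in> SYT lam" unfolding SYT_iff
  proof (intro conjI allI impI bij)
    show "T \<in> extensional (diag a l b)" by (simp add: T_def)
    show "T (0, c) < T (0, c')" if "c < c' \<and> c' < a" for c c'
      using that xm[of c c'] by (simp add: T0)
    show "T (r, 0) < T (r', 0)" if rr: "r < r' \<and> r' \<le> l" for r r'
    proof (cases "r = 0")
      case True
      have "r' - 1 < length ys" using rr ys(2) by linarith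
      hence "ys ! (r' - 1) \<in> S" using nth_mem ys(1) by blast
      hence "ys ! (r' - 1) \<ge> 2" using S by auto
      thus ?thesis using True rr x0 a1 by (simp add: T0 T1)
    next
      case False
      hence "r - 1 < r' - 1" "r' - 1 < l" using rr by linarith+
      thus ?thesis using False rr ym[of "r - 1" "r' - 1"] by (simp add: T1)
    qed
  next
    assume b: b
    hence v: "v \<in> V" using Vv by simp
    obtain x where x: "x \<in> S" "x < v" using lt(1)[OF v] by blast
    then obtain i where i: "i < l" "ys ! i = x" using ys by (metis in_set_conv_nth)
    \<comment> \<open>Only the neighbours of the inner box matter: \<open>ys ! 0\<close> is the
      least leg entry and \<open>xs ! 1\<close> the least arm entry after the corner.\<close>
    have "ys ! 0 \<le> ys ! i" using ym[of 0 i] i by (cases "i = 0") auto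
    thus "T (1, 0) < T (1, 1)" using x i T1[of 1] T2[OF b] by simp
    obtain y where y: "y \<in> {2..N} - S - V" "y < v" using lt(2)[OF v] by blast
    hence "y \<in> A" by (auto simp: A_def)
    then obtain j where j: "j < a" "xs ! j = y" using xs by (metis in_set_conv_nth)
    have j0: "j \<noteq> 0" using j y x0 by (cases "j = 0") auto
    have "xs ! 1 \<le> xs ! j" using xm[of 1 j] j j0 by (cases "j = 1") auto
    thus "T (0, 1) < T (1, 1)" using y j j0 T0[of 1] T2[OF b] by simp
  qed
  thus ?thesis using that leg inner by blast
qed

lemma tab_code_bij: "bij_betw (\<lambda>T. (tab_inner b T, tab_leg l T)) (SYT lam) (tab_codes N l b)"
  unfolding bij_betw_def
proof
  show "inj_on (\<lambda>T. (tab_inner b T, tab_leg l T)) (SYT lam)"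
    using tab_code_inj by (auto intro: inj_onI)
  show "(\<lambda>T. (tab_inner b T, tab_leg l T)) ` SYT lam = tab_codes N l b"
  proof
    show "(\<lambda>T. (tab_inner b T, tab_leg l T)) ` SYT lam \<subseteq> tab_codes N l b"
      using tab_code_in by auto
    show "tab_codes N l b \<subseteq> (\<lambda>T. (tab_inner b T, tab_leg l T)) ` SYT lam"
    proof
      fix q assume q: "q \<in> tab_codes N l b"
      obtain V S where VS: "q = (V, S)" by (cases q)
      obtain T where "T \<in> SYT lam" "tab_inner b T = V" "tab_leg l T = S"
        using tab_code_surj q VS by blast
      thus "q \<in> (\<lambda>T. (tab_inner b T, tab_leg l T)) ` SYT lam" using VS by blast
    qed
  qed
qed

lemma box_content_box:
  assumes T: "T \<in> SYT lam" and rc: "(r, c) \<in> diag a l b"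
  shows "box_content lam T (T (r, c)) = int c - int r"
proof -
  have "inj_on T (diag a l b)" using T by (auto simp: SYT_iff bij_betw_def)
  hence "the_inv_into (diag a l b) T (T (r, c)) = (r, c)" using rc by (rule the_inv_into_f_f)
  thus ?thesis by (simp add: box_content_def diagram)
qed

text \<open>The column or row of j is found by counting smaller entries in the arm or leg. The
  hypothesis on the inner entry is essential: \<open>leg_content\<close> counts everything outside
  the leg as arm, so a smaller inner entry would falsify the count.\<close>

lemma box_content_leg_content:
  assumes T: "T \<in> SYT lam" and j: "j \<in> {1..N}" and v: "\<And>v. v \<in> tab_inner b T \<Longrightarrow> j < v"
  shows "of_int (box_content lam T j) = leg_content (tab_leg l T) j"
proof -
  let ?S = "tab_leg l T"
  have code: "?S \<subseteq> {2..N} - tab_inner b T" using tab_code_in[OF T] by (simp add: tab_codes_def)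
  obtain r c where q: "(r, c) \<in> diag a l b" "T (r, c) = j" using tab_surj[OF T j] by auto
  have ct: "box_content lam T j = int c - int r" using box_content_box[OF T q(1)] q(2) by simp
  consider "r = 0" "c < a" | "c = 0" "1 \<le> r" "r \<le> l" | "b" "r = 1" "c = 1"
    using q by (auto simp: diag_def)
  thus ?thesis
  proof cases
    case 1
    have "card {x \<in> (\<lambda>c. T (0, c)) ` {..<a}. x < T (0, c)} = c"
      by (rule card_image_below[of a "\<lambda>c. T (0, c)" c]) (auto simp: tab_arm_mono[OF T] 1)
    moreover have "{x \<in> (\<lambda>c. T (0, c)) ` {..<a}. x < T (0, c)} = {1..j - 1} - (?S \<inter> {2..j - 1})"
      unfolding tab_arm_eq[OF T] using q 1 j v code by (force simp: subset_iff)
    ultimately have "card ({1..j - 1} - (?S \<inter> {2..j - 1})) = c" by simp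
    hence cj: "j - 1 - legs ?S (j - 1) = c" by (subst (asm) card_Diff_subset) auto
    have "j \<notin> ?S" using tab_arm_eq[OF T] 1 q by blast
    have "legs ?S (j - 1) \<le> card {2..j - 1}" by (rule card_mono) auto
    hence le: "legs ?S (j - 1) \<le> j - 1" by simp
    show ?thesis
    proof (cases "j = 1")
      case True
      thus ?thesis using cj ct 1 by (simp add: leg_content_def)
    next
      case False
      have "int c = int (j - 1) - int (legs ?S (j - 1))" using cj le by linarith
      thus ?thesis using False \<open>j \<notin> ?S\<close> ct 1 by (simp add: leg_content_def arm_def)
    qed
  next
    case 2
    have im: "(\<lambda>i. T (Suc i, 0)) ` {..<l} = ?S"
    proof -
      have "{1..l} = Suc ` {..<l}" by (simp add: image_Suc_lessThan)
      thus ?thesis by (simp add: tab_leg_def image_image)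
    qed
    have jT: "T (Suc (r - 1), 0) = j" using 2 q by simp
    have "card {x \<in> (\<lambda>i. T (Suc i, 0)) ` {..<l}. x < T (Suc (r - 1), 0)} = r - 1"
      using 2 by (intro card_image_below[of l "\<lambda>i. T (Suc i, 0)" "r - 1"]) (auto simp: tab_leg_mono[OF T])
    hence "card {x \<in> ?S. x < j} = r - 1" unfolding im jT .
    moreover have "{x \<in> ?S. x < j} = ?S \<inter> {2..j - 1}" using code by auto
    ultimately have k: "legs ?S (j - 1) = r - 1" by simp
    have jS: "j \<in> ?S" using 2 q by (auto simp: tab_leg_def)
    hence "j \<noteq> 1" using code by auto
    thus ?thesis using jS k ct 2 by (simp add: leg_content_def leg_def of_nat_diff)
  next
    case 3
    hence "T (1, 1) \<in> tab_inner b T" by (simp add: tab_inner_def)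
    thus ?thesis using v[of "T (1, 1)"] 3 q by simp
  qed
qed

end

section \<open>The two families of shapes and their numbers of tableaux\<close>

lemma row_lengths_eqI: "sorted xs \<Longrightarrow> mset xs = lam \<Longrightarrow> row_lengths lam = rev xs"
  unfolding row_lengths_def by (metis sorted_list_of_multiset_mset sorted_sort_id)

lemma row_lengths_hook: "a \<ge> 1 \<Longrightarrow> row_lengths (hook a k) = a # replicate k 1"
proof -
  assume "a \<ge> 1"
  hence "row_lengths (hook a k) = rev (replicate k 1 @ [a])"
    by (intro row_lengths_eqI) (auto simp: hook_def sorted_append)
  thus ?thesis by simp
qed

lemma row_lengths_near_hook: "a \<ge> 2 \<Longrightarrow> row_lengths (near_hook a k) = a # 2 # replicate k 1"
proof -
  assume "a \<ge> 2"
  hence "row_lengths (near_hook a k) = rev (replicate k 1 @ [2, a])"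
    by (intro row_lengths_eqI) (auto simp: near_hook_def sorted_append)
  thus ?thesis by simp
qed

lemma hook_shape: "a \<ge> 1 \<Longrightarrow> near_hook_shape (hook a k) a k (a + k) False"
proof
  assume a: "a \<ge> 1"
  show "young_diagram (hook a k) = diag a k False"
    unfolding young_diagram_def row_lengths_hook[OF a] diag_def
    by (auto simp: nth_Cons' less_Suc_eq_le split: if_splits)
  show "sum_mset (hook a k) = a + k" by (simp add: hook_def)
qed auto

lemma near_hook_shape: "a \<ge> 2 \<Longrightarrow> near_hook_shape (near_hook a k) a (Suc k) (a + k + 2) True"
proof
  assume a: "a \<ge> 2"
  show "young_diagram (near_hook a k) = diag a (Suc k) True"
    unfolding young_diagram_def row_lengths_near_hook[OF a] diag_def
    by (auto simp: nth_Cons' less_Suc_eq_le split: if_splits)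
  show "sum_mset (near_hook a k) = a + k + 2" by (simp add: near_hook_def)
qed auto

lemma tab_codes_hook: "tab_codes N l False = Pair {} ` leg_sets N l"
proof -
  have "(V, S) \<in> tab_codes N l False \<longleftrightarrow> V = {} \<and> S \<in> leg_sets N l" for V S
  proof
    assume h: "(V, S) \<in> tab_codes N l False"
    hence "finite V" by (auto simp: tab_codes_def intro: finite_subset)
    thus "V = {} \<and> S \<in> leg_sets N l" using h by (auto simp: tab_codes_def leg_sets_def)
  qed (auto simp: tab_codes_def leg_sets_def)
  thus ?thesis by auto
qed

lemma hook_leg_bij:
  assumes "a \<ge> 1"
  shows "bij_betw (tab_leg k) (SYT (hook a k)) (leg_sets (a + k) k)"
proof -
  interpret near_hook_shape "hook a k" a k "a + k" False by (rule hook_shape[OF assms])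
  have "bij_betw (\<lambda>T. ({} :: nat set, tab_leg k T)) (SYT (hook a k)) (Pair {} ` leg_sets (a + k) k)"
    using tab_code_bij by (simp add: tab_inner_def tab_codes_hook)
  hence "bij_betw (snd \<circ> (\<lambda>T. ({}::nat set, tab_leg k T))) (SYT (hook a k)) (leg_sets (a + k) k)"
    by (rule bij_betw_trans) (auto simp: bij_betw_def inj_on_def image_image)
  thus ?thesis by (simp add: o_def)
qed

lemma num_SYT_hook: "a \<ge> 1 \<Longrightarrow> num_SYT (hook a k) = (a + k - 1) choose k"
  unfolding num_SYT_def using bij_betw_same_card[OF hook_leg_bij] card_leg_sets by metis

text \<open>For each inner entry v, all sets of size l avoiding v are counted, and those with no
  smaller leg entry (\<open>B1\<close>) or no smaller arm entry (\<open>B2\<close>) are removed.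
  Summing over v uses the hockey-stick identity. The additive form avoids subtraction of natural
  numbers.\<close>

lemma card_near_codes:
  assumes N: "N \<ge> 3" and l: "l + 2 \<le> N"
  shows "card (tab_codes N l True) + ((N - 2) choose Suc l) + ((N - 2) choose (N - 1 - l))
    = (N - 2) * ((N - 2) choose l)"
proof -
  let ?R = "\<lambda>v. {2..N} - {v}"
  define U where "U = (\<lambda>v. {S. S \<subseteq> ?R v \<and> card S = l})"
  define B1 where "B1 = (\<lambda>v. {S. S \<subseteq> {v + 1..N} \<and> card S = l})"
  define B2 where "B2 = (\<lambda>v. {S. S \<subseteq> ?R v \<and> card S = l \<and> {2..v - 1} \<subseteq> S})"
  define G where "G = (\<lambda>v. {S. S \<subseteq> ?R v \<and> card S = l \<and> (\<exists>x\<in>S. x < v) \<and> (\<exists>x\<in>?R v - S. x < v)})"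
  have codes: "tab_codes N l True = (\<Union>v\<in>{2..N}. Pair {v} ` G v)"
  proof (intro set_eqI iffI)
    fix q assume q: "q \<in> tab_codes N l True"
    obtain V S where VS: "q = (V, S)" by (cases q)
    have "card V = 1" using q VS by (auto simp: tab_codes_def)
    then obtain v where v: "V = {v}" by (auto simp: card_1_singleton_iff)
    have "{2..N} - S - {v} = ?R v - S" by auto
    hence "S \<in> G v" "v \<in> {2..N}" using q VS v by (auto simp: tab_codes_def G_def)
    thus "q \<in> (\<Union>v\<in>{2..N}. Pair {v} ` G v)" using VS v by blast
  next
    fix q assume "q \<in> (\<Union>v\<in>{2..N}. Pair {v} ` G v)"
    then obtain v S where v: "v \<in> {2..N}" "S \<in> G v" "q = ({v}, S)" by blast
    have "{2..N} - S - {v} = ?R v - S" by auto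
    thus "q \<in> tab_codes N l True" using v by (auto simp: tab_codes_def G_def)
  qed
  have finG: "finite (G v)" for v
    by (rule finite_subset[of _ "Pow {2..N}"]) (auto simp: G_def)
  have "card (tab_codes N l True) = (\<Sum>v\<in>{2..N}. card (Pair {v} ` G v))"
    unfolding codes by (rule card_UN_disjoint) (auto simp: finG)
  also have "\<dots> = (\<Sum>v\<in>{2..N}. card (G v))"
    by (rule sum.cong) (auto simp: card_image inj_on_def)
  also have "{2..N} = insert 2 {3..N}" using N by auto
  \<comment> \<open>2 cannot be the inner entry, because no leg entry is smaller.\<close>
  also have "(\<Sum>v\<in>insert 2 {3..N}. card (G v)) = (\<Sum>v\<in>{3..N}. card (G v))"
  proof -
    have "G 2 = {}" by (auto simp: G_def)
    thus ?thesis by simp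
  qed
  finally have cG: "card (tab_codes N l True) = (\<Sum>v\<in>{3..N}. card (G v))" .
  have each: "card (G v) + ((N - v) choose l) + ((N - v) choose (N - 2 - l)) = (N - 2) choose l"
    if v: "v \<in> {3..N}" for v
  proof -
    have cR: "card (?R v) = N - 2" using v by simp
    have cU: "card (U v) = (N - 2) choose l"
      unfolding U_def using n_subsets[of "?R v" l] cR by simp
    have cB1: "card (B1 v) = (N - v) choose l"
      unfolding B1_def using n_subsets[of "{v + 1..N}" l] by simp
    \<comment> \<open>The complement of S consists of the arm entries other than 1; passing to it
      exchanges the conditions of \<open>B2\<close> and \<open>B1\<close>.\<close>
    have "bij_betw (\<lambda>S. ?R v - S) (B2 v) {S. S \<subseteq> {v + 1..N} \<and> card S = N - 2 - l}"
    proof (rule bij_betwI[where g="\<lambda>S. ?R v - S"])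
      show "(\<lambda>S. ?R v - S) \<in> B2 v \<rightarrow> {S. S \<subseteq> {v + 1..N} \<and> card S = N - 2 - l}"
      proof
        fix S assume S: "S \<in> B2 v"
        hence "finite S" by (auto simp: B2_def intro: finite_subset)
        hence "card (?R v - S) = N - 2 - l"
          using S cR by (subst card_Diff_subset) (auto simp: B2_def)
        moreover have "?R v - S \<subseteq> {v + 1..N}"
        proof
          fix x assume x: "x \<in> ?R v - S"
          hence "x \<notin> {2..v - 1}" using S by (auto simp: B2_def)
          thus "x \<in> {v + 1..N}" using x by auto
        qed
        ultimately show "?R v - S \<in> {S. S \<subseteq> {v + 1..N} \<and> card S = N - 2 - l}" by blast
      qed
      show "(\<lambda>S. ?R v - S) \<in> {S. S \<subseteq> {v + 1..N} \<and> card S = N - 2 - l} \<rightarrow> B2 v"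
      proof
        fix S assume "S \<in> {S. S \<subseteq> {v + 1..N} \<and> card S = N - 2 - l}"
        hence S: "S \<subseteq> {v + 1..N}" "card S = N - 2 - l" by auto
        have sub: "S \<subseteq> ?R v" using S(1) v by auto
        have "finite S" using S finite_subset by blast
        hence "card (?R v - S) = (N - 2) - (N - 2 - l)"
          using sub S(2) cR by (subst card_Diff_subset) auto
        hence "card (?R v - S) = l" using l by linarith
        moreover have "{2..v - 1} \<subseteq> ?R v - S"
        proof
          fix x assume x: "x \<in> {2..v - 1}"
          hence "x \<notin> {v + 1..N}" by auto
          hence "x \<notin> S" using S(1) by blast
          thus "x \<in> ?R v - S" using x v by auto
        qed
        ultimately show "?R v - S \<in> B2 v" by (simp only: B2_def mem_Collect_eq) blast
      qed
    qed (use v in \<open>auto simp: B2_def\<close>)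
    hence "card (B2 v) = card {S. S \<subseteq> {v + 1..N} \<and> card S = N - 2 - l}" by (rule bij_betw_same_card)
    hence cB2: "card (B2 v) = (N - v) choose (N - 2 - l)"
      using n_subsets[of "{v + 1..N}" "N - 2 - l"] by simp
    have fin: "finite (B1 v)" "finite (B2 v)"
      by (rule finite_subset[of _ "Pow {2..N}"], use v in \<open>auto simp: B1_def B2_def\<close>)+
    have U: "U v = G v \<union> B1 v \<union> B2 v"
    proof (intro set_eqI iffI)
      fix S assume S: "S \<in> U v"
      have "S \<in> B1 v" if h: "\<not> (\<exists>x\<in>S. x < v)"
      proof -
        have "x \<in> {v + 1..N}" if "x \<in> S" for x
        proof -
          have "x \<in> {2..N}" "x \<noteq> v" "\<not> x < v" using that S h by (auto simp: U_def)
          thus ?thesis by auto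
        qed
        thus ?thesis using S by (auto simp: B1_def U_def)
      qed
      moreover have "S \<in> B2 v" if h: "\<not> (\<exists>x\<in>?R v - S. x < v)"
      proof -
        have "x \<in> S" if "x \<in> {2..v - 1}" for x
        proof -
          have "x < v" "x \<in> ?R v" using that v by auto
          thus ?thesis using h by blast
        qed
        thus ?thesis using S by (auto simp: B2_def U_def)
      qed
      moreover have "S \<in> G v" if "\<exists>x\<in>S. x < v" "\<exists>x\<in>?R v - S. x < v"
        using that S unfolding G_def U_def by blast
      ultimately show "S \<in> G v \<union> B1 v \<union> B2 v" by blast
    next
      fix S assume "S \<in> G v \<union> B1 v \<union> B2 v"
      moreover have "{v + 1..N} \<subseteq> ?R v" using v by auto
      ultimately show "S \<in> U v" unfolding U_def G_def B1_def B2_def by blast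
    qed
    \<comment> \<open>As v is at least 3, the entry 2 is smaller than v and lies in the leg or in
      the arm; so the two bad cases exclude each other.\<close>
    have "2 \<in> {2..v - 1}" using v by auto
    hence "B1 v \<inter> B2 v = {}" unfolding B1_def B2_def using v by fastforce
    moreover have "G v \<inter> B1 v = {}" unfolding G_def B1_def by fastforce
    moreover have "G v \<inter> B2 v = {}"
    proof -
      have "x \<in> {2..v - 1}" if "x \<in> ?R v" "x < v" for x using that by auto
      thus ?thesis unfolding G_def B2_def by blast
    qed
    ultimately have "card (U v) = card (G v) + card (B1 v) + card (B2 v)"
      unfolding U using finG fin by (subst card_Un_disjoint; (subst card_Un_disjoint)?) auto
    thus ?thesis using cU cB1 cB2 by simp
  qed
  have hockey: "(\<Sum>v\<in>{3..N}. (N - v) choose j) = (N - 2) choose Suc j" for j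
  proof -
    have "(\<Sum>v\<in>{3..N}. (N - v) choose j) = (\<Sum>i\<le>N - 3. i choose j)"
      by (rule sum.reindex_bij_witness[where i="\<lambda>i. N - i" and j="\<lambda>v. N - v"]) (use N in auto)
    also have "\<dots> = Suc (N - 3) choose Suc j" by (rule sum_choose_upper)
    also have "Suc (N - 3) = N - 2" using N by simp
    finally show ?thesis .
  qed
  have "Suc (N - 2 - l) = N - 1 - l" using l by simp
  hence "card (tab_codes N l True) + ((N - 2) choose Suc l) + ((N - 2) choose (N - 1 - l))
      = (\<Sum>v\<in>{3..N}. card (G v) + ((N - v) choose l) + ((N - v) choose (N - 2 - l)))"
    unfolding cG sum.distrib hockey by simp
  also have "\<dots> = (\<Sum>v\<in>{3..N}. (N - 2) choose l)" by (rule sum.cong[OF refl]) (rule each)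
  also have "\<dots> = (N - 2) * ((N - 2) choose l)" by simp
  finally show ?thesis .
qed

text \<open>Both subtracted binomials in \<open>card_near_codes\<close> are rational multiples of
  \<open>(m - 1) choose k\<close>. With a + b = m + 1 the bracket (m - 1) - (a - 1) / b - (b - 1) /
  a factors, and the same weight as in \<open>trace_hook_proj\<close> appears.\<close>

lemma num_SYT_near_hook:
  assumes k: "1 \<le> k" "k + 2 \<le> m"
  shows "of_nat (num_SYT (near_hook (m - k) (k - 1)))
    = (of_nat m + 1) * ((arm m k - 1) * (leg k - 1) / (arm m k * leg k)) * of_nat ((m - 1) choose k)"
proof -
  interpret near_hook_shape "near_hook (m - k) (k - 1)" "m - k" "Suc (k - 1)" "m - k + (k - 1) + 2" True
    using k by (intro near_hook_shape) auto
  have e: "Suc (k - 1) = k" "m - k + (k - 1) + 2 = Suc m" using k by auto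
  have c: "num_SYT (near_hook (m - k) (k - 1)) = card (tab_codes (Suc m) k True)"
    unfolding num_SYT_def using bij_betw_same_card[OF tab_code_bij] unfolding e .
  define x where "x = (of_nat (card (tab_codes (Suc m) k True)) :: complex)"
  define y where "y = (of_nat ((m - 1) choose k) :: complex)"
  have "card (tab_codes (Suc m) k True) + ((m - 1) choose Suc k) + ((m - 1) choose (m - k))
      = (m - 1) * ((m - 1) choose k)"
    using card_near_codes[of "Suc m" k] k by simp
  hence "of_nat (card (tab_codes (Suc m) k True) + ((m - 1) choose Suc k) + ((m - 1) choose (m - k)))
      = (of_nat ((m - 1) * ((m - 1) choose k)) :: complex)" by (simp only:)
  hence "x + of_nat ((m - 1) choose (m - k)) + of_nat ((m - 1) choose Suc k) = of_nat (m - 1) * y"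
    by (simp only: x_def y_def of_nat_add of_nat_mult add_ac)
  hence s: "x = of_nat (m - 1) * y - of_nat ((m - 1) choose Suc k) - of_nat ((m - 1) choose (m - k))"
    by (simp only: eq_diff_eq)
  have lk: "leg k \<noteq> 0" "arm m k \<noteq> 0" using arm_leg_nonzero k by auto
  have 1: "of_nat ((m - 1) choose Suc k) = (arm m k - 1) * y / leg k"
  proof -
    have "Suc k * ((m - 1) choose Suc k) = (m - 1 - k) * ((m - 1) choose k)"
      using binomial_absorption[of k "m - 1"] binomial_absorb_comp[of "m - 1" k] by simp
    hence "of_nat (Suc k * ((m - 1) choose Suc k)) = (of_nat ((m - 1 - k) * ((m - 1) choose k)) :: complex)"
      by (simp only:)
    moreover have "of_nat (m - 1 - k) = arm m k - 1" using k by (simp add: arm_def of_nat_diff)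
    moreover have "of_nat (Suc k) = leg k" by (simp add: leg_def add.commute)
    ultimately have "leg k * of_nat ((m - 1) choose Suc k) = (arm m k - 1) * y"
      by (simp only: of_nat_mult y_def)
    thus ?thesis using lk by (simp add: nonzero_eq_divide_eq mult.commute)
  qed
  have 2: "of_nat ((m - 1) choose (m - k)) = (leg k - 1) * y / arm m k"
  proof -
    have "(m - 1) choose (m - k) = (m - 1) choose (k - 1)"
      using k by (subst binomial_symmetric) auto
    moreover have "(m - k) * ((m - 1) choose (k - 1)) = k * ((m - 1) choose k)"
      using binomial_absorption[of "k - 1" "m - 1"] binomial_absorb_comp[of "m - 1" "k - 1"] k by simp
    ultimately have "of_nat ((m - k) * ((m - 1) choose (m - k))) = (of_nat (k * ((m - 1) choose k)) :: complex)"
      by (simp only:)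
    moreover have "of_nat (m - k) = arm m k" using k by (simp add: arm_def of_nat_diff)
    moreover have "of_nat k = leg k - 1" by (simp add: leg_def)
    ultimately have "arm m k * of_nat ((m - 1) choose (m - k)) = (leg k - 1) * y"
      by (simp only: of_nat_mult y_def)
    thus ?thesis using lk by (simp add: nonzero_eq_divide_eq mult.commute)
  qed
  have m: "of_nat m = arm m k + leg k - 1" using arm_add_leg[of m k] by simp
  have m1: "of_nat (m - 1) = arm m k + leg k - 2" using k m by (simp add: of_nat_diff)
  have "x = (arm m k + leg k) * ((arm m k - 1) * (leg k - 1) / (arm m k * leg k)) * y"
    unfolding s 1 2 m1 using lk by (simp add: divide_simps) (simp add: algebra_simps)
  thus ?thesis unfolding c x_def y_def arm_add_leg by simp
qed


section \<open>Dipoles and seminormal units\<close>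

lemma bij_betw_Collect: "bij_betw f A B \<Longrightarrow> bij_betw f {x\<in>A. P (f x)} {y\<in>B. P y}"
  unfolding bij_betw_def inj_on_def by blast

text \<open>For k < m the first row has at least two boxes and is the only row of its length; n ends
  it exactly if n is not in the leg, that is, if the leg set is one of size m.\<close>

lemma Gamma_arm:
  assumes k: "k < m"
  shows "Gamma_elt (Suc m) (hook (Suc m - k) k) (Suc m - k) = galg_of (hookA m k)"
proof -
  let ?n = "Suc m" and ?a = "Suc m - k"
  have a: "?a \<ge> 1" "?a \<ge> 2" "?a + k = ?n" using k by auto
  interpret near_hook_shape "hook ?a k" ?a k "?a + k" False by (rule hook_shape[OF a(1)])
  have iff: "(\<exists>r<length (row_lengths (hook ?a k)). row_lengths (hook ?a k) ! r = ?a \<and> T (r, ?a - 1) = sum_mset (hook ?a k))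
      \<longleftrightarrow> ?n \<notin> tab_leg k T" if T: "T \<in> SYT (hook ?a k)" for T
  proof -
    have rows: "row_lengths (hook ?a k) = ?a # replicate k 1" by (rule row_lengths_hook[OF a(1)])
    have "(\<exists>r<length (row_lengths (hook ?a k)). row_lengths (hook ?a k) ! r = ?a \<and> T (r, ?a - 1) = sum_mset (hook ?a k))
        \<longleftrightarrow> T (0, ?a - 1) = ?n"
      unfolding rows size a(3) using a(2) by (auto simp: nth_Cons' less_Suc_eq_le split: if_splits)
    also have "\<dots> \<longleftrightarrow> ?n \<notin> tab_leg k T"
    proof
      assume "T (0, ?a - 1) = ?n"
      moreover have "T (0, ?a - 1) \<in> (\<lambda>c. T (0, c)) ` {..<?a}" using a by auto
      ultimately show "?n \<notin> tab_leg k T" unfolding tab_arm_eq[OF T] by simp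
    next
      assume "?n \<notin> tab_leg k T"
      hence "?n \<in> (\<lambda>c. T (0, c)) ` {..<?a}" unfolding tab_arm_eq[OF T] a(3) by (simp add: tab_inner_def)
      then obtain c where c: "c < ?a" "T (0, c) = ?n" by auto
      have "c = ?a - 1"
      proof (rule ccontr)
        assume "c \<noteq> ?a - 1"
        hence "T (0, c) < T (0, ?a - 1)" using c by (intro tab_arm_mono[OF T]) auto
        moreover have "T (0, ?a - 1) \<in> {1..?a + k}" using a by (intro tab_range[OF T]) (simp add: diag_def)
        ultimately show False using c a(3) by simp
      qed
      thus "T (0, ?a - 1) = ?n" using c by simp
    qed
    finally show ?thesis .
  qed
  have ends: "SYT_end (hook ?a k) ?a = {T\<in>SYT (hook ?a k). ?n \<notin> tab_leg k T}"
    unfolding SYT_end_def using iff by blast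
  have "{S\<in>leg_sets ?n k. ?n \<notin> S} = leg_sets m k"
    by (auto simp: leg_sets_def le_Suc_eq subset_iff)
  hence bij: "bij_betw (tab_leg k) (SYT_end (hook ?a k) ?a) (leg_sets m k)"
    using bij_betw_Collect[OF hook_leg_bij[OF a(1), of k], of "\<lambda>S. ?n \<notin> S"] unfolding a(3) ends by simp
  have "seminormal_unit ?n (hook ?a k) T = galg_of (hookE ?n (tab_leg k T))" if "T \<in> SYT (hook ?a k)" for T
    using box_content_leg_content[OF that] a(3) by (intro seminormal_unit_hook) (auto simp: tab_inner_def)
  hence "Gamma_elt ?n (hook ?a k) ?a = (\<lambda>\<rho>. \<Sum>T\<in>SYT_end (hook ?a k) ?a. galg_of (hookE ?n (tab_leg k T)) \<rho>)"
    unfolding Gamma_elt_def ends by (intro ext sum.cong) auto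
  also have "\<dots> = (\<lambda>\<rho>. \<Sum>S\<in>leg_sets m k. galg_of (hookE ?n S) \<rho>)"
    by (intro ext sum.reindex_bij_betw[OF bij])
  finally show ?thesis using k by (simp add: hook_proj_sum(1) galg_of_sum)
qed

lemma Gamma_leg:
  assumes k: "k < m"
  shows "Gamma_elt (Suc m) (hook (m - k) (Suc k)) 1 = galg_of (hookL m k)"
proof -
  let ?n = "Suc m" and ?a = "m - k" and ?l = "Suc k"
  have a: "?a \<ge> 1" "?a + ?l = ?n" using k by auto
  interpret near_hook_shape "hook ?a ?l" ?a ?l "?a + ?l" False by (rule hook_shape[OF a(1)])
  have iff: "(\<exists>r<length (row_lengths (hook ?a ?l)). row_lengths (hook ?a ?l) ! r = 1 \<and> T (r, 1 - 1) = sum_mset (hook ?a ?l))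
      \<longleftrightarrow> ?n \<in> tab_leg ?l T" if T: "T \<in> SYT (hook ?a ?l)" for T
  proof -
    have rows: "row_lengths (hook ?a ?l) = ?a # replicate ?l 1" by (rule row_lengths_hook[OF a(1)])
    show ?thesis unfolding rows size a(2)
    proof
      assume "\<exists>r<length (?a # replicate ?l 1). (?a # replicate ?l 1) ! r = 1 \<and> T (r, 1 - 1) = ?n"
      then obtain r where r: "r < Suc ?l" "T (r, 0) = ?n" by auto
      \<comment> \<open>If the arm is a single box, the first row has length 1 as well, but the
        corner contains 1.\<close>
      have "r \<noteq> 0" using r tab_corner[OF T] k by (cases "r = 0") auto
      thus "?n \<in> tab_leg ?l T" unfolding tab_leg_def using r by (intro image_eqI[of _ _ r]) auto
    next
      assume "?n \<in> tab_leg ?l T"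
      then obtain r where "r \<in> {1..?l}" "T (r, 0) = ?n" by (auto simp: tab_leg_def)
      thus "\<exists>r<length (?a # replicate ?l 1). (?a # replicate ?l 1) ! r = 1 \<and> T (r, 1 - 1) = ?n"
        by (intro exI[of _ r]) (auto simp: nth_Cons' simp del: replicate_Suc)
    qed
  qed
  have ends: "SYT_end (hook ?a ?l) 1 = {T\<in>SYT (hook ?a ?l). ?n \<in> tab_leg ?l T}"
    unfolding SYT_end_def using iff by blast
  have notin: "?n \<notin> S" "finite S" if "S \<in> leg_sets m k" for S
    using that by (auto simp: leg_sets_def intro: finite_subset)
  have img: "{S\<in>leg_sets ?n ?l. ?n \<in> S} = insert ?n ` leg_sets m k"
  proof (intro set_eqI iffI)
    fix S assume S: "S \<in> {S\<in>leg_sets ?n ?l. ?n \<in> S}"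
    have "S - {?n} \<in> leg_sets m k" using S by (auto simp: leg_sets_def)
    moreover have "S = insert ?n (S - {?n})" using S by blast
    ultimately show "S \<in> insert ?n ` leg_sets m k" by (metis image_eqI)
  next
    fix S assume "S \<in> insert ?n ` leg_sets m k"
    then obtain S' where S': "S' \<in> leg_sets m k" "S = insert ?n S'" by blast
    have "S' \<subseteq> {2..m}" "card S' = k" using S'(1) by (auto simp: leg_sets_def)
    thus "S \<in> {S\<in>leg_sets ?n ?l. ?n \<in> S}"
      using notin[OF S'(1)] k S'(2) by (auto simp: leg_sets_def)
  qed
  have bij: "bij_betw (tab_leg ?l) (SYT_end (hook ?a ?l) 1) (insert ?n ` leg_sets m k)"
    using bij_betw_Collect[OF hook_leg_bij[OF a(1), of ?l], of "\<lambda>S. ?n \<in> S"]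
    unfolding a(2) ends img[symmetric] .
  have inj: "inj_on (insert ?n) (leg_sets m k)"
    using notin(1) by (intro inj_onI) (metis insert_ident)
  have "seminormal_unit ?n (hook ?a ?l) T = galg_of (hookE ?n (tab_leg ?l T))" if "T \<in> SYT (hook ?a ?l)" for T
    using box_content_leg_content[OF that] a(2) by (intro seminormal_unit_hook) (auto simp: tab_inner_def)
  hence "Gamma_elt ?n (hook ?a ?l) 1 = (\<lambda>\<rho>. \<Sum>T\<in>SYT_end (hook ?a ?l) 1. galg_of (hookE ?n (tab_leg ?l T)) \<rho>)"
    unfolding Gamma_elt_def ends by (intro ext sum.cong) auto
  also have "\<dots> = (\<lambda>\<rho>. \<Sum>S\<in>insert ?n ` leg_sets m k. galg_of (hookE ?n S) \<rho>)"
    by (intro ext sum.reindex_bij_betw[OF bij])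
  also have "\<dots> = (\<lambda>\<rho>. \<Sum>S\<in>leg_sets m k. galg_of (hookE ?n (insert ?n S)) \<rho>)"
    by (simp add: sum.reindex[OF inj])
  finally show ?thesis using k by (simp add: hook_proj_sum(2) galg_of_sum)
qed

lemma Gamma_inner:
  assumes k: "1 \<le> k" "k + 2 \<le> m"
  shows "Gamma_elt (Suc m) (near_hook (m - k) (k - 1)) 2 = galg_of (hookZ m k)"
proof -
  let ?n = "Suc m" and ?a = "m - k"
  let ?lam = "near_hook ?a (k - 1)"
  have a: "?a \<ge> 2" "?a + (k - 1) + 2 = ?n" "Suc (k - 1) = k" using k by auto
  interpret near_hook_shape ?lam ?a k ?n True
    using near_hook_shape[OF a(1), of "k - 1"] unfolding a(2,3) .
  have iff: "(\<exists>r<length (row_lengths ?lam). row_lengths ?lam ! r = 2 \<and> T (r, 2 - 1) = sum_mset ?lam)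
      \<longleftrightarrow> T (1, 1) = ?n" if T: "T \<in> SYT ?lam" for T
  proof -
    have rows: "row_lengths ?lam = ?a # 2 # replicate (k - 1) 1" by (rule row_lengths_near_hook[OF a(1)])
    have "(1, 1) \<in> diag ?a k True" by (simp add: diag_def)
    hence "T (1, 1) \<in> {1..?n}" by (rule tab_range[OF T])
    \<comment> \<open>If the first row also has length 2, its last entry is still smaller than the
      inner one and cannot be n.\<close>
    hence "T (0, 1) \<noteq> ?n" using tab_inner_gt[OF T] by auto
    moreover have "r = 0 \<or> r = 1" if "r < length (?a # 2 # replicate (k - 1) (1::nat))"
      "(?a # 2 # replicate (k - 1) 1) ! r = 2" for r
      using that by (auto simp: nth_Cons' split: if_splits)
    ultimately have "T (1, 1) = ?n" if "\<exists>r<length (?a # 2 # replicate (k - 1) (1::nat)).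
        (?a # 2 # replicate (k - 1) 1) ! r = 2 \<and> T (r, 2 - 1) = ?n"
      using that by (metis diff_Suc_1 numeral_2_eq_2 One_nat_def)
    moreover have "(?a # 2 # replicate (k - 1) (1::nat)) ! 1 = 2" by simp
    ultimately show ?thesis unfolding rows size by fastforce
  qed
  have ends: "SYT_end ?lam 2 = {T\<in>SYT ?lam. tab_inner True T = {?n}}"
    unfolding SYT_end_def using iff by (auto simp: tab_inner_def)
  have codes: "{q\<in>tab_codes ?n k True. fst q = {?n}} = Pair {?n} ` leg_sets m k"
  proof (intro set_eqI iffI)
    fix q assume "q \<in> {q\<in>tab_codes ?n k True. fst q = {?n}}"
    then obtain S where S: "q = ({?n}, S)" "S \<subseteq> {2..?n} - {?n}" "card S = k"
      by (cases q) (auto simp: tab_codes_def)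
    have "S \<subseteq> {2..m}" using S(2) by auto
    thus "q \<in> Pair {?n} ` leg_sets m k" using S by (auto simp: leg_sets_def)
  next
    fix q assume "q \<in> Pair {?n} ` leg_sets m k"
    then obtain S where S: "q = ({?n}, S)" "S \<subseteq> {2..m}" "card S = k" by (auto simp: leg_sets_def)
    \<comment> \<open>With n in the inner box, the conditions of \<open>tab_codes\<close> say that S
      is nonempty and misses some point of \<open>{2..m}\<close>; the bounds on k grant
      both.\<close>
    have "S \<noteq> {}" using S(3) k by auto
    then obtain x where x: "x \<in> S" by blast
    have "card {2..m} = m - 1" by simp
    hence "S \<noteq> {2..m}" using S(3) k by auto
    then obtain y where y: "y \<in> {2..m}" "y \<notin> S" using S(2) by blast
    have "x < ?n" using x S(2) by auto
    moreover have "y < ?n" "y \<in> {2..?n} - S - {?n}" using y by auto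
    ultimately show "q \<in> {q\<in>tab_codes ?n k True. fst q = {?n}}"
      using x S k by (fastforce simp: tab_codes_def)
  qed
  have "bij_betw (\<lambda>T. (tab_inner True T, tab_leg k T)) (SYT_end ?lam 2) (Pair {?n} ` leg_sets m k)"
    using bij_betw_Collect[OF tab_code_bij, of "\<lambda>q. fst q = {?n}"] unfolding ends codes by simp
  hence "bij_betw (snd \<circ> (\<lambda>T. (tab_inner True T, tab_leg k T))) (SYT_end ?lam 2) (leg_sets m k)"
    by (rule bij_betw_trans) (auto simp: bij_betw_def inj_on_def image_image)
  hence bij: "bij_betw (tab_leg k) (SYT_end ?lam 2) (leg_sets m k)" by (simp add: o_def)
  have unit: "seminormal_unit ?n ?lam T = galg_of (hookE0 m (tab_leg k T))" if T: "T \<in> SYT_end ?lam 2" for T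
  proof (rule seminormal_unit_near_hook)
    have T': "T \<in> SYT ?lam" and v: "tab_inner True T = {?n}" using T ends by auto
    have "tab_leg k T \<in> leg_sets m k" using bij T by (auto simp: bij_betw_def)
    hence l: "legs (tab_leg k T) m = k" by (rule legs_leg_sets)
    show "1 \<le> legs (tab_leg k T) m" "legs (tab_leg k T) m \<le> m - 2" using l k by linarith+
    show "m \<ge> 1" using k by simp
    show "of_int (box_content ?lam T j) = leg_content (tab_leg k T) j" if "j \<in> {1..m}" for j
      using that v by (intro box_content_leg_content[OF T']) auto
    have "(1, 1) \<in> diag ?a k True" by (simp add: diag_def)
    from box_content_box[OF T' this] show "box_content ?lam T (Suc m) = 0"
      using v by (simp add: tab_inner_def)
  qed
  have "Gamma_elt ?n ?lam 2 = (\<lambda>\<rho>. \<Sum>T\<in>SYT_end ?lam 2. galg_of (hookE0 m (tab_leg k T)) \<rho>)"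
    unfolding Gamma_elt_def by (intro ext sum.cong refl) (simp only: unit)
  also have "\<dots> = (\<lambda>\<rho>. \<Sum>S\<in>leg_sets m k. galg_of (hookE0 m S) \<rho>)"
    by (intro ext sum.reindex_bij_betw[OF bij])
  finally show ?thesis using k by (simp add: hook_proj_sum(3) galg_of_sum)
qed

lemma hook_proj_near_central:
  assumes "k < m"
  shows "hookA m k \<in> cent m" "hookL m k \<in> cent m" "hookZ m k \<in> cent m"
    "hookA m k \<in> alg (Suc m)" "hookL m k \<in> alg (Suc m)" "hookZ m k \<in> alg (Suc m)"
  using hookF_cent[OF assms] JM_cent[of m] alg_mono[OF _ hookF_alg, of m "Suc m" k] JM_alg[of "Suc m" "Suc m"]
  by (simp_all add: proj_cent proj_alg)

text \<open>Comparing coefficients of the identity in \<open>near_elt * x\<close> shows that each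
  coefficient of x is a multiple of its trace. Used for the parts \<open>hookZ m k\<close> whose
  near-hook does not exist.\<close>

lemma near_central_trace_zero:
  assumes x: "x \<in> cent m" "x \<in> alg (Suc m)" and 0: "coef x 0 = 0"
    and sc: "\<And>X. X \<in> alg (Suc m) \<Longrightarrow> X \<in> cent m \<Longrightarrow> \<exists>\<kappa>. X * x = \<kappa> *\<^sub>C x"
  shows "x = 0"
proof (rule sga_eqI)
  fix g
  show "coef x g = coef 0 g"
  proof (cases "g \<in> Sn (Suc m)")
    case True
    define \<pi> where "\<pi> = perm_fun g"
    let ?l = "cycle_type (Suc m) \<pi>" and ?i = "card (orbit \<pi> (Suc m))"
    have p: "\<pi> \<in> near_class (Suc m) ?l ?i" using True by (simp add: near_class_def \<pi>_def Sn_iff)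
    obtain \<kappa> where "near_elt (Suc m) ?l ?i * x = \<kappa> *\<^sub>C x"
      using sc[OF near_elt_alg near_elt_cent] by blast
    hence "of_nat (card (near_class (Suc m) ?l ?i)) * galg_of x \<pi> = 0"
      using trace_near_elt[OF x(1) p] 0 by simp
    moreover have "card (near_class (Suc m) ?l ?i) \<noteq> 0" using p finite_near_class by auto
    ultimately show ?thesis by (simp add: \<pi>_def)
  next
    case False
    thus ?thesis using coef_alg_eq_0[OF x(2)] by simp
  qed
qed

lemma gamma_coeff_eq:
  assumes "Gamma_elt (Suc m) \<nu> l = galg_of x" "x \<in> cent m" "x \<in> alg (Suc m)"
    and "\<mu> \<in> partitions (Suc m)" "j \<in># \<mu>" "\<pi> \<in> near_class (Suc m) \<mu> j"
  shows "gamma_coeff (Suc m) \<nu> l \<mu> j = fact (Suc m) / of_nat (num_SYT \<nu>) * galg_of x \<pi>"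
  unfolding gamma_coeff_def assms(1) K_coeff_eq[OF assms(2,3) refl assms(4-6)] ..

text \<open>With \<open>d\<close> and \<open>D\<close> the dimensions of the hook of size \<open>m\<close> and of the shape of size
  \<open>m + 1\<close> containing it, and \<open>w = D / ((m + 1) d)\<close>, the trace of the idempotent is
  \<open>d\<^sup>2 w / m!\<close>.\<close>

lemma dipole_term:
  assumes x: "x \<in> cent m" and \<pi>: "\<pi> \<in> near_class (Suc m) lam i"
    and sc: "\<exists>\<kappa>. near_elt (Suc m) lam i * x = \<kappa> *\<^sub>C x"
    and tr: "coef x 0 = d ^ 2 / fact m * w" and d: "d \<noteq> 0" and w: "w \<noteq> 0"
    and D: "D = (of_nat m + 1) * w * d" and R: "R = (of_nat m + 1) * w"
    and om: "om = s * fact (m - 1) / d"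
  shows "of_nat (card (near_class (Suc m) lam i)) * fact (m - 1) / fact (Suc m)
      * (s * (fact (Suc m) / D * galg_of x \<pi>) * (fact (Suc m) / D * coef x r) / d * R)
    = om * coef (near_elt (Suc m) lam i * x) r"
proof -
  define N where "N = (of_nat (card (near_class (Suc m) lam i)) :: complex)"
  obtain \<kappa> where k: "near_elt (Suc m) lam i * x = \<kappa> *\<^sub>C x" using sc by blast
  have "\<kappa> * (d ^ 2 / fact m * w) = N * galg_of x \<pi>"
    using trace_near_elt[OF x \<pi>] tr by (simp add: k N_def)
  hence kap: "\<kappa> = N * galg_of x \<pi> * fact m / (d ^ 2 * w)"
    using d w by (simp add: field_simps)
  have m1: "(of_nat m + 1 :: complex) \<noteq> 0" by (metis of_nat_Suc of_nat_neq_0 add.commute)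
  have f: "fact (Suc m) = (of_nat m + 1) * (fact m :: complex)" by (simp add: algebra_simps)
  have "N * fact (m - 1) / fact (Suc m)
      * (s * (fact (Suc m) / D * galg_of x \<pi>) * (fact (Suc m) / D * coef x r) / d * R)
    = om * (\<kappa> * coef x r)"
    unfolding kap D R om f using d w m1 by (simp add: power2_eq_square mult_ac)
  thus ?thesis by (simp add: k N_def)
qed

text \<open>Origin of the sign, of the factor (n - 2)! and of the denominators d in the
  formula.\<close>

lemma hook_eig_binomial:
  assumes "k < m"
  shows "hook_eig m k = (-1) ^ k * fact (m - 1) / of_nat ((m - 1) choose k)"
proof -
  have "fact k * fact (m - 1 - k) * ((m - 1) choose k) = (fact (m - 1) :: nat)"
    using assms by (intro binomial_fact_lemma) simp
  hence "of_nat (fact k * fact (m - 1 - k) * ((m - 1) choose k)) = (of_nat (fact (m - 1)) :: complex)"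
    by (simp only:)
  hence "fact (m - 1) = fact k * fact (m - 1 - k) * (of_nat ((m - 1) choose k) :: complex)"
    by (simp only: of_nat_mult of_nat_fact)
  moreover have "(m - 1) choose k \<noteq> 0" using assms by simp
  ultimately show ?thesis by (simp add: hook_eig_def)
qed

theorem mainTheorem7:
  fixes n p i :: nat and lam :: "nat multiset"
  assumes "lam \<in> partitions n"
    and "i \<in># lam"
    and "1 \<le> p" and "p \<le> n - 1"
  shows "(of_nat (card (dipoles n p lam i)) :: complex) =
    of_nat (card (near_class n lam i)) * fact (n - 2) / fact n
      * (A_sum n p lam i + B_sum n p lam i + C_sum n p lam i)"
proof (cases "near_class n lam i = {}")
  \<comment> \<open>If the class is empty both sides are 0; otherwise it contains a representative
    at which coefficients can be read off.\<close>
  case True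
  thus ?thesis by (simp add: dipoles_def)
next
  case False
  then obtain \<pi> where \<pi>: "\<pi> \<in> near_class n lam i" by blast
  define m where "m = n - 1"
  have n: "n = Suc m" and m: "m \<ge> 1" and p: "1 \<le> p" "p \<le> m" using assms by (auto simp: m_def)
  define r where "r = root_elt m p"
  let ?K = "near_elt n lam i"
  let ?c = "of_nat (card (near_class n lam i)) * fact (m - 1) / fact n :: complex"
  have rn: "perm_fun r \<in> near_class n {#p, n - p#} p"
    unfolding r_def n by (rule root_elt_near_class[OF p])
  have pp: "{#p, n - p#} \<in> partitions n" "p \<in># {#p, n - p#}"
    using p n by (auto simp: partitions_def)
  have K: "?K \<in> alg (Suc m)" "?K \<in> cent m"
    unfolding n by (rule near_elt_alg, rule near_elt_cent)
  note scalar = near_central_scalar[OF m K]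
  note \<pi>' = \<pi>[unfolded n]
  \<comment> \<open>The second coefficient is evaluated at r, a representative of the class of
    \<open>{#p, n - p#}\<close> with mark p.\<close>
  have ga: "gamma_coeff n \<nu> l lam i = fact n / of_nat (num_SYT \<nu>) * galg_of x \<pi>"
      "gamma_coeff n \<nu> l {#p, n - p#} p = fact n / of_nat (num_SYT \<nu>) * coef x r"
    if "Gamma_elt n \<nu> l = galg_of x" "x \<in> cent m" "x \<in> alg (Suc m)" for \<nu> l x
    using gamma_coeff_eq[of m \<nu> l x lam i \<pi>] gamma_coeff_eq[of m \<nu> l x "{#p, n - p#}" p "perm_fun r"]
      that assms(1,2) \<pi> rn pp n by simp_all
  have om: "hook_eig m k = (-1) ^ k * fact (m - 1) / of_nat ((m - 1) choose k)" if "k < m" for k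
    using hook_eig_binomial[OF that] .
  have d0: "of_nat ((m - 1) choose k) \<noteq> (0 :: complex)" if "k < m" for k using that by simp
  have n0: "of_nat m + 1 \<noteq> (0::complex)" by (metis of_nat_Suc of_nat_neq_0 add.commute)
  have numd: "num_SYT (hook (m - k) k) = (m - 1) choose k" if "k < m" for k
    using num_SYT_hook[of "m - k" k] that by simp
  have binA: "of_nat (m choose k) = (of_nat m / arm m k :: complex) * of_nat ((m - 1) choose k)" if k: "k < m" for k
  proof -
    have "of_nat ((m - k) * (m choose k)) = (of_nat (m * ((m - 1) choose k)) :: complex)"
      by (simp only: binomial_absorb_comp)
    thus ?thesis using k arm_leg_nonzero(1)[OF k] by (simp add: arm_def of_nat_diff field_simps)
  qed
  have binL: "of_nat (m choose Suc k) = (of_nat m / leg k :: complex) * of_nat ((m - 1) choose k)" for k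
  proof -
    have "of_nat (Suc k * (m choose Suc k)) = (of_nat (m * ((m - 1) choose k)) :: complex)"
      by (simp only: binomial_absorption)
    hence "leg k * of_nat (m choose Suc k) = of_nat m * (of_nat ((m - 1) choose k) :: complex)"
      by (simp add: leg_def algebra_simps)
    thus ?thesis using arm_leg_nonzero(2)[of k] by (simp add: nonzero_eq_divide_eq mult.commute)
  qed
  have A: "?c * A_sum n p lam i = (\<Sum>k<m. hook_eig m k * coef (?K * hookA m k) r)"
  proof -
    have idx: "{0..n - 2} = {..<m}" using n m by auto
    show ?thesis unfolding A_sum_def sum_distrib_left idx
    proof (rule sum.cong[OF refl], goal_cases)
      case (1 k)
      hence k: "k < m" by simp
      have G: "Gamma_elt n (hook (n - k) k) (n - k) = galg_of (hookA m k)"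
        unfolding n by (rule Gamma_arm[OF k])
      have num: "num_SYT (hook (n - k) k) = m choose k"
        using num_SYT_hook[of "n - k" k] k n by simp
      have num': "num_SYT (hook (n - k - 1) k) = (m - 1) choose k" using numd[OF k] n by simp
      \<comment> \<open>This factor is D / d, the quotient of the numbers of tableaux of the hook
        and of the hook with its arm shortened by one box.\<close>
      have ratio: "of_nat (n - 1) / of_nat (n - k - 1) = (of_nat m / arm m k :: complex)"
        using k n by (simp add: arm_def of_nat_diff)
      show ?case
        unfolding ga[OF G hook_proj_near_central(1,4)[OF k]] num num' ratio
        unfolding n
      proof (rule dipole_term[OF _ \<pi>' _ _ d0[OF k]])
        show "coef (hookA m k) 0 = (of_nat ((m - 1) choose k)) ^ 2 / fact m
            * (of_nat m / (arm m k * (of_nat m + 1)))"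
          by (rule trace_hook_proj(1)[OF k])
        show "of_nat m / (arm m k * (of_nat m + 1)) \<noteq> 0"
          using m n0 arm_leg_nonzero(1)[OF k] by simp
        show "of_nat (m choose k) = (of_nat m + 1) * (of_nat m / (arm m k * (of_nat m + 1)))
            * of_nat ((m - 1) choose k)"
          using n0 by (simp add: binA[OF k])
        show "of_nat m / arm m k = (of_nat m + 1) * (of_nat m / (arm m k * (of_nat m + 1)))"
          using n0 by simp
      qed (use scalar[unfolded n] hook_proj_near_central[OF k] om[OF k] in auto)
    qed
  qed
  have B: "?c * B_sum n p lam i = (\<Sum>k<m. hook_eig m k * coef (?K * hookL m k) r)"
  proof -
    \<comment> \<open>The k-th summand of \<open>B_sum\<close> stems from the hook of size m with
      leg k - 1.\<close>
    have idx: "{1..n - 1} = Suc ` {..<m}" using n by (simp add: image_Suc_lessThan)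
    show ?thesis unfolding B_sum_def sum_distrib_left idx sum.reindex[OF inj_Suc] o_def
    proof (rule sum.cong[OF refl], goal_cases)
      case (1 k)
      hence k: "k < m" by simp
      have e: "n - Suc k = m - k" "Suc k - 1 = k" "n - 1 = m" using n by auto
      have G: "Gamma_elt n (hook (m - k) (Suc k)) 1 = galg_of (hookL m k)"
        unfolding n by (rule Gamma_leg[OF k])
      have num: "num_SYT (hook (m - k) (Suc k)) = m choose Suc k"
        using num_SYT_hook[of "m - k" "Suc k"] k by simp
      have ratio: "of_nat m / of_nat (Suc k) = (of_nat m / leg k :: complex)"
        by (simp add: leg_def add.commute)
      show ?case
        unfolding e ga[OF G hook_proj_near_central(2,5)[OF k]] num numd[OF k] ratio
        unfolding n
      proof (rule dipole_term[OF _ \<pi>' _ _ d0[OF k]])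
        show "coef (hookL m k) 0 = (of_nat ((m - 1) choose k)) ^ 2 / fact m
            * (of_nat m / (leg k * (of_nat m + 1)))"
          by (rule trace_hook_proj(2)[OF k])
        show "of_nat m / (leg k * (of_nat m + 1)) \<noteq> 0"
          using m n0 arm_leg_nonzero(2)[of k] by simp
        show "of_nat (m choose Suc k) = (of_nat m + 1) * (of_nat m / (leg k * (of_nat m + 1)))
            * of_nat ((m - 1) choose k)"
          using n0 by (simp add: binL)
        show "of_nat m / leg k = (of_nat m + 1) * (of_nat m / (leg k * (of_nat m + 1)))"
          using n0 by simp
      qed (use scalar[unfolded n] hook_proj_near_central[OF k] om[OF k] in auto)
    qed
  qed
  have C: "?c * C_sum n p lam i = (\<Sum>k<m. hook_eig m k * coef (?K * hookZ m k) r)"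
  proof -
    have "?c * C_sum n p lam i = (\<Sum>k\<in>{1..n - 3}. hook_eig m k * coef (?K * hookZ m k) r)"
      unfolding C_sum_def sum_distrib_left
    proof (rule sum.cong[OF refl], goal_cases)
      case (1 k)
      hence k1: "1 \<le> k" "k + 2 \<le> m" and k: "k < m" using n by auto
      have e: "n - k - 1 = m - k" using n by simp
      have G: "Gamma_elt n (near_hook (m - k) (k - 1)) 2 = galg_of (hookZ m k)"
        unfolding n by (rule Gamma_inner[OF k1])
      have nz: "arm m k - 1 \<noteq> 0" "leg k - 1 \<noteq> 0"
      proof -
        have "arm m k - 1 = of_nat (m - 1 - k)" using k by (simp add: arm_def of_nat_diff)
        moreover have "m - 1 - k \<noteq> 0" using k1 by simp
        ultimately show "arm m k - 1 \<noteq> 0" by (simp only: of_nat_eq_0_iff not_False_eq_True)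
        show "leg k - 1 \<noteq> 0" using k1 by (simp add: leg_def)
      qed
      have ratio: "of_nat (n * k * (n - k - 2)) / of_nat ((m - k) * (k + 1))
          = (of_nat m + 1) * ((arm m k - 1) * (leg k - 1) / (arm m k * leg k))"
      proof -
        have "of_nat (n - k - 2) = arm m k - 1" "of_nat k = leg k - 1" "of_nat (m - k) = arm m k"
            "of_nat (k + 1) = leg k" "of_nat n = (of_nat m + 1 :: complex)"
          using k k1 n by (auto simp: arm_def leg_def of_nat_diff)
        thus ?thesis by (simp only: of_nat_mult times_divide_eq_right mult_ac)
      qed
      show ?case
        unfolding e ga[OF G hook_proj_near_central(3,6)[OF k]] numd[OF k] ratio
        unfolding n
      proof (rule dipole_term[OF _ \<pi>' _ _ d0[OF k]])
        show "coef (hookZ m k) 0 = (of_nat ((m - 1) choose k)) ^ 2 / fact m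
            * ((arm m k - 1) * (leg k - 1) / (arm m k * leg k))"
          by (rule trace_hook_proj(3)[OF k])
        show "(arm m k - 1) * (leg k - 1) / (arm m k * leg k) \<noteq> 0"
          using nz arm_leg_nonzero(1)[OF k] arm_leg_nonzero(2)[of k] by simp
        show "of_nat (num_SYT (near_hook (m - k) (k - 1)))
          = (of_nat m + 1) * ((arm m k - 1) * (leg k - 1) / (arm m k * leg k)) * of_nat ((m - 1) choose k)"
          by (rule num_SYT_near_hook[OF k1])
      qed (use scalar[unfolded n] hook_proj_near_central[OF k] om[OF k] in auto)
    qed
    \<comment> \<open>Only k = 0 and k = m - 1 are added. There no inner box fits, the identity
      coefficient of \<open>hookZ m k\<close> is 0, and the whole element vanishes with it.\<close>
    also have "\<dots> = (\<Sum>k<m. hook_eig m k * coef (?K * hookZ m k) r)"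
    proof (rule sum.mono_neutral_left)
      show "\<forall>k\<in>{..<m} - {1..n - 3}. hook_eig m k * coef (?K * hookZ m k) r = 0"
      proof
        fix k assume k': "k \<in> {..<m} - {1..n - 3}"
        hence k: "k < m" by simp
        have "k = 0 \<or> k = m - 1" using k' n by auto
        hence "arm m k - 1 = 0 \<or> leg k - 1 = 0" using m by (auto simp: arm_def leg_def of_nat_diff)
        hence "coef (hookZ m k) 0 = 0" unfolding trace_hook_proj(3)[OF k] by auto
        hence "hookZ m k = 0"
          using hook_proj_near_central[OF k] near_central_scalar(3)[OF m]
          by (intro near_central_trace_zero[of _ m]) auto
        thus "hook_eig m k * coef (?K * hookZ m k) r = 0" by simp
      qed
    qed (use n in auto)
    finally show ?thesis .
  qed
  have "of_nat (card (dipoles n p lam i)) = coef (JM_prod m * ?K) r"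
    unfolding r_def coef_JM_prod_near_elt[OF m] n card_dipoles[OF m] ..
  also have "JM_prod m * ?K = ?K * JM_prod m"
    by (rule cent_commute[OF K(2) JM_prod_alg])
  also have "\<dots> = (\<Sum>k<m. hook_eig m k *\<^sub>C (?K * hookF m k))"
    by (simp add: JM_prod_hookF[OF m] sum_distrib_left)
  also have "\<dots> = (\<Sum>k<m. hook_eig m k *\<^sub>C (?K * hookA m k + ?K * hookL m k + ?K * hookZ m k))"
    by (subst hookF_split) (simp only: distrib_left)
  finally have "of_nat (card (dipoles n p lam i)) = ?c * A_sum n p lam i + ?c * B_sum n p lam i + ?c * C_sum n p lam i"
    unfolding A B C by (simp only: lookup_sum coef_scl lookup_add distrib_left sum.distrib)
  moreover have "n - 2 = m - 1" using n by simp
  ultimately show ?thesis by (simp only: distrib_left)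
qed

end
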